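(* Let $\mathbf k$ be an arbitrary field and $n\ge1$. For each $i\in\{0,1,\dots,n-1\}$, there is an $\mathfrak S_n$-module isomorphism $$\phi:\mathcal{L}ie_2(n,i)\to\tilde H^{n-3}((\hat 0,[n]^i);\mathbf k)\otimes\operatorname{sgn}_n$$ determined by $$\phi([T,\sigma])=\operatorname{sgn}(\sigma)\operatorname{sgn}(T)\,\bar c(T,\sigma)\qquad\text{for all }(T,\sigma)\in\mathcal{BT}_{n,i}.$$
   Context: Poset. Let $[n]=\{1,\dots,n\}$. A weighted partition of $[n]$ is a set $\{B_1^{v_1},\dots,B_t^{v_t}\}$ where $\{B_1,\dots,B_t\}$ is a partition of $[n]$ and $v_i\in\{0,1,\dots,|B_i|-1\}$. The poset $\Pi_n^w$ is the set of weighted partitions of $[n]$ ordered by: $\{A_1^{w_1},\dots,A_s^{w_s}\}\le\{B_1^{v_1},\dots,B_t^{v_t}\}$ iff $\{A_j\}$ refines $\{B_k\}$ and whenever $B_k=A_{i_1}\cup\cdots\cup A_{i_l}$, then $v_k-(w_{i_1}+\cdots+w_{i_l})\in\{0,\dots,l-1\}$. Its minimum is $\hat 0=\{\{1\}^0,\dots,\{n\}^0\}$ and its maximal elements are $[n]^i:=\{[n]^i\}$, $0\le i\le n-1$. $\mathfrak S_n$ acts on $\Pi_n^w$ by replacing each element $x$ of each block by $\sigma(x)$ (weights unchanged); this preserves the order and fixes each $[n]^i$, so it acts on chains of $(\hat 0,[n]^i)$ and on cohomology. Cohomology. For a finite poset $P$ the reduced cochain module $C_r(P)$ is the $\mathbf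 k$-vector space with basis the chains $\alpha_0<\cdots<\alpha_r$ ($C_{-1}$ is spanned by the empty chain), with $\delta_r(\alpha_0<\cdots<\alpha_r)=\sum_{i=0}^{r+1}(-1)^i\sum_{\alpha\in(\alpha_{i-1},\alpha_i)}(\alpha_0<\cdots<\alpha_{i-1}<\alpha<\alpha_i<\cdots<\alpha_r)$, where $\alpha_{-1},\alpha_{r+1}$ are an adjoined minimum and maximum; $\tilde H^r(P)=\ker\delta_r/\operatorname{im}\delta_{r-1}$. Maximal chains are identified with their classes in top cohomology. For a degenerate interval, $\tilde H^r((x,x))=\mathbf k$ if $r=-2$ and $0$ otherwise. Lie side. A Lie bracket on a vector space is a bilinear product that is antisymmetric and satisfies the Jacobi identity. Two Lie brackets $[\cdot,\cdot]$ (blue) and $\langle\cdot,\cdot\rangle$ (red) on one space are compatible if every linear combination of them is a Lie bracket; equivalently they satisfy the mixed Jacobi relation $[x,\langle y,z\rangle]+[z,\langle x,y\rangle]+[y,\langle z,x\rangle]+\langle x,[y,z]\rangle+\langle z,[x,y]\rangle+\langle y,[z,x]\rangle=0$. $\mathcal{L}ie_2(n)$ is the multilinear component (spanned by bracketings, using both brackets, containing each element of $[n]$ exactly once, called bracketed permutations) of the free Lie algebra over $\mathbf k$ on $[n]$ with two compatible brackets, i.e. subject only to antisymmetry and Jacobi for each bracket and mixed Jacobi. $\mathcal{L}ie_2(n,i)$ is the subspace generated by bracketed permutations with exactly $i$ red and $n-1-i$ blue brackets. $\mathfrak S_n$ acts by replacing each letter $x$ by $\sigma(x)$. Trees. A bicolored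 binary tree is a complete plane binary tree (every internal node has a left and a right child) with each internal node colored red or blue. $\mathcal{BT}_{n,i}$ is the set of pairs $(T,\sigma)$ with $T$ a bicolored binary tree with $n$ leaves and $i$ red internal nodes, and $\sigma\in\mathfrak S_n$, where the $j$th leaf of $T$ from left to right is labeled $\sigma(j)$. $[T,\sigma]$ is defined recursively: if $T$ is a single leaf it is the leaf's label; otherwise, with left and right labeled subtrees $(T_1,\sigma_1),(T_2,\sigma_2)$, it is $[[T_1,\sigma_1],[T_2,\sigma_2]]$ (blue bracket) if the root is blue and $\langle[T_1,\sigma_1],[T_2,\sigma_2]\rangle$ (red bracket) if the root is red. $I(T)$ is the set of internal nodes of $T$. The sign of $T$ (ignoring colors) is defined recursively: $\operatorname{sgn}(T)=1$ if $I(T)=\emptyset$, and $\operatorname{sgn}(T)=(-1)^{|I(T_2)|}\operatorname{sgn}(T_1)\operatorname{sgn}(T_2)$ if $T$ has left subtree $T_1$ and right subtree $T_2$. $\operatorname{sgn}(\sigma)$ is the sign of the permutation; $\operatorname{sgn}_n$ is the sign representation of $\mathfrak S_n$, and the underlying space of $M\otimes\operatorname{sgn}_n$ is identified with $M$. Chains. Put $u(\text{blue})=0$, $u(\text{red})=1$. To $u$-merge two blocks $A^{a},B^{b}$ means to replace them by $(A\cup B)^{a+b+u}$. Postorder lists the internal nodes of the left subtree (recursively in postorder), then those of the right subtree, then the root. For $(T,\sigma)\in\mathcal{BT}_{n,i}$, $c(T,\sigma)$ is the maximal chain of $[\hat 0,[n]^i]$ starting at $\hat 0$ whose rank $k$ element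 is obtained from its rank $k-1$ element by $u(\mathrm{col}_k)$-merging the blocks whose underlying sets are the leaf label sets of the left and right subtrees of the $k$th internal node in postorder, $\mathrm{col}_k$ being the color of that node. $\bar c(T,\sigma)=c(T,\sigma)\setminus\{\hat 0,[n]^i\}$ (for $n=1$, read as the generator of $\tilde H^{-2}$). *)

theory Defs
  imports
    Complex_Main
    "HOL-Library.Poly_Mapping"
    "HOL-Library.Set_Algebras"
    "HOL-Library.Disjoint_Sets"
    "HOL-Combinatorics.Permutations"
begin

section \<open>Free vector spaces and their subquotients\<close>

text \<open>The free vector space on a set of basis elements of type \<open>'x\<close> over a field \<open>'k\<close> is the
  type \<open>'x \<Rightarrow>\<^sub>0 'k\<close> of finitely supported functions; \<open>Poly_Mapping.single x 1\<close> is the basis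
  vector \<open>x\<close>.\<close>

definition fscale :: "'k::field \<Rightarrow> ('x \<Rightarrow>\<^sub>0 'k) \<Rightarrow> ('x \<Rightarrow>\<^sub>0 'k)" where
  "fscale c p = Poly_Mapping.map ((*) c) p"

lemma lookup_fscale [simp]: "Poly_Mapping.lookup (fscale c p) x = c * Poly_Mapping.lookup p x"
  unfolding fscale_def by transfer (simp add: when_def)

global_interpretation fvs: vector_space "fscale :: 'k::field \<Rightarrow> ('x \<Rightarrow>\<^sub>0 'k) \<Rightarrow> ('x \<Rightarrow>\<^sub>0 'k)"
  defines fspan = fvs.span
  by unfold_locales (auto intro!: poly_mapping_eqI simp: lookup_add algebra_simps)

abbreviation basis_vec :: "'x \<Rightarrow> ('x \<Rightarrow>\<^sub>0 'k::field)" where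
  "basis_vec x \<equiv> Poly_Mapping.single x 1"

definition lin_ext :: "('x \<Rightarrow> ('y \<Rightarrow>\<^sub>0 'k::field)) \<Rightarrow> ('x \<Rightarrow>\<^sub>0 'k) \<Rightarrow> ('y \<Rightarrow>\<^sub>0 'k)" where
  "lin_ext g p = (\<Sum>x\<in>Poly_Mapping.keys p. fscale (Poly_Mapping.lookup p x) (g x))"

text \<open>Representations of the symmetric group on \<open>{1..n}\<close>; the action is only meaningful for
  \<open>\<sigma>\<close> with \<open>\<sigma> permutes {1..n}\<close>.\<close>

record ('k, 'v) sn_rep =
  rep_space :: "'v set"
  rep_add :: "'v \<Rightarrow> 'v \<Rightarrow> 'v"
  rep_scale :: "'k \<Rightarrow> 'v \<Rightarrow> 'v"
  rep_act :: "(nat \<Rightarrow> nat) \<Rightarrow> 'v \<Rightarrow> 'v"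

definition tensor_sgn :: "('k::field, 'v) sn_rep \<Rightarrow> ('k, 'v) sn_rep" where
  "tensor_sgn M =
     M\<lparr>rep_act := (\<lambda>\<sigma> x. rep_scale M (of_int (sign \<sigma>)) (rep_act M \<sigma> x))\<rparr>"

definition rep_linear :: "('k, 'v) sn_rep \<Rightarrow> ('k, 'w) sn_rep \<Rightarrow> ('v \<Rightarrow> 'w) \<Rightarrow> bool" where
  "rep_linear M N \<phi> \<longleftrightarrow>
     (\<forall>x\<in>rep_space M. \<phi> x \<in> rep_space N) \<and>
     (\<forall>x\<in>rep_space M. \<forall>y\<in>rep_space M. \<phi> (rep_add M x y) = rep_add N (\<phi> x) (\<phi> y)) \<and>
     (\<forall>c. \<forall>x\<in>rep_space M. \<phi> (rep_scale M c x) = rep_scale N c (\<phi> x))"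

definition sn_module_iso ::
    "nat \<Rightarrow> ('k, 'v) sn_rep \<Rightarrow> ('k, 'w) sn_rep \<Rightarrow> ('v \<Rightarrow> 'w) \<Rightarrow> bool" where
  "sn_module_iso n M N \<phi> \<longleftrightarrow>
     rep_linear M N \<phi> \<and>
     bij_betw \<phi> (rep_space M) (rep_space N) \<and>
     (\<forall>\<sigma>. \<sigma> permutes {1..n} \<longrightarrow>
        (\<forall>x\<in>rep_space M. \<phi> (rep_act M \<sigma> x) = rep_act N \<sigma> (\<phi> x)))"

text \<open>The image of the subspace \<open>V\<close> in the quotient by the subspace \<open>W\<close>. Its elements are the
  cosets \<open>v +o W\<close> with \<open>v \<in> V\<close>; the operation \<open>X + Y\<close> on cosets is elementwise addition of sets.
  In a scalar multiple, \<open>W\<close> is added so that \<open>0\<close> times a coset is again a coset. A group element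
  \<open>\<sigma>\<close> acts by the linear extension of the map \<open>h \<sigma>\<close> on basis elements, applied to a coset
  elementwise; this yields a coset because \<open>W\<close> is invariant in the uses below.\<close>

definition subquotient ::
    "((nat \<Rightarrow> nat) \<Rightarrow> 'x \<Rightarrow> 'x) \<Rightarrow> ('x \<Rightarrow>\<^sub>0 'k::field) set \<Rightarrow> ('x \<Rightarrow>\<^sub>0 'k) set
      \<Rightarrow> ('k, ('x \<Rightarrow>\<^sub>0 'k) set) sn_rep" where
  "subquotient h V W =
     \<lparr>rep_space = (\<lambda>v. v +o W) ` V,
      rep_add = (\<lambda>X Y. X + Y),
      rep_scale = (\<lambda>c X. fscale c ` X + W),
      rep_act = (\<lambda>\<sigma> X. lin_ext (\<lambda>x. basis_vec (h \<sigma> x)) ` X)\<rparr>"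

section \<open>The free Lie algebra with two compatible brackets\<close>

datatype color = Blue | Red

text \<open>The free magma with two products: bracketings of letters, equivalently bicolored plane
  binary trees with labeled leaves.\<close>

datatype 'a bracketing =
  Letter 'a | Bracket color "'a bracketing" "'a bracketing"

fun letters :: "'a bracketing \<Rightarrow> 'a list" where
  "letters (Letter a) = [a]"
| "letters (Bracket c s t) = letters s @ letters t"

fun red_brackets :: "'a bracketing \<Rightarrow> nat" where
  "red_brackets (Letter a) = 0"
| "red_brackets (Bracket c s t) =
     red_brackets s + red_brackets t + (if c = Red then 1 else 0)"

definition free_alg :: "'a set \<Rightarrow> ('a bracketing \<Rightarrow>\<^sub>0 'k::field) set" where
  "free_alg A = {p. \<forall>m\<in>Poly_Mapping.keys p. set (letters m) \<subseteq> A}"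

definition br ::
    "color \<Rightarrow> ('a bracketing \<Rightarrow>\<^sub>0 'k::field) \<Rightarrow> ('a bracketing \<Rightarrow>\<^sub>0 'k)
      \<Rightarrow> ('a bracketing \<Rightarrow>\<^sub>0 'k)" where
  "br c p q = lin_ext (\<lambda>s. lin_ext (\<lambda>t. basis_vec (Bracket c s t)) q) p"

text \<open>The two-sided ideal of the free nonassociative algebra \<open>free_alg A\<close> such that the quotient
  is the free Lie algebra on \<open>A\<close> with two compatible brackets.\<close>

inductive_set lie2_ideal :: "'a set \<Rightarrow> ('a bracketing \<Rightarrow>\<^sub>0 'k::field) set"
  for A :: "'a set" where
  antisym: "x \<in> free_alg A \<Longrightarrow> y \<in> free_alg A \<Longrightarrow> br c x y + br c y x \<in> lie2_ideal A"
| jacobi: "x \<in> free_alg A \<Longrightarrow> y \<in> free_alg A \<Longrightarrow> z \<in> free_alg A \<Longrightarrow>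
    br c x (br c y z) + br c z (br c x y) + br c y (br c z x) \<in> lie2_ideal A"
| mixed_jacobi: "x \<in> free_alg A \<Longrightarrow> y \<in> free_alg A \<Longrightarrow> z \<in> free_alg A \<Longrightarrow>
    br Blue x (br Red y z) + br Blue z (br Red x y) + br Blue y (br Red z x)
    + br Red x (br Blue y z) + br Red z (br Blue x y) + br Red y (br Blue z x)
    \<in> lie2_ideal A"
| zero: "0 \<in> lie2_ideal A"
| add: "p \<in> lie2_ideal A \<Longrightarrow> q \<in> lie2_ideal A \<Longrightarrow> p + q \<in> lie2_ideal A"
| scale: "p \<in> lie2_ideal A \<Longrightarrow> fscale a p \<in> lie2_ideal A"
| br_left: "p \<in> lie2_ideal A \<Longrightarrow> x \<in> free_alg A \<Longrightarrow> br c x p \<in> lie2_ideal A"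
| br_right: "p \<in> lie2_ideal A \<Longrightarrow> x \<in> free_alg A \<Longrightarrow> br c p x \<in> lie2_ideal A"

definition lie_class :: "nat \<Rightarrow> nat bracketing \<Rightarrow> (nat bracketing \<Rightarrow>\<^sub>0 'k::field) set" where
  "lie_class n m = basis_vec m +o lie2_ideal {1..n}"

definition bracketed_perms :: "nat \<Rightarrow> nat \<Rightarrow> nat bracketing set" where
  "bracketed_perms n i =
     {m. distinct (letters m) \<and> set (letters m) = {1..n} \<and> red_brackets m = i}"

definition Lie2 :: "nat \<Rightarrow> nat \<Rightarrow> ('k::field, (nat bracketing \<Rightarrow>\<^sub>0 'k) set) sn_rep" where
  "Lie2 n i = subquotient map_bracketing
     (fspan (basis_vec ` bracketed_perms n i)) (lie2_ideal {1..n})"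

section \<open>Cohomology of open intervals\<close>

text \<open>Posets are given by a carrier and an order relation \<open>le\<close>. An \<open>r\<close>-chain is the strictly
  increasing list of its \<open>r + 1\<close> elements.\<close>

definition lt_of :: "('p \<Rightarrow> 'p \<Rightarrow> bool) \<Rightarrow> 'p \<Rightarrow> 'p \<Rightarrow> bool" where
  "lt_of le x y \<longleftrightarrow> le x y \<and> x \<noteq> y"

definition open_interval :: "'p set \<Rightarrow> ('p \<Rightarrow> 'p \<Rightarrow> bool) \<Rightarrow> 'p \<Rightarrow> 'p \<Rightarrow> 'p set" where
  "open_interval P le x y = {z\<in>P. lt_of le x z \<and> lt_of le z y}"

definition chains :: "'p set \<Rightarrow> ('p \<Rightarrow> 'p \<Rightarrow> bool) \<Rightarrow> int \<Rightarrow> 'p list set" where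
  "chains P le r = {xs. sorted_wrt (lt_of le) xs \<and> set xs \<subseteq> P \<and> int (length xs) = r + 1}"

definition cochains ::
    "'p set \<Rightarrow> ('p \<Rightarrow> 'p \<Rightarrow> bool) \<Rightarrow> int \<Rightarrow> ('p list \<Rightarrow>\<^sub>0 'k::field) set" where
  "cochains P le r = fspan (basis_vec ` chains P le r)"

text \<open>The elements that can be inserted before position \<open>j\<close> of the chain \<open>xs\<close>; the missing
  conditions for \<open>j = 0\<close> and \<open>j = length xs\<close> account for the adjoined minimum and maximum.\<close>

definition insertable :: "'p set \<Rightarrow> ('p \<Rightarrow> 'p \<Rightarrow> bool) \<Rightarrow> 'p list \<Rightarrow> nat \<Rightarrow> 'p set" where
  "insertable P le xs j =
     {a\<in>P. (0 < j \<longrightarrow> lt_of le (xs ! (j - 1)) a) \<and> (j < length xs \<longrightarrow> lt_of le a (xs ! j))}"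

definition cobdry ::
    "'p set \<Rightarrow> ('p \<Rightarrow> 'p \<Rightarrow> bool) \<Rightarrow> ('p list \<Rightarrow>\<^sub>0 'k::field) \<Rightarrow> ('p list \<Rightarrow>\<^sub>0 'k)" where
  "cobdry P le = lin_ext (\<lambda>xs. \<Sum>j\<in>{0..length xs}. \<Sum>a\<in>insertable P le xs j.
     fscale ((- 1) ^ j) (basis_vec (take j xs @ a # drop j xs)))"

text \<open>In the degenerate interval from \<open>x\<close> to \<open>x\<close> the only nonzero cohomology is one-dimensional in
  degree \<open>-2\<close>; its generator is written as the basis vector of the empty list.\<close>

definition int_cocycles ::
    "'p set \<Rightarrow> ('p \<Rightarrow> 'p \<Rightarrow> bool) \<Rightarrow> 'p \<Rightarrow> 'p \<Rightarrow> int \<Rightarrow> ('p list \<Rightarrow>\<^sub>0 'k::field) set" where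
  "int_cocycles P le x y r =
     (if x = y then (if r = - 2 then fspan {basis_vec []} else {0})
      else {f\<in>cochains (open_interval P le x y) le r. cobdry (open_interval P le x y) le f = 0})"

definition int_cobdries ::
    "'p set \<Rightarrow> ('p \<Rightarrow> 'p \<Rightarrow> bool) \<Rightarrow> 'p \<Rightarrow> 'p \<Rightarrow> int \<Rightarrow> ('p list \<Rightarrow>\<^sub>0 'k::field) set" where
  "int_cobdries P le x y r =
     (if x = y then {0}
      else cobdry (open_interval P le x y) le ` cochains (open_interval P le x y) le (r - 1))"

section \<open>The poset of weighted partitions\<close>

type_synonym wpart = "(nat set \<times> nat) set"

definition wpartitions :: "nat \<Rightarrow> wpart set" where
  "wpartitions n = {\<pi>. partition_on {1..n} (fst ` \<pi>) \<and> inj_on fst \<pi> \<and>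
     (\<forall>(B, v)\<in>\<pi>. v \<in> {0..card B - 1})}"

definition parts_in :: "wpart \<Rightarrow> nat set \<Rightarrow> wpart" where
  "parts_in \<pi> B = {(A, w)\<in>\<pi>. A \<subseteq> B}"

definition wle :: "nat \<Rightarrow> wpart \<Rightarrow> wpart \<Rightarrow> bool" where
  "wle n \<pi> \<rho> \<longleftrightarrow> refines {1..n} (fst ` \<pi>) (fst ` \<rho>) \<and>
     (\<forall>(B, v)\<in>\<rho>. int v - (\<Sum>(A, w)\<in>parts_in \<pi> B. int w)
        \<in> {0..int (card (parts_in \<pi> B)) - 1})"

definition wbot :: "nat \<Rightarrow> wpart" where
  "wbot n = (\<lambda>x. ({x}, 0)) ` {1..n}"

definition wtop :: "nat \<Rightarrow> nat \<Rightarrow> wpart" where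
  "wtop n i = {({1..n}, i)}"

definition perm_wpart :: "(nat \<Rightarrow> nat) \<Rightarrow> wpart \<Rightarrow> wpart" where
  "perm_wpart \<sigma> \<pi> = (\<lambda>(B, v). (\<sigma> ` B, v)) ` \<pi>"

definition HPi :: "nat \<Rightarrow> nat \<Rightarrow> int \<Rightarrow> ('k::field, (wpart list \<Rightarrow>\<^sub>0 'k) set) sn_rep" where
  "HPi n i r = subquotient (\<lambda>\<sigma>. map (perm_wpart \<sigma>))
     (int_cocycles (wpartitions n) (wle n) (wbot n) (wtop n i) r)
     (int_cobdries (wpartitions n) (wle n) (wbot n) (wtop n i) r)"

definition coh_class :: "nat \<Rightarrow> nat \<Rightarrow> int \<Rightarrow> wpart list \<Rightarrow> (wpart list \<Rightarrow>\<^sub>0 'k::field) set" where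
  "coh_class n i r xs =
     basis_vec xs +o int_cobdries (wpartitions n) (wle n) (wbot n) (wtop n i) r"

section \<open>Bicolored binary trees\<close>

datatype bctree = Tip | Node color bctree bctree

fun leaf_count :: "bctree \<Rightarrow> nat" where
  "leaf_count Tip = 1"
| "leaf_count (Node c l r) = leaf_count l + leaf_count r"

fun internal_count :: "bctree \<Rightarrow> nat" where
  "internal_count Tip = 0"
| "internal_count (Node c l r) = internal_count l + internal_count r + 1"

fun red_count :: "bctree \<Rightarrow> nat" where
  "red_count Tip = 0"
| "red_count (Node c l r) = red_count l + red_count r + (if c = Red then 1 else 0)"

definition BT :: "nat \<Rightarrow> nat \<Rightarrow> (bctree \<times> (nat \<Rightarrow> nat)) set" where
  "BT n i = {(T, \<sigma>). leaf_count T = n \<and> red_count T = i \<and> \<sigma> permutes {1..n}}"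

fun tree_sgn :: "bctree \<Rightarrow> int" where
  "tree_sgn Tip = 1"
| "tree_sgn (Node c l r) = (- 1) ^ internal_count r * tree_sgn l * tree_sgn r"

text \<open>\<open>label_from j T \<sigma>\<close> labels the leaves of \<open>T\<close> from left to right by
  \<open>\<sigma> j, \<sigma> (j + 1), \<dots>\<close>.\<close>

fun label_from :: "nat \<Rightarrow> bctree \<Rightarrow> (nat \<Rightarrow> nat) \<Rightarrow> nat bracketing" where
  "label_from j Tip \<sigma> = Letter (\<sigma> j)"
| "label_from j (Node c l r) \<sigma> =
     Bracket c (label_from j l \<sigma>) (label_from (j + leaf_count l) r \<sigma>)"

definition bracket_of :: "bctree \<Rightarrow> (nat \<Rightarrow> nat) \<Rightarrow> nat bracketing" where
  "bracket_of T \<sigma> = label_from 1 T \<sigma>"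

fun u_color :: "color \<Rightarrow> nat" where
  "u_color Blue = 0"
| "u_color Red = 1"

definition merge :: "nat \<Rightarrow> nat set \<Rightarrow> nat set \<Rightarrow> wpart \<Rightarrow> wpart" where
  "merge u A B \<pi> = {(C, w)\<in>\<pi>. C \<noteq> A \<and> C \<noteq> B} \<union>
     {(A \<union> B, a + b + u) | a b. (A, a) \<in> \<pi> \<and> (B, b) \<in> \<pi>}"

fun postorder_merges :: "nat bracketing \<Rightarrow> (wpart \<Rightarrow> wpart) list" where
  "postorder_merges (Letter a) = []"
| "postorder_merges (Bracket c s t) =
     postorder_merges s @ postorder_merges t
     @ [merge (u_color c) (set (letters s)) (set (letters t))]"

fun iterates :: "'p \<Rightarrow> ('p \<Rightarrow> 'p) list \<Rightarrow> 'p list" where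
  "iterates x [] = [x]"
| "iterates x (f # fs) = x # iterates (f x) fs"

definition max_chain :: "nat \<Rightarrow> bctree \<Rightarrow> (nat \<Rightarrow> nat) \<Rightarrow> wpart list" where
  "max_chain n T \<sigma> = iterates (wbot n) (postorder_merges (bracket_of T \<sigma>))"

definition bar_chain :: "nat \<Rightarrow> nat \<Rightarrow> bctree \<Rightarrow> (nat \<Rightarrow> nat) \<Rightarrow> wpart list" where
  "bar_chain n i T \<sigma> = filter (\<lambda>\<pi>. \<pi> \<notin> {wbot n, wtop n i}) (max_chain n T \<sigma>)"

end

theory Submission
  imports Defs "HOL-Library.Nat_Bijection"
begin

text \<open>Both sides are presented by trees. Record a maximal chain by the list of its merges, that is, of
  pairs (merged block, color). This list is a linear extension of the containment order on the
  internal nodes of a bracketing \<open>m\<close> (a node being the set of its letters with its color), and \<open>m\<close> is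
  determined by its set of nodes up to swapping children. In an interval of rank 2, the two merges
  either are disjoint, so that there are two intermediate elements and the coboundary relation says
  that exchanging the two merges changes the sign; or they concern three blocks, so that there are
  three intermediate elements when the colors agree and six when they differ, and the relation is the
  Jacobi or the mixed Jacobi relation. Hence the map sending \<open>m\<close> to its signed postorder chain kills
  the Lie relations, the map sending a chain with linear extension \<open>L\<close> to the signed bracketing \<open>m\<close>
  kills the coboundaries, and they are inverse to each other.

  All signs are parities of numbers of inversions, with respect to an arbitrary fixed order on the
  nodes: \<open>osgn m\<close> combines those of the letters and of the postorder list with the sign of the tree,
  and the two maps relate \<open>m\<close> to the chain of \<open>L\<close> with the factor \<open>osgn m * nsgn L\<close>, which does not
  depend on the order on the nodes.\<close>

text \<open>A bracketing and a chain do not determine each other: a bracketing has many linear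
  extensions, and a chain forgets which child is the left one. The pairs (\<open>m\<close>,
  \<open>L\<close>) with \<open>linear_ext m L\<close> refine both. So each map involves a choice,
  the postorder in one direction and \<open>SOME\<close> in the other, and only its class is
  canonical; \<open>signed_chain_cong\<close> and \<open>signed_vec_cong\<close> make the choices
  harmless. The sign is split accordingly: \<open>nsgn L\<close> changes when two adjacent merges
  are exchanged, \<open>osgn m\<close> when two children are swapped. The ideal of Lie relations is
  not multilinear, whereas chains only correspond to multilinear monomials of one degree. Both maps
  are therefore defined on whole free vector spaces and send everything irrelevant to 0, so that no
  multilinear version of the ideal is required. Since the inverse is explicit and the relations
  match one by one, the argument is the same over every field.\<close>

abbreviation lset :: "'a bracketing \<Rightarrow> 'a set" where
  "lset m \<equiv> set (letters m)"

type_synonym 'k bracket_vec = "nat bracketing \<Rightarrow>\<^sub>0 'k"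
type_synonym 'k chain_vecs = "wpart list \<Rightarrow>\<^sub>0 'k"

section \<open>Signs of lists\<close>

text \<open>With these rules, \<open>blast\<close> and \<open>auto\<close> diverge on goals about sets of numbers.\<close>

declare set_plus_intro [rule del] set_plus_intro2 [rule del] set_plus_mono [rule del]
  set_plus_mono2 [rule del] set_plus_mono3 [rule del] set_plus_mono4 [rule del]
  set_times_intro [rule del] set_times_intro2 [rule del] set_times_mono [rule del]
  set_times_mono2 [rule del] set_times_mono3 [rule del] set_times_mono4 [rule del]

text \<open>The parity of the inversions between \<open>A\<close> and \<open>B\<close> when all of
  \<open>A\<close> is written before all of \<open>B\<close>. It takes sets because the order inside
  the two groups does not matter.\<close>

definition cross :: "'a::linorder set \<Rightarrow> 'a set \<Rightarrow> int" where
  "cross A B = (\<Prod>x\<in>A. \<Prod>y\<in>B. if y < x then - 1 else 1)"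

fun lsgn :: "'a::linorder list \<Rightarrow> int" where
  "lsgn [] = 1"
| "lsgn (x # xs) = cross {x} (set xs) * lsgn xs"

lemma cross_empty [simp]: "cross {} B = 1" "cross A {} = 1"
  by (simp_all add: cross_def)

lemma cross_Un_left:
  "finite A \<Longrightarrow> finite A' \<Longrightarrow> A \<inter> A' = {} \<Longrightarrow> cross (A \<union> A') B = cross A B * cross A' B"
  by (simp add: cross_def prod.union_disjoint)

lemma cross_Un_right:
  "finite B \<Longrightarrow> finite B' \<Longrightarrow> B \<inter> B' = {} \<Longrightarrow> cross A (B \<union> B') = cross A B * cross A B'"
  by (simp add: cross_def prod.union_disjoint prod.distrib)

lemma cross_square [simp]: "cross A B * cross A B = 1"
proof -
  have "cross A B * cross A B
      = (\<Prod>x\<in>A. \<Prod>y\<in>B. (if y < x then - 1 else 1) * (if y < x then - 1 else 1))"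
    by (simp add: cross_def prod.distrib)
  also have "\<dots> = 1" by (intro prod.neutral ballI) auto
  finally show ?thesis .
qed

text \<open>Each of the \<open>card A * card B\<close> pairs is an inversion in exactly one of the
  two orders.\<close>

lemma cross_commute:
  assumes "finite A" "finite B" "A \<inter> B = {}"
  shows "cross A B = (- 1) ^ (card A * card B) * cross B A"
proof -
  have "cross A B * cross B A
      = (\<Prod>x\<in>A. \<Prod>y\<in>B. (if y < x then - 1 else 1) * (if x < y then - 1 else 1))"
    unfolding cross_def by (subst (2) prod.swap) (simp add: prod.distrib)
  also have "\<dots> = (\<Prod>x\<in>A. \<Prod>y\<in>B. - 1)"
    using assms by (intro prod.cong refl) (auto simp: not_less order.order_iff_strict)
  also have "\<dots> = (- 1) ^ (card A * card B)"
    by (simp add: power_mult[symmetric] mult.commute)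
  finally have "cross A B * cross B A = (- 1) ^ (card A * card B)" .
  moreover have "cross A B = (cross A B * cross B A) * cross B A" by (simp add: mult.assoc)
  ultimately show ?thesis by simp
qed

lemma lsgn_append:
  "distinct (xs @ ys) \<Longrightarrow> lsgn (xs @ ys) = lsgn xs * lsgn ys * cross (set xs) (set ys)"
proof (induction xs)
  case (Cons a xs)
  have "cross (insert a (set xs)) (set ys) = cross {a} (set ys) * cross (set xs) (set ys)"
    using Cons.prems cross_Un_left[of "{a}" "set xs"] by simp
  with Cons show ?case by (simp add: cross_Un_right)
qed simp

lemma lsgn_square [simp]: "lsgn xs * lsgn xs = 1"
proof (induction xs)
  case (Cons x xs)
  have "lsgn (x # xs) * lsgn (x # xs)
      = (cross {x} (set xs) * cross {x} (set xs)) * (lsgn xs * lsgn xs)"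
    by (simp only: lsgn.simps mult_ac)
  with Cons show ?case by simp
qed simp

text \<open>Only the inversions between \<open>xs\<close> and \<open>ys\<close> change; those with
  \<open>as\<close> and \<open>bs\<close> depend on the union of the two blocks.\<close>

lemma lsgn_swap_blocks:
  assumes "distinct (as @ xs @ ys @ bs)"
  shows "lsgn (as @ xs @ ys @ bs) = (- 1) ^ (length xs * length ys) * lsgn (as @ ys @ xs @ bs)"
proof -
  have "cross (set xs) (set ys) = (- 1) ^ (length xs * length ys) * cross (set ys) (set xs)"
    using cross_commute[of "set xs" "set ys"] assms by (auto simp: distinct_card)
  moreover have "set xs \<union> (set ys \<union> set bs) = set ys \<union> (set xs \<union> set bs)" by blast
  moreover have "distinct (as @ ys @ xs @ bs)" using assms by auto
  ultimately show ?thesis using assms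
    by (simp add: lsgn_append cross_Un_right Int_Un_distrib mult_ac)
qed

lemma lsgn_move_front:
  assumes "distinct (us @ x # vs)"
  shows "lsgn (us @ x # vs) = (- 1) ^ length us * cross {x} (set us \<union> set vs) * lsgn (us @ vs)"
  using lsgn_swap_blocks[of "[]" us "[x]" vs] assms by simp

text \<open>Moving \<open>x\<close> to the front costs the number of elements before it; the
  remaining factor of \<open>x\<close> is the same in both lists and squares to 1. This removes the
  inner node of a Jacobi triple, which changes under rotation, from two lists that are to be
  compared.\<close>

lemma lsgn_replace:
  assumes "distinct (us @ x # vs)" "distinct (us' @ x # vs')"
    and "set us \<union> set vs = set us' \<union> set vs'"
  shows "lsgn (us @ x # vs) * lsgn (us' @ x # vs')
    = (- 1) ^ (length us + length us') * (lsgn (us @ vs) * lsgn (us' @ vs'))"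
proof -
  have "lsgn (us @ x # vs) * lsgn (us' @ x # vs') = (- 1) ^ length us * (- 1) ^ length us' *
      (cross {x} (set us \<union> set vs) * cross {x} (set us \<union> set vs))
      * (lsgn (us @ vs) * lsgn (us' @ vs'))"
    unfolding lsgn_move_front[OF assms(1)] lsgn_move_front[OF assms(2)] assms(3)
    by (simp only: mult_ac)
  then show ?thesis by (simp add: power_add)
qed

lemma lsgn_sorted: "sorted xs \<Longrightarrow> lsgn xs = 1"
  by (induction xs) (auto simp: cross_def intro!: prod.neutral)

lemma lsgn_swap_elems:
  assumes "distinct (as @ x # bs @ y # cs)"
  shows "lsgn (as @ y # bs @ x # cs) = - lsgn (as @ x # bs @ y # cs)"
proof -
  have "lsgn (as @ x # bs @ y # cs) = (- 1) ^ length bs * lsgn (as @ bs @ x # y # cs)"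
    using lsgn_swap_blocks[of as "[x]" bs "y # cs"] assms by simp
  also have "lsgn (as @ bs @ x # y # cs) = - lsgn (as @ bs @ y # x # cs)"
    using lsgn_swap_blocks[of "as @ bs" "[x]" "[y]" cs] assms by auto
  also have "lsgn (as @ bs @ y # x # cs) = (- 1) ^ length bs * lsgn (as @ y # bs @ x # cs)"
    using lsgn_swap_blocks[of as bs "[y]" "x # cs"] assms by auto
  finally show ?thesis by (simp add: mult.assoc[symmetric] power_add[symmetric])
qed

lemma lsgn_map_transpose:
  assumes "distinct xs" "a \<in> set xs" "b \<in> set xs" "a \<noteq> b"
  shows "lsgn (map (Transposition.transpose a b) xs) = - lsgn xs"
proof -
  have *: "lsgn (map (Transposition.transpose a b) xs) = - lsgn xs"
    if "xs = as @ a # bs @ b # cs" for as bs cs a b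
  proof -
    have "map (Transposition.transpose a b) ys = ys" if "a \<notin> set ys" "b \<notin> set ys" for ys
      using that by (intro map_idI) (auto simp: transpose_def)
    with that assms(1) have "map (Transposition.transpose a b) xs = as @ b # bs @ a # cs" by auto
    with lsgn_swap_elems that assms(1) show ?thesis by simp
  qed
  obtain as ds where as: "xs = as @ a # ds" using assms(2) by (meson split_list)
  show ?thesis
  proof (cases "b \<in> set ds")
    case True
    then obtain bs cs where "ds = bs @ b # cs" by (meson split_list)
    with as * show ?thesis by simp
  next
    case False
    with as assms have "b \<in> set as" by auto
    then obtain bs cs where "as = bs @ b # cs" by (meson split_list)
    with as *[of bs b cs a ds] show ?thesis by (simp add: transpose_commute)
  qed
qed

text \<open>\<open>p\<close> is a product of transpositions, each of which changes the sign. Here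
  the sign of the permutation in the theorem meets the inversions of the letters.\<close>

lemma lsgn_map_permutes:
  assumes "p permutes A" "finite A" "distinct xs" "set xs = A"
  shows "lsgn (map p xs) = sign p * lsgn xs"
  using assms(1,2)
proof (induction rule: permutes_induct)
  case id
  then show ?case by simp
next
  case (swap a b p)
  have "distinct (map p xs)" "set (map p xs) = A"
    using assms swap by (auto simp: distinct_map permutes_image intro: permutes_inj_on)
  with lsgn_map_transpose[of "map p xs" a b] swap
  have "lsgn (map (Transposition.transpose a b \<circ> p) xs) = - (sign p * lsgn xs)" by simp
  moreover have "sign (Transposition.transpose a b \<circ> p) = - sign p"
    using swap assms by (subst sign_compose)
      (auto simp: sign_swap_id permutation_swap_id intro: permutes_imp_permutation)
  ultimately show ?case by (metis mult_minus_left)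
qed

section \<open>Linear extensions and contexts\<close>

lemma lin_ext_superset:
  assumes "finite X" "Poly_Mapping.keys p \<subseteq> X"
  shows "lin_ext g p = (\<Sum>x\<in>X. fscale (Poly_Mapping.lookup p x) (g x))"
  unfolding lin_ext_def
  by (rule sum.mono_neutral_left) (use assms in \<open>auto simp: in_keys_iff\<close>)

lemma lin_ext_add [simp]: "lin_ext g (p + q) = lin_ext g p + lin_ext g q"
proof -
  let ?X = "Poly_Mapping.keys p \<union> Poly_Mapping.keys q"
  have "Poly_Mapping.keys (p + q) \<subseteq> ?X" by (rule keys_add)
  then show ?thesis
    by (simp add: lin_ext_superset[of ?X] lookup_add fvs.scale_left_distrib sum.distrib)
qed

lemma lin_ext_scale [simp]: "lin_ext g (fscale c p) = fscale c (lin_ext g p)"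
proof -
  have "Poly_Mapping.keys (fscale c p) \<subseteq> Poly_Mapping.keys p" by (auto simp: in_keys_iff)
  then show ?thesis
    by (simp add: lin_ext_superset[of "Poly_Mapping.keys p"] fvs.scale_sum_right)
qed

lemma lin_ext_basis [simp]: "lin_ext g (basis_vec x) = g x"
  by (simp add: lin_ext_superset[of "{x}"])

lemma lin_ext_0 [simp]: "lin_ext g 0 = 0"
  by (simp add: lin_ext_def)

lemma lin_ext_uminus [simp]: "lin_ext g (- p) = - lin_ext g p"
  using lin_ext_scale[of g "- 1" p] by simp

lemma lin_ext_diff [simp]: "lin_ext g (p - q) = lin_ext g p - lin_ext g q"
  using lin_ext_add[of g p "- q"] by simp

lemma lin_ext_sum: "lin_ext g (\<Sum>i\<in>I. f i) = (\<Sum>i\<in>I. lin_ext g (f i))"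
  by (induction I rule: infinite_finite_induct) simp_all

text \<open>The preimage of a subspace is a subspace, so it contains the span of its basis vectors.
  \<open>F\<close> is any additive and homogeneous map, so that compositions and differences of maps
  can be inserted directly.\<close>

lemma linear_image_in_subspace:
  assumes "fvs.subspace B"
    and "\<And>p q. F (p + q) = F p + F q" and "\<And>c p. F (fscale c p) = fscale c (F p)"
    and "p \<in> fspan (basis_vec ` X)" and "\<And>x. x \<in> X \<Longrightarrow> F (basis_vec x) \<in> B"
  shows "F p \<in> B"
proof -
  have "F 0 = 0" using assms(3)[of 0 0] by simp
  then have "fvs.subspace {p. F p \<in> B}"
    using assms(1-3) by (auto intro!: fvs.subspaceI simp: fvs.subspace_0 fvs.subspace_add fvs.subspace_scale)
  moreover have "basis_vec ` X \<subseteq> {p. F p \<in> B}" using assms(5) by auto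
  ultimately show ?thesis using assms(4) fvs.span_minimal by blast
qed

lemma lin_ext_basis_vec: "lin_ext basis_vec p = p"
proof (rule poly_mapping_eqI)
  fix x
  have "Poly_Mapping.lookup (lin_ext basis_vec p) x
      = (\<Sum>y\<in>Poly_Mapping.keys p. Poly_Mapping.lookup p y * (1 when y = x))"
    by (simp add: lin_ext_def lookup_sum lookup_single)
  also have "\<dots> = (\<Sum>y\<in>Poly_Mapping.keys p. if y = x then Poly_Mapping.lookup p y else 0)"
    by (intro sum.cong) auto
  also have "\<dots> = Poly_Mapping.lookup p x" by (auto simp: in_keys_iff)
  finally show "Poly_Mapping.lookup (lin_ext basis_vec p) x = Poly_Mapping.lookup p x" .
qed

lemma in_span_basis:
  assumes "Poly_Mapping.keys p \<subseteq> X"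
  shows "p \<in> fspan (basis_vec ` X)"
proof -
  have "lin_ext basis_vec p \<in> fspan (basis_vec ` X)"
    unfolding lin_ext_def using assms
    by (intro fvs.span_sum fvs.span_scale fvs.span_base) auto
  then show ?thesis by (simp add: lin_ext_basis_vec)
qed

lemma in_subspace_of_basis:
  assumes "fvs.subspace B"
    and "\<And>p q. F (p + q) = F p + F q" and "\<And>c p. F (fscale c p) = fscale c (F p)"
    and "\<And>x. F (basis_vec x) \<in> B"
  shows "F p \<in> B"
  using linear_image_in_subspace[of B F p UNIV] assms in_span_basis[of p UNIV] by blast

lemma subspace_zero_set: "fvs.subspace {0}"
  by (simp add: fvs.subspace_def)

lemma lin_eq_if_basis_eq:
  assumes "\<And>p q. F (p + q) = F p + F q" and "\<And>c p. F (fscale c p) = fscale c (F p)"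
    and "\<And>p q. G (p + q) = G p + G q" and "\<And>c p. G (fscale c p) = fscale c (G p)"
    and "\<And>x. F (basis_vec x) = G (basis_vec x)"
  shows "F p = G p"
  using in_subspace_of_basis[OF subspace_zero_set, of "\<lambda>p. F p - G p" p] assms
  by (simp add: fvs.scale_right_diff_distrib)

lemma br_add_left [simp]: "br c (p + p') q = br c p q + br c p' q"
  by (simp add: br_def)

lemma br_add_right [simp]: "br c p (q + q') = br c p q + br c p q'"
  unfolding br_def lin_ext_def by (simp add: fvs.scale_right_distrib sum.distrib
      lin_ext_add[unfolded lin_ext_def])

lemma br_scale_left [simp]: "br c (fscale a p) q = fscale a (br c p q)"
  by (simp add: br_def)

lemma br_scale_right [simp]: "br c p (fscale a q) = fscale a (br c p q)"
  unfolding br_def by (simp add: lin_ext_def[of _ p] fvs.scale_sum_right mult.commute)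

lemma br_basis [simp]: "br c (basis_vec s) (basis_vec t) = basis_vec (Bracket c s t)"
  by (simp add: br_def)

lemma br_diff_left: "br c (p - p') q = br c p q - br c p' q"
  by (simp add: br_def)

lemma br_diff_right: "br c p (q - q') = br c p q - br c p q'"
  using br_add_right[of c p "q - q'" q'] by (simp del: br_add_right)

lemma subspace_lie2_ideal: "fvs.subspace (lie2_ideal A)"
  by (simp add: fvs.subspaceI lie2_ideal.add lie2_ideal.scale lie2_ideal.zero)

lemma basis_in_free_alg [simp]: "basis_vec m \<in> free_alg A \<longleftrightarrow> lset m \<subseteq> A"
  by (auto simp: free_alg_def)

lemma scale_in_free_alg: "p \<in> free_alg A \<Longrightarrow> fscale c p \<in> free_alg A"
  by (auto simp: free_alg_def in_keys_iff)

section \<open>One-hole contexts and the ideal of relations\<close>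

datatype 'a ctx = Hole | CtxL color "'a ctx" "'a bracketing" | CtxR color "'a bracketing" "'a ctx"

fun fill :: "'a ctx \<Rightarrow> 'a bracketing \<Rightarrow> 'a bracketing" where
  "fill Hole g = g"
| "fill (CtxL c K t) g = Bracket c (fill K g) t"
| "fill (CtxR c s K) g = Bracket c s (fill K g)"

fun lets_before :: "'a ctx \<Rightarrow> 'a list" where
  "lets_before Hole = []"
| "lets_before (CtxL c K t) = lets_before K"
| "lets_before (CtxR c s K) = letters s @ lets_before K"

fun lets_after :: "'a ctx \<Rightarrow> 'a list" where
  "lets_after Hole = []"
| "lets_after (CtxL c K t) = lets_after K @ letters t"
| "lets_after (CtxR c s K) = lets_after K"

lemma letters_fill: "letters (fill K g) = lets_before K @ letters g @ lets_after K"
  by (induction K) simp_all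

definition fill_lin :: "'a ctx \<Rightarrow> ('a bracketing \<Rightarrow>\<^sub>0 'k::field) \<Rightarrow> ('a bracketing \<Rightarrow>\<^sub>0 'k)" where
  "fill_lin K = lin_ext (\<lambda>g. basis_vec (fill K g))"

lemma fill_lin_simps [simp]:
  "fill_lin K (p + q) = fill_lin K p + fill_lin K q"
  "fill_lin K (fscale a p) = fscale a (fill_lin K p)"
  "fill_lin K (basis_vec g) = basis_vec (fill K g)"
  "fill_lin K 0 = 0"
  "fill_lin K (p - q) = fill_lin K p - fill_lin K q"
  by (simp_all add: fill_lin_def)

lemma fill_lin_Hole: "fill_lin Hole p = p"
  by (simp add: fill_lin_def lin_ext_basis_vec)

lemma fill_lin_CtxL: "fill_lin (CtxL c K t) p = br c (fill_lin K p) (basis_vec t)"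
  by (rule lin_eq_if_basis_eq) simp_all

lemma fill_lin_CtxR: "fill_lin (CtxR c s K) p = br c (basis_vec s) (fill_lin K p)"
  by (rule lin_eq_if_basis_eq) simp_all

text \<open>Each layer of the context multiplies by one monomial from one side, and the ideal is
  two-sided.\<close>

lemma fill_lin_in_ideal:
  assumes "p \<in> lie2_ideal A" "set (lets_before K) \<subseteq> A" "set (lets_after K) \<subseteq> A"
  shows "fill_lin K p \<in> lie2_ideal A"
  using assms
proof (induction K)
  case Hole
  then show ?case by (simp add: fill_lin_Hole)
next
  case (CtxL c K t)
  then show ?case by (simp add: fill_lin_CtxL lie2_ideal.br_right)
next
  case (CtxR c s K)
  then show ?case by (simp add: fill_lin_CtxR lie2_ideal.br_left)
qed

fun comp_ctx :: "'a ctx \<Rightarrow> 'a ctx \<Rightarrow> 'a ctx" where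
  "comp_ctx Hole K' = K'"
| "comp_ctx (CtxL c K t) K' = CtxL c (comp_ctx K K') t"
| "comp_ctx (CtxR c s K) K' = CtxR c s (comp_ctx K K')"

lemma fill_comp_ctx: "fill (comp_ctx K K') g = fill K (fill K' g)"
  by (induction K) simp_all

lemma fill_lin_comp_ctx: "fill_lin (comp_ctx K K') p = fill_lin K (fill_lin K' p)"
  by (rule lin_eq_if_basis_eq) (simp_all add: fill_comp_ctx)

text \<open>By multilinearity the generators of the ideal reduce to relations between monomials, and
  the closure rules for brackets only surround such a relation by a context. The hypotheses range
  over all monomials and contexts, also those with repeated letters or letters outside
  \<open>A\<close>; a \<open>\<Phi>\<close> meant for multilinear monomials has to vanish on the
  others.\<close>

lemma ideal_vanishing:
  fixes \<Phi> :: "('a bracketing \<Rightarrow>\<^sub>0 'k::field) \<Rightarrow> ('y \<Rightarrow>\<^sub>0 'k)"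
  assumes B: "fvs.subspace B"
    and add: "\<And>p q. \<Phi> (p + q) = \<Phi> p + \<Phi> q"
    and scale: "\<And>c p. \<Phi> (fscale c p) = fscale c (\<Phi> p)"
    and antisym: "\<And>K c x y. \<Phi> (basis_vec (fill K (Bracket c x y))) + \<Phi> (basis_vec (fill K (Bracket c y x))) \<in> B"
    and jacobi: "\<And>K c x y z. \<Phi> (basis_vec (fill K (Bracket c x (Bracket c y z))))
      + \<Phi> (basis_vec (fill K (Bracket c z (Bracket c x y))))
      + \<Phi> (basis_vec (fill K (Bracket c y (Bracket c z x)))) \<in> B"
    and mixed: "\<And>K x y z. \<Phi> (basis_vec (fill K (Bracket Blue x (Bracket Red y z))))
      + \<Phi> (basis_vec (fill K (Bracket Blue z (Bracket Red x y))))
      + \<Phi> (basis_vec (fill K (Bracket Blue y (Bracket Red z x))))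
      + \<Phi> (basis_vec (fill K (Bracket Red x (Bracket Blue y z))))
      + \<Phi> (basis_vec (fill K (Bracket Red z (Bracket Blue x y))))
      + \<Phi> (basis_vec (fill K (Bracket Red y (Bracket Blue z x)))) \<in> B"
    and p: "p \<in> lie2_ideal A"
  shows "\<Phi> p \<in> B"
proof -
  note lin = add scale fvs.scale_right_distrib
  \<comment> \<open>Generalized to all contexts, so that the closure rules for brackets can absorb a
    factor into \<open>K\<close>.\<close>
  have "\<forall>K. \<Phi> (fill_lin K p) \<in> B"
    using p
  proof induction
    case (antisym x y c)
    have "\<Phi> (fill_lin K (br c x y)) + \<Phi> (fill_lin K (br c y x)) \<in> B" for K
      \<comment> \<open>First \<open>x\<close>, then \<open>y\<close> is replaced by a basis
        vector.\<close>
      apply (rule in_subspace_of_basis[where p = x, OF B])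
        apply (simp add: lin ac_simps)
       apply (simp add: lin)
      apply (rule in_subspace_of_basis[where p = y, OF B])
        apply (simp add: lin ac_simps)
       apply (simp add: lin)
      apply (simp add: assms(4))
      done
    then show ?case by (simp add: add)
  next
    case (jacobi x y z c)
    have "\<Phi> (fill_lin K (br c x (br c y z))) + \<Phi> (fill_lin K (br c z (br c x y)))
        + \<Phi> (fill_lin K (br c y (br c z x))) \<in> B" for K
      apply (rule in_subspace_of_basis[where p = x, OF B])
        apply (simp add: lin ac_simps)
       apply (simp add: lin)
      apply (rule in_subspace_of_basis[where p = y, OF B])
        apply (simp add: lin ac_simps)
       apply (simp add: lin)
      apply (rule in_subspace_of_basis[where p = z, OF B])
        apply (simp add: lin ac_simps)
       apply (simp add: lin)
      apply (simp add: assms(5))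
      done
    then show ?case by (simp add: add)
  next
    case (mixed_jacobi x y z)
    have "\<Phi> (fill_lin K (br Blue x (br Red y z))) + \<Phi> (fill_lin K (br Blue z (br Red x y)))
        + \<Phi> (fill_lin K (br Blue y (br Red z x)))
        + \<Phi> (fill_lin K (br Red x (br Blue y z))) + \<Phi> (fill_lin K (br Red z (br Blue x y)))
        + \<Phi> (fill_lin K (br Red y (br Blue z x))) \<in> B" for K
      apply (rule in_subspace_of_basis[where p = x, OF B])
        apply (simp add: lin ac_simps)
       apply (simp add: lin)
      apply (rule in_subspace_of_basis[where p = y, OF B])
        apply (simp add: lin ac_simps)
       apply (simp add: lin)
      apply (rule in_subspace_of_basis[where p = z, OF B])
        apply (simp add: lin ac_simps)
       apply (simp add: lin)
      apply (simp add: assms(6))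
      done
    then show ?case by (simp add: add)
  next
    case zero
    have "\<Phi> 0 = 0" using scale[of 0 0] by simp
    then show ?case using B by (simp add: fvs.subspace_0)
  next
    case (add p q)
    then show ?case using B by (simp add: assms(2) fvs.subspace_add)
  next
    case (scale p a)
    then show ?case using B by (simp add: assms(3) fvs.subspace_scale)
  next
    case (br_left p x c)
    have "\<Phi> (fill_lin K (br c x p)) \<in> B" for K
    proof (rule in_subspace_of_basis[where p = x, OF B])
      fix s
      have "fill_lin (comp_ctx K (CtxR c s Hole)) p = fill_lin K (br c (basis_vec s) p)"
        by (simp add: fill_lin_comp_ctx fill_lin_CtxR fill_lin_Hole)
      then show "\<Phi> (fill_lin K (br c (basis_vec s) p)) \<in> B" using br_left by metis
    qed (simp_all add: lin)
    then show ?case by blast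
  next
    case (br_right p x c)
    have "\<Phi> (fill_lin K (br c p x)) \<in> B" for K
    proof (rule in_subspace_of_basis[where p = x, OF B])
      fix s
      have "fill_lin (comp_ctx K (CtxL c Hole s)) p = fill_lin K (br c p (basis_vec s))"
        by (simp add: fill_lin_comp_ctx fill_lin_CtxL fill_lin_Hole)
      then show "\<Phi> (fill_lin K (br c p (basis_vec s))) \<in> B" using br_right by metis
    qed (simp_all add: lin)
    then show ?case by blast
  qed
  then show ?thesis using fill_lin_Hole by metis
qed

section \<open>Nodes of a bracketing and their signs\<close>

type_synonym node = "nat set \<times> color"

fun post :: "nat bracketing \<Rightarrow> node list" where
  "post (Letter a) = []"
| "post (Bracket c s t) = post s @ post t @ [(lset s \<union> lset t, c)]"

text \<open>This is \<open>tree_sgn\<close> of the underlying tree, because \<open>t\<close> has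
  \<open>length (post t)\<close> internal nodes.\<close>

fun bsgn :: "nat bracketing \<Rightarrow> int" where
  "bsgn (Letter a) = 1"
| "bsgn (Bracket c s t) = (- 1) ^ length (post t) * bsgn s * bsgn t"

text \<open>Counting inversions needs a total order on the nodes, and the encoding of finite sets by
  numbers supplies one. The color is dropped: the nodes of one linear extension already differ as
  sets, and the sign must not react to the exchange of colors in the mixed Jacobi relation.\<close>

definition node_key :: "node \<Rightarrow> nat" where
  "node_key x = set_encode (fst x)"

definition nsgn :: "node list \<Rightarrow> int" where
  "nsgn L = lsgn (map node_key L)"

definition osgn :: "nat bracketing \<Rightarrow> int" where
  "osgn m = lsgn (letters m) * bsgn m * nsgn (post m)"

lemma nsgn_square [simp]: "nsgn L * nsgn L = 1"
  by (simp add: nsgn_def)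

lemma bsgn_square [simp]: "bsgn m * bsgn m = 1"
proof (induction m)
  case (Bracket c s t)
  have "bsgn (Bracket c s t) * bsgn (Bracket c s t) = ((- 1) ^ length (post t) * (- 1) ^ length (post t))
      * (bsgn s * bsgn s) * (bsgn t * bsgn t)" by (simp only: bsgn.simps mult_ac)
  with Bracket show ?case by (simp add: power_add[symmetric])
qed simp

lemma osgn_square [simp]: "osgn m * osgn m = 1"
proof -
  have "osgn m * osgn m = (lsgn (letters m) * lsgn (letters m)) * (bsgn m * bsgn m)
      * (nsgn (post m) * nsgn (post m))" by (simp only: osgn_def mult_ac)
  then show ?thesis by simp
qed

section \<open>Nodes as sets of letters, and linear extensions\<close>

lemma letters_nonempty [simp]: "letters m \<noteq> []"
  by (induction m) simp_all

lemma length_post: "Suc (length (post m)) = length (letters m)"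
  by (induction m) auto

lemma post_BracketE:
  assumes "x \<in> set (post (Bracket c s t))"
  obtains "x \<in> set (post s)" | "x \<in> set (post t)" | "x = (lset s \<union> lset t, c)"
  using assms by auto

lemma post_subset: "(X, c) \<in> set (post m) \<Longrightarrow> X \<subseteq> lset m"
proof (induction m)
  case (Bracket b s t)
  then show ?case by simp blast
qed simp

lemma letters_not_subset:
  assumes "lset s \<inter> lset t = {}"
  shows "\<not> lset s \<subseteq> lset t" "\<not> lset t \<subseteq> lset s"
proof -
  have s: "hd (letters s) \<in> lset s" and t: "hd (letters t) \<in> lset t" by simp_all
  show "\<not> lset s \<subseteq> lset t" using s assms by blast
  show "\<not> lset t \<subseteq> lset s" using t assms by blast
qed

lemma post_nonempty: "(X, c) \<in> set (post m) \<Longrightarrow> X \<noteq> {}"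
proof (induction m)
  case (Bracket b s t)
  then show ?case by (elim post_BracketE) simp_all
qed simp

lemma finite_fst_post: "x \<in> set (post m) \<Longrightarrow> finite (fst x)"
  by (rule finite_subset[OF post_subset[of "fst x" "snd x" m]]) simp_all

text \<open>No later node is contained in an earlier one. As the containment is not strict, this
  also makes the node sets pairwise distinct.\<close>

definition linear_ext :: "nat bracketing \<Rightarrow> node list \<Rightarrow> bool" where
  "linear_ext m L \<longleftrightarrow> set L = set (post m) \<and> sorted_wrt (\<lambda>x y. \<not> fst y \<subseteq> fst x) L"

text \<open>Nodes of different subtrees are disjoint and nonempty, hence incomparable; the root,
  which comes last, is contained in neither child.\<close>

lemma sorted_post: "distinct (letters m) \<Longrightarrow> sorted_wrt (\<lambda>x y. \<not> fst y \<subseteq> fst x) (post m)"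
proof (induction m)
  case (Bracket c s t)
  have D: "lset s \<inter> lset t = {}" using Bracket.prems by simp
  let ?r = "[(lset s \<union> lset t, c)]"
  have 1: "\<forall>x\<in>set (post s). \<forall>y\<in>set (post t). \<not> fst y \<subseteq> fst x"
  proof (intro ballI)
    fix x y assume "x \<in> set (post s)" "y \<in> set (post t)"
    then show "\<not> fst y \<subseteq> fst x"
      using post_subset[of "fst x" "snd x" s] post_subset[of "fst y" "snd y" t]
        post_nonempty[of "fst y" "snd y" t] D unfolding prod.collapse by blast
  qed
  have 2: "\<forall>x\<in>set (post s). \<forall>y\<in>set ?r. \<not> fst y \<subseteq> fst x"
  proof (intro ballI)
    fix x y assume "x \<in> set (post s)" "y \<in> set ?r"
    then show "\<not> fst y \<subseteq> fst x"
      using post_subset[of "fst x" "snd x" s] letters_not_subset[OF D] unfolding prod.collapse by fastforce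
  qed
  have 3: "\<forall>x\<in>set (post t). \<forall>y\<in>set ?r. \<not> fst y \<subseteq> fst x"
  proof (intro ballI)
    fix x y assume "x \<in> set (post t)" "y \<in> set ?r"
    then show "\<not> fst y \<subseteq> fst x"
      using post_subset[of "fst x" "snd x" t] letters_not_subset[OF D] unfolding prod.collapse by fastforce
  qed
  have "sorted_wrt (\<lambda>x y. \<not> fst y \<subseteq> fst x) (post s)" "sorted_wrt (\<lambda>x y. \<not> fst y \<subseteq> fst x) (post t)"
    using Bracket by simp_all
  then show ?case
    using 1 2 3 by (simp add: sorted_wrt_append)
qed simp

lemma linear_ext_post: "distinct (letters m) \<Longrightarrow> linear_ext m (post m)"
  by (simp add: linear_ext_def sorted_post)

lemma sorted_distinct_fst:
  "sorted_wrt (\<lambda>x y. \<not> fst y \<subseteq> fst x) L \<Longrightarrow> distinct (map fst L)"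
  by (induction L) auto

lemma linear_ext_distinct_fst: "linear_ext m L \<Longrightarrow> distinct (map fst L)"
  by (simp add: linear_ext_def sorted_distinct_fst)

lemma distinct_fst_post: "distinct (letters m) \<Longrightarrow> distinct (map fst (post m))"
  using linear_ext_post linear_ext_distinct_fst by blast

lemma distinct_node_key:
  assumes "distinct (map fst L)" "\<And>x. x \<in> set L \<Longrightarrow> finite (fst x)"
  shows "distinct (map node_key L)"
proof -
  have "inj_on node_key (set L)"
  proof (rule inj_onI)
    fix x y assume "x \<in> set L" "y \<in> set L" "node_key x = node_key y"
    with assms(2) have "fst x = fst y" by (auto simp: node_key_def set_encode_eq)
    with \<open>x \<in> set L\<close> \<open>y \<in> set L\<close> assms(1) show "x = y"
      by (auto simp: distinct_map dest: inj_onD)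
  qed
  with assms(1) show ?thesis by (auto simp: distinct_map)
qed

lemma distinct_key_post: "distinct (letters m) \<Longrightarrow> distinct (map node_key (post m))"
  by (rule distinct_node_key[OF distinct_fst_post finite_fst_post])

lemma linear_ext_distinct_key: "linear_ext m L \<Longrightarrow> distinct (map node_key L)"
  by (rule distinct_node_key[OF linear_ext_distinct_fst finite_fst_post])
    (simp_all add: linear_ext_def)

text \<open>What a root adds to the signs of its children: inversions between the letters, the sign
  of the tree, inversions between the nodes, and inversions with the root. It takes sets as
  arguments and so does not see the inner structure of the children.\<close>

definition merge_sgn :: "nat set \<Rightarrow> nat set \<Rightarrow> node set \<Rightarrow> node set \<Rightarrow> int" where
  "merge_sgn A B M N = cross A B * (- 1) ^ card N * cross (node_key ` M) (node_key ` N)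
     * cross (node_key ` M \<union> node_key ` N) {set_encode (A \<union> B)}"

lemma osgn_Bracket:
  assumes "distinct (letters (Bracket c s t))"
  shows "osgn (Bracket c s t) = osgn s * osgn t *
    merge_sgn (lset s) (lset t) (set (post s)) (set (post t))"
proof -
  let ?u = "set_encode (lset s \<union> lset t)"
  have k: "map node_key (post (Bracket c s t)) = (map node_key (post s) @ map node_key (post t)) @ [?u]"
    by (simp add: node_key_def)
  have d': "distinct ((map node_key (post s) @ map node_key (post t)) @ [?u])"
    using distinct_key_post[OF assms] unfolding k .
  then have d'': "distinct (map node_key (post s) @ map node_key (post t))"
    by (simp only: distinct_append)
  have "nsgn (post (Bracket c s t)) = nsgn (post s) * nsgn (post t)
      * cross (node_key ` set (post s)) (node_key ` set (post t))
      * cross (node_key ` set (post s) \<union> node_key ` set (post t)) {?u}"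
    unfolding nsgn_def k lsgn_append[OF d'] lsgn_append[OF d''] by simp
  moreover have "length (post t) = card (set (post t))"
    using d'' by (simp add: distinct_map distinct_card del: post.simps)
  ultimately show ?thesis
    using assms by (simp add: osgn_def merge_sgn_def lsgn_append mult_ac)
qed

lemma sign_collect:
  fixes a b d e g p q x y :: int
  assumes "a * (g * b) = - d"
  shows "p * q * (a * x * g * (b * y) * e) = - (p * q * (x * d * y * e))"
proof -
  have "p * q * (a * x * g * (b * y) * e) = (a * (g * b)) * (p * q * x * y * e)" by (simp add: mult_ac)
  also have "\<dots> = - (p * q * (x * d * y * e))" by (simp only: assms) (simp add: mult_ac)
  finally show ?thesis .
qed

text \<open>If the children have \<open>p\<close> and \<open>q\<close> nodes, the exponent of the
  sign changes by \<open>(p + 1) * (q + 1)\<close> for the letters, \<open>p * q\<close> for the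
  nodes and \<open>p + q\<close> for the tree; the sum is odd.\<close>

lemma osgn_antisym:
  assumes "distinct (letters (Bracket c s t))"
  shows "osgn (Bracket c t s) = - osgn (Bracket c s t)"
proof -
  have d: "distinct (map node_key (post s @ post t @ [(lset s \<union> lset t, c)]))"
    using distinct_key_post[OF assms] unfolding post.simps .
  have ds: "distinct (post s)" "distinct (post t)"
    using d by (auto simp: distinct_map)
  have k: "node_key ` set (post s) \<inter> node_key ` set (post t) = {}"
    using d by (auto simp: distinct_map)
  have ck: "card (node_key ` set (post s)) = length (post s)"
    "card (node_key ` set (post t)) = length (post t)"
    using d by (auto simp: distinct_map card_image distinct_card)
  have "cross (lset t) (lset s) =
      (- 1) ^ (length (letters t) * length (letters s)) * cross (lset s) (lset t)"
    using assms by (subst cross_commute) (auto simp: distinct_card)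
  moreover have "cross (node_key ` set (post t)) (node_key ` set (post s)) =
      (- 1) ^ (length (post t) * length (post s)) * cross (node_key ` set (post s)) (node_key ` set (post t))"
    using k by (subst cross_commute) (auto simp: ck)
  moreover have "(- 1 :: int) ^ (length (letters t) * length (letters s)) *
      ((- 1) ^ length (post s) * (- 1) ^ (length (post t) * length (post s)))
      = - ((- 1) ^ length (post t))"
    unfolding length_post[symmetric] by (auto simp: minus_one_power_iff)
  moreover have "distinct (letters (Bracket c t s))" using assms by auto
  ultimately show ?thesis
    unfolding osgn_Bracket[OF assms] merge_sgn_def distinct_card[OF ds(2)]
    by (simp only: osgn_Bracket merge_sgn_def distinct_card[OF ds(1)] Un_commute mult.commute[of "osgn t"])
      (rule sign_collect)
qed

section \<open>Bracketings with the same set of nodes\<close>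

lemma post_child:
  assumes "distinct (letters (Bracket c s t))"
  shows "set (post s) = {x \<in> set (post (Bracket c s t)). fst x \<subseteq> lset s}"
    and "set (post t) = {x \<in> set (post (Bracket c s t)). fst x \<subseteq> lset t}"
proof -
  let ?r = "(lset s \<union> lset t, c)"
  have D: "lset s \<inter> lset t = {}" using assms by simp
  have s: "fst x \<subseteq> lset s \<and> \<not> fst x \<subseteq> lset t" if "x \<in> set (post s)" for x
    using that D post_subset[of "fst x" "snd x" s] post_nonempty[of "fst x" "snd x" s]
    unfolding prod.collapse by blast
  have t: "fst x \<subseteq> lset t \<and> \<not> fst x \<subseteq> lset s" if "x \<in> set (post t)" for x
    using that D post_subset[of "fst x" "snd x" t] post_nonempty[of "fst x" "snd x" t]
    unfolding prod.collapse by blast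
  have r: "\<not> fst ?r \<subseteq> lset s" "\<not> fst ?r \<subseteq> lset t"
    using letters_not_subset[OF D] by auto
  have m: "x \<in> set (post (Bracket c s t)) \<longleftrightarrow> x \<in> set (post s) \<or> x \<in> set (post t) \<or> x = ?r" for x by auto
  show "set (post s) = {x \<in> set (post (Bracket c s t)). fst x \<subseteq> lset s}"
    unfolding m using s t r(1) by (intro set_eqI) (metis (mono_tags, lifting) mem_Collect_eq)
  show "set (post t) = {x \<in> set (post (Bracket c s t)). fst x \<subseteq> lset t}"
    unfolding m using s t r(2) by (intro set_eqI) (metis (mono_tags, lifting) mem_Collect_eq)
qed

lemma two_blocks_eq:
  assumes "A \<inter> B = {}" "C \<inter> D = {}" "A \<union> B = C \<union> D" "C \<noteq> {}" "D \<noteq> {}"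
    and "A \<subseteq> C \<or> A \<subseteq> D" "B \<subseteq> C \<or> B \<subseteq> D"
  shows "(A = C \<and> B = D) \<or> (A = D \<and> B = C)"
proof -
  have *: "A = C \<and> B = D" if "C \<inter> D = {}" "A \<union> B = C \<union> D" "D \<noteq> {}" "A \<subseteq> C" "B \<subseteq> C \<or> B \<subseteq> D" for C D
  proof -
    have "D \<inter> A = {}" using that(1,4) by blast
    then have "D \<subseteq> B" using that(2) by blast
    then have "\<not> B \<subseteq> C" using that(1,3) by blast
    then have "B \<subseteq> D" using that(5) by blast
    then have "C \<inter> B = {}" using that(1) by blast
    then have "C \<subseteq> A" using that(2) by blast
    with \<open>D \<subseteq> B\<close> \<open>B \<subseteq> D\<close> \<open>A \<subseteq> C\<close> show ?thesis by simp
  qed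
  from assms(6) show ?thesis
    using *[OF assms(2,3,5) _ assms(7)] *[of D C] assms by (metis Int_commute Un_commute)
qed

lemma letters_node: "(\<exists>a. lset m = {a} \<and> post m = []) \<or> (\<exists>c. (lset m, c) \<in> set (post m))"
  by (cases m) auto

text \<open>A child with more than one letter is itself a node of the other bracketing and is not
  its root, so it lies inside one of the children there.\<close>

lemma child_in_child:
  assumes d: "distinct (letters (Bracket c s t))" "distinct (letters (Bracket c' s' t'))"
    and l: "set (letters (Bracket c s t)) = set (letters (Bracket c' s' t'))"
    and p: "set (post (Bracket c s t)) = set (post (Bracket c' s' t'))"
    and u: "u = s \<or> u = t"
  shows "lset u \<subseteq> lset s' \<or> lset u \<subseteq> lset t'"
proof (cases "\<exists>a. lset u = {a}")
  case True
  then show ?thesis using u l by auto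
next
  case False
  then obtain b where "(lset u, b) \<in> set (post u)" using letters_node by blast
  then have "(lset u, b) \<in> set (post (Bracket c' s' t'))" unfolding p[symmetric] using u by auto
  moreover have "lset u \<noteq> set (letters (Bracket c s t))"
    using u d(1) letters_not_subset[of s t] by auto
  ultimately show ?thesis using l post_subset by fastforce
qed

text \<open>The sign \<^const>\<open>osgn\<close> makes the signed monomial depend only on the set of nodes: swapping the
  children of a node changes both the sign and, by antisymmetry, the monomial.\<close>

definition signed_vec :: "nat bracketing \<Rightarrow> (('k::field) bracket_vec)" where
  "signed_vec m = fscale (of_int (osgn m)) (basis_vec m)"

lemma signed_vec_Bracket:
  assumes "distinct (letters (Bracket c s t))"
  shows "signed_vec (Bracket c s t) = fscale (of_int
    (merge_sgn (lset s) (lset t) (set (post s)) (set (post t))))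
    (br c (signed_vec s) (signed_vec t))"
  by (simp add: signed_vec_def osgn_Bracket[OF assms] mult_ac del: of_int_mult
      flip: of_int_mult)

text \<open>Induction on \<open>m\<close>. The root is the node with all letters, and the letter
  sets of the two children are determined up to order. If they come in opposite order, one
  application of antisymmetry aligns them, and \<open>osgn\<close> absorbs its sign.\<close>

lemma signed_vec_cong:
  assumes "distinct (letters m)" "distinct (letters m')" "lset m \<subseteq> A"
    and "lset m = lset m'" "set (post m) = set (post m')"
  shows "signed_vec m - signed_vec m' \<in> (lie2_ideal A :: (('k::field) bracket_vec) set)"
  using assms
proof (induction m arbitrary: m')
  case (Letter a)
  then have "length (letters m') = 1"
    by (metis distinct_card letters.simps(1) length_Cons list.size(3) One_nat_def)
  then obtain b where "m' = Letter b" by (cases m') (auto simp: length_post[symmetric])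
  with Letter show ?case by (simp add: lie2_ideal.zero)
next
  case (Bracket c s t)
  note [simp] = fvs.subspace_diff[OF subspace_lie2_ideal]
  obtain c' s' t' where m': "m' = Bracket c' s' t'"
    using Bracket.prems by (cases m') auto
  have c': "c' = c"
  proof -
    let ?U = "set (letters (Bracket c s t))"
    have "(?U, c) \<in> set (post m')" "(?U, c') \<in> set (post m')"
      using Bracket.prems(4,5) m' by auto
    moreover have "inj_on fst (set (post m'))"
      using distinct_fst_post[OF Bracket.prems(2)] by (simp add: distinct_map)
    ultimately show ?thesis by (metis (no_types, lifting) fst_conv inj_onD prod.inject)
  qed
  \<comment> \<open>Children in the same order: \<open>merge_sgn\<close> agrees on both sides, and
    the induction hypotheses for the two factors are combined by changing one factor at a
    time.\<close>
  have aligned: "signed_vec (Bracket c s t) - signed_vec (Bracket c s' t') \<in> (lie2_ideal A :: ('k bracket_vec) set)"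
    if d: "distinct (letters (Bracket c s' t'))"
      and p: "set (post (Bracket c s t)) = set (post (Bracket c s' t'))"
      and l: "lset s = lset s'" "lset t = lset t'"
    for s' t'
  proof -
    have ps: "set (post s) = set (post s')"
      unfolding post_child(1)[OF Bracket.prems(1)] post_child(1)[OF d] p l ..
    have pt: "set (post t) = set (post t')"
      unfolding post_child(2)[OF Bracket.prems(1)] post_child(2)[OF d] p l ..
    have IH: "signed_vec s - signed_vec s' \<in> (lie2_ideal A :: ('k bracket_vec) set)"
      "signed_vec t - signed_vec t' \<in> (lie2_ideal A :: ('k bracket_vec) set)"
      using Bracket.IH Bracket.prems d l ps pt by auto
    have "(signed_vec s' :: 'k bracket_vec) \<in> free_alg A" "(signed_vec t :: 'k bracket_vec) \<in> free_alg A"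
      using Bracket.prems l unfolding signed_vec_def by (auto intro!: scale_in_free_alg)
    then have "br c (signed_vec s - signed_vec s') (signed_vec t) + br c (signed_vec s') (signed_vec t - signed_vec t')
        \<in> (lie2_ideal A :: ('k bracket_vec) set)"
      using IH by (intro lie2_ideal.add lie2_ideal.br_left lie2_ideal.br_right)
    then have "br c (signed_vec s) (signed_vec t) - br c (signed_vec s') (signed_vec t')
        \<in> (lie2_ideal A :: ('k bracket_vec) set)"
      by (simp add: br_diff_left br_diff_right)
    then show ?thesis
      unfolding signed_vec_Bracket[OF Bracket.prems(1)] signed_vec_Bracket[OF d] l ps pt
        fvs.scale_right_diff_distrib[symmetric]
      by (rule lie2_ideal.scale)
  qed
  have S: "lset s \<subseteq> lset s' \<or> lset s \<subseteq> lset t'"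
    and T: "lset t \<subseteq> lset s' \<or> lset t \<subseteq> lset t'"
    using child_in_child[of c s t c' s' t'] Bracket.prems m' by auto
  have ne: "lset u \<noteq> {}" for u :: "nat bracketing" by simp
  have d': "lset s \<inter> lset t = {}" "lset s' \<inter> lset t' = {}"
    "lset s \<union> lset t = lset s' \<union> lset t'"
    using Bracket.prems m' by auto
  then consider "lset s = lset s'" "lset t = lset t'"
    | "lset s = lset t'" "lset t = lset s'"
    using two_blocks_eq[OF d'(1,2,3) ne ne S T] by blast
  then show ?case
  proof cases
    case 1
    then show ?thesis using aligned[of s' t'] Bracket.prems m' c' by simp
  next
    case 2
    have "signed_vec (Bracket c s t) - signed_vec (Bracket c t' s') \<in> (lie2_ideal A :: ('k bracket_vec) set)"
      using aligned[of t' s'] 2 Bracket.prems m' c' by (auto simp: Un_commute)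
    moreover have "signed_vec (Bracket c t' s') - signed_vec (Bracket c s' t') \<in> (lie2_ideal A :: ('k bracket_vec) set)"
    proof -
      have "osgn (Bracket c t' s') = - osgn (Bracket c s' t')"
        using osgn_antisym[of c s' t'] Bracket.prems(2) m' by simp
      then have "signed_vec (Bracket c t' s') - signed_vec (Bracket c s' t') =
          fscale (- of_int (osgn (Bracket c s' t')) :: 'k)
            (br c (basis_vec t') (basis_vec s') + br c (basis_vec s') (basis_vec t'))"
        by (simp add: signed_vec_def fvs.scale_right_distrib)
      also have "\<dots> \<in> lie2_ideal A"
        using Bracket.prems m' by (intro lie2_ideal.scale lie2_ideal.antisym) auto
      finally show ?thesis .
    qed
    ultimately show ?thesis using lie2_ideal.add m' c' by fastforce
  qed
qed

section \<open>Merging blocks of weighted partitions\<close>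

lemma wpartitionsI:
  assumes "\<And>A a. (A, a) \<in> \<pi> \<Longrightarrow> A \<noteq> {} \<and> A \<subseteq> {1..n} \<and> a \<le> card A - 1"
    and "\<And>A a B b x. (A, a) \<in> \<pi> \<Longrightarrow> (B, b) \<in> \<pi> \<Longrightarrow> x \<in> A \<Longrightarrow> x \<in> B \<Longrightarrow> A = B \<and> a = b"
    and "\<And>x. x \<in> {1..n} \<Longrightarrow> \<exists>(A, a)\<in>\<pi>. x \<in> A"
  shows "\<pi> \<in> wpartitions n"
proof -
  have "\<Union> (fst ` \<pi>) = {1..n}"
  proof
    show "\<Union> (fst ` \<pi>) \<subseteq> {1..n}" using assms(1) by fastforce
    show "{1..n} \<subseteq> \<Union> (fst ` \<pi>)" using assms(3) by fastforce
  qed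
  moreover have "disjoint (fst ` \<pi>)"
    using assms(2) by (fastforce simp: pairwise_def disjnt_def)
  moreover have "{} \<notin> fst ` \<pi>" using assms(1) by fastforce
  moreover have "inj_on fst \<pi>"
  proof (rule inj_onI)
    fix p q assume "p \<in> \<pi>" "q \<in> \<pi>" "fst p = fst q"
    then obtain A a b where p: "p = (A, a)" "q = (A, b)" "(A, a) \<in> \<pi>" "(A, b) \<in> \<pi>"
      by (metis prod.collapse)
    obtain x where "x \<in> A" using assms(1)[OF p(3)] by blast
    with assms(2)[OF p(3,4)] p show "p = q" by simp
  qed
  moreover have "\<forall>(B, v)\<in>\<pi>. v \<in> {0..card B - 1}" using assms(1) by fastforce
  ultimately show ?thesis by (simp add: wpartitions_def partition_on_def)
qed

lemma wp_disj:
  assumes "\<pi> \<in> wpartitions n" "(A, a) \<in> \<pi>" "(B, b) \<in> \<pi>" "x \<in> A" "x \<in> B"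
  shows "A = B" "a = b"
proof -
  have "disjoint (fst ` \<pi>)" "inj_on fst \<pi>"
    using assms(1) by (auto simp: wpartitions_def partition_on_def)
  moreover have "A \<in> fst ` \<pi>" "B \<in> fst ` \<pi>" using assms by force+
  ultimately show "A = B" using assms(4,5) unfolding pairwise_def disjnt_def by blast
  with \<open>inj_on fst \<pi>\<close> assms(2,3) inj_onD[of fst \<pi> "(A, a)" "(B, b)"] show "a = b" by simp
qed

lemma wp_nonempty: "\<pi> \<in> wpartitions n \<Longrightarrow> (A, a) \<in> \<pi> \<Longrightarrow> A \<noteq> {}"
  by (metis (no_types, lifting) fst_conv image_eqI mem_Collect_eq partition_on_def wpartitions_def)

lemma wp_subset: "\<pi> \<in> wpartitions n \<Longrightarrow> (A, a) \<in> \<pi> \<Longrightarrow> A \<subseteq> {1..n}"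
  by (metis (no_types, lifting) Sup_upper fst_conv image_eqI mem_Collect_eq partition_on_def wpartitions_def)

lemma wp_weight: "\<pi> \<in> wpartitions n \<Longrightarrow> (A, a) \<in> \<pi> \<Longrightarrow> a \<le> card A - 1"
  unfolding wpartitions_def by fastforce

lemma wp_cover:
  assumes "\<pi> \<in> wpartitions n" "x \<in> {1..n}"
  shows "\<exists>A a. (A, a) \<in> \<pi> \<and> x \<in> A"
proof -
  have "\<Union> (fst ` \<pi>) = {1..n}" using assms(1) by (simp add: wpartitions_def partition_on_def)
  with assms(2) obtain p where "p \<in> \<pi>" "x \<in> fst p" by blast
  then show ?thesis by (metis prod.collapse)
qed

lemma wp_finite_block: "\<pi> \<in> wpartitions n \<Longrightarrow> (A, a) \<in> \<pi> \<Longrightarrow> finite A"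
  using wp_subset finite_subset finite_atLeastAtMost by metis

lemma wp_finite: "\<pi> \<in> wpartitions n \<Longrightarrow> finite \<pi>"
proof -
  assume wp: "\<pi> \<in> wpartitions n"
  have "fst ` \<pi> \<subseteq> Pow {1..n}" using wp_subset[OF wp] by force
  then have "finite (fst ` \<pi>)" by (rule finite_subset) simp
  moreover have "inj_on fst \<pi>" using wp by (simp add: wpartitions_def)
  ultimately show "finite \<pi>" by (rule finite_imageD)
qed

lemma wp_fst_eq: "\<pi> \<in> wpartitions n \<Longrightarrow> (A, a) \<in> \<pi> \<Longrightarrow> (A, b) \<in> \<pi> \<Longrightarrow> a = b"
  using inj_onD[of fst \<pi> "(A, a)" "(A, b)"] by (simp add: wpartitions_def)

lemma wp_subset_eq: "\<pi> \<in> wpartitions n \<Longrightarrow> (A, a) \<in> \<pi> \<Longrightarrow> (B, b) \<in> \<pi> \<Longrightarrow> A \<subseteq> B \<Longrightarrow> A = B"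
  using wp_disj(1)[of \<pi> n A a B b] wp_nonempty[of \<pi> n A a] by blast

lemma parts_in_Union:
  assumes wp: "\<pi> \<in> wpartitions n" and S: "S \<subseteq> \<pi>"
  shows "parts_in \<pi> (\<Union> (fst ` S)) = S"
proof
  show "parts_in \<pi> (\<Union> (fst ` S)) \<subseteq> S"
  proof
    fix p assume "p \<in> parts_in \<pi> (\<Union> (fst ` S))"
    then have p: "(fst p, snd p) \<in> \<pi>" "fst p \<subseteq> \<Union> (fst ` S)" by (auto simp: parts_in_def)
    then obtain x where "x \<in> fst p" using wp_nonempty[OF wp] by blast
    with p(2) obtain q where q: "q \<in> S" "x \<in> fst q" by blast
    then have "(fst q, snd q) \<in> \<pi>" using S by auto
    from wp_disj[OF wp p(1) this \<open>x \<in> fst p\<close> q(2)] have "p = q" by (simp add: prod_eq_iff)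
    with q show "p \<in> S" by simp
  qed
  show "S \<subseteq> parts_in \<pi> (\<Union> (fst ` S))" using S by (auto simp: parts_in_def)
qed

lemma parts_in_block:
  assumes "\<pi> \<in> wpartitions n" "(A, a) \<in> \<pi>"
  shows "parts_in \<pi> A = {(A, a)}"
  using parts_in_Union[OF assms(1), of "{(A, a)}"] assms by simp

lemma parts_in_two:
  assumes "\<pi> \<in> wpartitions n" "(A, a) \<in> \<pi>" "(B, b) \<in> \<pi>"
  shows "parts_in \<pi> (A \<union> B) = {(A, a), (B, b)}"
  using parts_in_Union[OF assms(1), of "{(A, a), (B, b)}"] assms by simp

lemma finite_parts_in: "\<pi> \<in> wpartitions n \<Longrightarrow> finite (parts_in \<pi> B)"
  by (rule finite_subset[OF _ wp_finite]) (auto simp: parts_in_def)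

definition wsum :: "wpart \<Rightarrow> nat set \<Rightarrow> int" where
  "wsum \<pi> B = (\<Sum>p\<in>parts_in \<pi> B. int (snd p))"

lemma Ball_pair: "(\<forall>p\<in>S. P p) \<longleftrightarrow> (\<forall>a b. (a, b) \<in> S \<longrightarrow> P (a, b))"
  by auto

lemma Bex_pair: "(\<exists>p\<in>S. P p) \<longleftrightarrow> (\<exists>a b. (a, b) \<in> S \<and> P (a, b))"
  by auto

text \<open>Replaces the membership in an integer interval by two inequalities, which can be summed
  over blocks.\<close>

lemma wle_iff:
  assumes "\<pi> \<in> wpartitions n" "\<rho> \<in> wpartitions n"
  shows "wle n \<pi> \<rho> \<longleftrightarrow> (\<forall>A a. (A, a) \<in> \<pi> \<longrightarrow> (\<exists>C v. (C, v) \<in> \<rho> \<and> A \<subseteq> C)) \<and>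
    (\<forall>C v. (C, v) \<in> \<rho> \<longrightarrow> wsum \<pi> C \<le> int v \<and> int v < wsum \<pi> C + int (card (parts_in \<pi> C)))"
proof -
  have "partition_on {1..n} (fst ` \<pi>)" "partition_on {1..n} (fst ` \<rho>)"
    using assms by (simp_all add: wpartitions_def)
  then have "refines {1..n} (fst ` \<pi>) (fst ` \<rho>) \<longleftrightarrow> (\<forall>p\<in>\<pi>. \<exists>q\<in>\<rho>. fst p \<subseteq> fst q)"
    by (simp add: refines_def)
  moreover have "(int v - wsum \<pi> B \<in> {0..int (card (parts_in \<pi> B)) - 1}) \<longleftrightarrow>
      wsum \<pi> B \<le> int v \<and> int v < wsum \<pi> B + int (card (parts_in \<pi> B))" for B v
    by auto
  ultimately show ?thesis
    unfolding wle_def split_beta wsum_def[symmetric] by (simp only: Ball_pair Bex_pair fst_conv snd_conv)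
qed

lemma wle_sub:
  assumes "\<pi> \<in> wpartitions n" "\<rho> \<in> wpartitions n" "wle n \<pi> \<rho>" "(A, a) \<in> \<pi>"
  obtains C v where "(C, v) \<in> \<rho>" "A \<subseteq> C"
  using assms wle_iff by blast

lemma wle_overlap:
  assumes "\<pi> \<in> wpartitions n" "\<rho> \<in> wpartitions n" "wle n \<pi> \<rho>" "(A, a) \<in> \<pi>" "(C, v) \<in> \<rho>"
    and "x \<in> A" "x \<in> C"
  shows "A \<subseteq> C"
proof -
  obtain C' v' where "(C', v') \<in> \<rho>" "A \<subseteq> C'" using wle_sub assms by blast
  with wp_disj(1)[OF assms(2,5) this(1) assms(7)] assms(6) show ?thesis by blast
qed

text \<open>The hypothesis says that \<open>B\<close> contains a block of \<open>\<rho>\<close> as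
  soon as it contains one of its parts. It is used for blocks of a coarser partition and for
  \<open>{1..n}\<close>.\<close>

lemma parts_in_decomp:
  assumes wp: "\<pi> \<in> wpartitions n" "\<rho> \<in> wpartitions n" and le: "wle n \<pi> \<rho>"
    and B: "\<And>A a C v. (A, a) \<in> \<pi> \<Longrightarrow> (C, v) \<in> \<rho> \<Longrightarrow> A \<subseteq> B \<Longrightarrow> A \<subseteq> C \<Longrightarrow> C \<subseteq> B"
  shows "parts_in \<pi> B = (\<Union>c\<in>parts_in \<rho> B. parts_in \<pi> (fst c))"
proof
  show "parts_in \<pi> B \<subseteq> (\<Union>c\<in>parts_in \<rho> B. parts_in \<pi> (fst c))"
  proof
    fix p assume "p \<in> parts_in \<pi> B"
    then obtain A a where p: "p = (A, a)" "(A, a) \<in> \<pi>" "A \<subseteq> B" by (auto simp: parts_in_def)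
    obtain C v where C: "(C, v) \<in> \<rho>" "A \<subseteq> C" using wle_sub[OF wp le p(2)] by blast
    then have "(C, v) \<in> parts_in \<rho> B" using B p by (auto simp: parts_in_def)
    moreover have "p \<in> parts_in \<pi> (fst (C, v))" using p C by (auto simp: parts_in_def)
    ultimately show "p \<in> (\<Union>c\<in>parts_in \<rho> B. parts_in \<pi> (fst c))" by blast
  qed
  show "(\<Union>c\<in>parts_in \<rho> B. parts_in \<pi> (fst c)) \<subseteq> parts_in \<pi> B"
    by (fastforce simp: parts_in_def)
qed

lemma sum_parts_in_decomp:
  assumes wp: "\<pi> \<in> wpartitions n" "\<rho> \<in> wpartitions n" and le: "wle n \<pi> \<rho>"
    and B: "\<And>A a C v. (A, a) \<in> \<pi> \<Longrightarrow> (C, v) \<in> \<rho> \<Longrightarrow> A \<subseteq> B \<Longrightarrow> A \<subseteq> C \<Longrightarrow> C \<subseteq> B"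
  shows "(\<Sum>p\<in>parts_in \<pi> B. g p) = (\<Sum>c\<in>parts_in \<rho> B. \<Sum>p\<in>parts_in \<pi> (fst c). g p)"
proof -
  have "parts_in \<pi> (fst c) \<inter> parts_in \<pi> (fst d) = {}"
    if "c \<in> parts_in \<rho> B" "d \<in> parts_in \<rho> B" "c \<noteq> d" for c d
  proof (rule ccontr)
    assume "\<not> ?thesis"
    then obtain A a where A: "(A, a) \<in> \<pi>" "A \<subseteq> fst c" "A \<subseteq> fst d" by (auto simp: parts_in_def)
    then obtain x where "x \<in> A" using wp_nonempty wp by blast
    with A have "x \<in> fst c" "x \<in> fst d" by auto
    moreover have "(fst c, snd c) \<in> \<rho>" "(fst d, snd d) \<in> \<rho>" using that by (auto simp: parts_in_def)
    ultimately have "c = d" using wp_disj[OF wp(2)] by (metis prod.collapse)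
    with that show False by simp
  qed
  then show ?thesis
    using finite_parts_in[OF wp(1)] finite_parts_in[OF wp(2)]
    by (subst parts_in_decomp[OF assms]) (assumption | rule sum.UNION_disjoint ballI impI)+
qed

lemma card_parts_in_pos:
  assumes wp: "\<pi> \<in> wpartitions n" "\<rho> \<in> wpartitions n" and le: "wle n \<pi> \<rho>" and "(C, v) \<in> \<rho>"
  shows "1 \<le> card (parts_in \<pi> C)"
proof -
  obtain x where x: "x \<in> C" using wp_nonempty[OF wp(2) assms(4)] by blast
  then have "x \<in> {1..n}" using wp_subset[OF wp(2) assms(4)] by blast
  from wp_cover[OF wp(1) this] obtain A a where A: "(A, a) \<in> \<pi>" "x \<in> A" by blast
  have "A \<subseteq> C" by (rule wle_overlap[OF wp le A(1) assms(4) A(2) x])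
  with A have "parts_in \<pi> C \<noteq> {}" unfolding parts_in_def by blast
  then show ?thesis using finite_parts_in[OF wp(1)] by (simp add: Suc_le_eq card_gt_0_iff)
qed

text \<open>Let a block of \<open>\<tau>\<close> contain \<open>k\<close> blocks of
  \<open>\<rho>\<close>. Each of these exceeds the weight of its parts by at most the number of its
  parts minus one, so the sum of the excesses stays \<open>k\<close> below the total number of
  parts; the step from \<open>\<rho>\<close> to \<open>\<tau>\<close> adds at most
  \<open>k - 1\<close>.\<close>

lemma wle_trans:
  assumes wp: "\<pi> \<in> wpartitions n" "\<rho> \<in> wpartitions n" "\<tau> \<in> wpartitions n"
    and le: "wle n \<pi> \<rho>" "wle n \<rho> \<tau>"
  shows "wle n \<pi> \<tau>"
  unfolding wle_iff[OF wp(1,3)]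
proof (intro conjI allI impI)
  fix A a assume "(A, a) \<in> \<pi>"
  from wle_sub[OF wp(1,2) le(1) this] obtain C v where C: "(C, v) \<in> \<rho>" "A \<subseteq> C" .
  from wle_sub[OF wp(2,3) le(2) C(1)] obtain D w where "(D, w) \<in> \<tau>" "C \<subseteq> D" .
  with C show "\<exists>C v. (C, v) \<in> \<tau> \<and> A \<subseteq> C" by (metis order_trans)
next
  fix B v assume B: "(B, v) \<in> \<tau>"
  have sub: "C \<subseteq> B" if "(A, a) \<in> \<pi>" "(C, w) \<in> \<rho>" "A \<subseteq> B" "A \<subseteq> C" for A a C w
    using wle_overlap[OF wp(2,3) le(2) that(2) B] that wp_nonempty[OF wp(1) that(1)] by blast
  have ws: "wsum \<pi> B = (\<Sum>c\<in>parts_in \<rho> B. wsum \<pi> (fst c))"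
    unfolding wsum_def by (rule sum_parts_in_decomp[OF wp(1,2) le(1) sub])
  have cs: "int (card (parts_in \<pi> B)) = (\<Sum>c\<in>parts_in \<rho> B. int (card (parts_in \<pi> (fst c))))"
    using sum_parts_in_decomp[OF wp(1,2) le(1) sub, where g = "\<lambda>_. 1 :: int"] by simp
  have c: "wsum \<pi> (fst c) \<le> int (snd c) \<and> int (snd c) \<le> wsum \<pi> (fst c) + int (card (parts_in \<pi> (fst c))) - 1"
    if "c \<in> parts_in \<rho> B" for c
    using le(1) that unfolding wle_iff[OF wp(1,2)] by (force simp: parts_in_def)
  have "wsum \<pi> B \<le> wsum \<rho> B" unfolding ws wsum_def[of \<rho>] using c by (intro sum_mono) blast
  moreover have "wsum \<rho> B \<le> (\<Sum>c\<in>parts_in \<rho> B. wsum \<pi> (fst c) + int (card (parts_in \<pi> (fst c))) - 1)"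
    unfolding wsum_def[of \<rho>] using c by (intro sum_mono) blast
  then have "wsum \<rho> B \<le> wsum \<pi> B + int (card (parts_in \<pi> B)) - int (card (parts_in \<rho> B))"
    by (simp add: ws cs sum.distrib sum_subtractf)
  moreover have "wsum \<rho> B \<le> int v" "int v < wsum \<rho> B + int (card (parts_in \<rho> B))"
    using le(2) B unfolding wle_iff[OF wp(2,3)] by blast+
  ultimately show "wsum \<pi> B \<le> int v" "int v < wsum \<pi> B + int (card (parts_in \<pi> B))" by linarith+
qed

text \<open>Every block of \<open>\<rho>\<close> contains at least one part of \<open>\<pi>\<close>.
  If the numbers agree, every block is a single part, and then the only admissible weight difference
  is 0. The number of blocks thus replaces the rank.\<close>

lemma wle_card:
  assumes wp: "\<pi> \<in> wpartitions n" "\<rho> \<in> wpartitions n" and le: "wle n \<pi> \<rho>"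
  shows "card \<rho> \<le> card \<pi>" and "card \<rho> = card \<pi> \<Longrightarrow> \<rho> = \<pi>"
proof -
  have "parts_in \<pi> {1..n} = \<pi>" "parts_in \<rho> {1..n} = \<rho>"
    using wp_subset[OF wp(1)] wp_subset[OF wp(2)] by (force simp: parts_in_def)+
  then have s: "card \<pi> = (\<Sum>c\<in>\<rho>. card (parts_in \<pi> (fst c)))"
    using sum_parts_in_decomp[OF wp le, where B = "{1..n}" and g = "\<lambda>_. 1 :: nat"] wp_subset[OF wp(2)] by simp
  have ge: "1 \<le> card (parts_in \<pi> (fst c))" if "c \<in> \<rho>" for c
    using card_parts_in_pos[OF wp le, of "fst c" "snd c"] that by simp
  have "(\<Sum>c\<in>\<rho>. 1) \<le> card \<pi>" unfolding s using ge by (intro sum_mono)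
  then show "card \<rho> \<le> card \<pi>" by simp
  assume eq: "card \<rho> = card \<pi>"
  have one: "card (parts_in \<pi> (fst c)) = 1" if "c \<in> \<rho>" for c
    using sum_mono_inv[of "\<lambda>_. 1" \<rho> "\<lambda>c. card (parts_in \<pi> (fst c))" c] s eq ge that wp_finite[OF wp(2)] by simp
  have "\<rho> \<subseteq> \<pi>"
  proof
    fix c assume c: "c \<in> \<rho>"
    obtain p where p: "parts_in \<pi> (fst c) = {p}" using one[OF c] by (auto simp: card_1_singleton_iff)
    then have "p \<in> parts_in \<pi> (fst c)" by simp
    then have "p \<in> \<pi>" "fst p \<subseteq> fst c" by (auto simp: parts_in_def)
    moreover have "fst c \<subseteq> fst p"
    proof
      fix x assume x: "x \<in> fst c"
      then have "x \<in> {1..n}" using wp_subset[OF wp(2), of "fst c" "snd c"] c by auto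
      from wp_cover[OF wp(1) this] obtain A a where A: "(A, a) \<in> \<pi>" "x \<in> A" by blast
      then have "(A, a) \<in> parts_in \<pi> (fst c)"
        using wle_overlap[OF wp le A(1), of "fst c" "snd c"] c x by (auto simp: parts_in_def)
      with p A show "x \<in> fst p" by auto
    qed
    moreover have "snd c = snd p"
      using le c p unfolding wle_iff[OF wp] wsum_def by (cases c) force
    ultimately show "c \<in> \<pi>" by (metis prod.collapse subset_antisym)
  qed
  then show "\<rho> = \<pi>" using eq wp_finite[OF wp(1)] by (metis card_subset_eq)
qed

section \<open>Merges as the covering relations\<close>

lemma merge_eq:
  assumes wp: "\<pi> \<in> wpartitions n" and A: "(A, a) \<in> \<pi>" and B: "(B, b) \<in> \<pi>"
  shows "merge u A B \<pi> = insert (A \<union> B, a + b + u) (\<pi> - {(A, a), (B, b)})"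
proof -
  have "{(A \<union> B, a + b + u) | a b. (A, a) \<in> \<pi> \<and> (B, b) \<in> \<pi>} = {(A \<union> B, a + b + u)}"
    using A B wp_fst_eq[OF wp A] wp_fst_eq[OF wp B] by blast
  moreover have "{(C, w) \<in> \<pi>. C \<noteq> A \<and> C \<noteq> B} = \<pi> - {(A, a), (B, b)}"
    using wp_fst_eq[OF wp A] wp_fst_eq[OF wp B] by auto
  ultimately show ?thesis unfolding merge_def by simp
qed

text \<open>The bound on weights survives because \<open>(card A - 1) + (card B - 1) + 1\<close> is
  \<open>card (A \<union> B) - 1\<close>.\<close>

lemma merge_in_wpartitions:
  assumes wp: "\<pi> \<in> wpartitions n" and A: "(A, a) \<in> \<pi>" and B: "(B, b) \<in> \<pi>" and "A \<noteq> B" "u \<le> 1"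
  shows "merge u A B \<pi> \<in> wpartitions n"
proof (rule wpartitionsI)
  note eq = merge_eq[OF wp A B, of u]
  have AB: "A \<inter> B = {}" using wp_disj(1)[OF wp A B] \<open>A \<noteq> B\<close> by blast
  \<comment> \<open>Positivity matters, since the weight bounds use truncated subtraction.\<close>
  have "card A > 0" "card B > 0"
    using wp_finite_block[OF wp] wp_nonempty[OF wp] A B by (auto simp: card_gt_0_iff)
  moreover have "card (A \<union> B) = card A + card B"
    using AB wp_finite_block[OF wp] A B by (simp add: card_Un_disjoint)
  ultimately have w: "a + b + u \<le> card (A \<union> B) - 1"
    using wp_weight[OF wp A] wp_weight[OF wp B] \<open>u \<le> 1\<close> by linarith
  fix C c assume C: "(C, c) \<in> merge u A B \<pi>"
  then show "C \<noteq> {} \<and> C \<subseteq> {1..n} \<and> c \<le> card C - 1"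
    unfolding eq using w wp_nonempty[OF wp] wp_subset[OF wp] wp_weight[OF wp] A B by blast
  fix D d x assume D: "(D, d) \<in> merge u A B \<pi>" and x: "x \<in> C" "x \<in> D"
  have "(C, c) = (D, d)"
    using C D x wp_disj[OF wp] A B unfolding eq by (smt (verit) Diff_iff Pair_inject Un_iff insert_iff)
  then show "C = D \<and> c = d" by simp
next
  fix x assume "x \<in> {1..n}"
  then obtain C c where "(C, c) \<in> \<pi>" "x \<in> C" using wp_cover[OF wp] by blast
  then show "\<exists>(C, c)\<in>merge u A B \<pi>. x \<in> C" unfolding merge_eq[OF wp A B] by auto
qed

lemma union_not_block:
  assumes wp: "\<pi> \<in> wpartitions n" and A: "(A, a) \<in> \<pi>" and B: "(B, b) \<in> \<pi>" and "A \<noteq> B"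
  shows "(A \<union> B, c) \<notin> \<pi>"
  using wp_subset_eq[OF wp A, of "A \<union> B" c] wp_subset_eq[OF wp B, of "A \<union> B" c] \<open>A \<noteq> B\<close> by auto

lemma card_merge:
  assumes wp: "\<pi> \<in> wpartitions n" and A: "(A, a) \<in> \<pi>" and B: "(B, b) \<in> \<pi>" and "A \<noteq> B"
  shows "Suc (card (merge u A B \<pi>)) = card \<pi>"
proof -
  have "card {(A, a), (B, b)} = 2" using \<open>A \<noteq> B\<close> by simp
  moreover have "card {(A, a), (B, b)} \<le> card \<pi>" using A B wp_finite[OF wp] by (intro card_mono) auto
  moreover have "card (\<pi> - {(A, a), (B, b)}) = card \<pi> - card {(A, a), (B, b)}"
    using A B by (intro card_Diff_subset) auto
  moreover have "(A \<union> B, a + b + u) \<notin> \<pi> - {(A, a), (B, b)}" using union_not_block[OF assms] by simp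
  ultimately show ?thesis
    using wp_finite[OF wp] by (simp add: merge_eq[OF wp A B])
qed

text \<open>In \<open>C\<close> the merge raises the sum of the weights by \<open>u\<close> and
  lowers the number of parts by one; the other blocks of \<open>\<rho>\<close> keep their
  parts.\<close>

lemma merge_le_iff:
  assumes wp: "\<pi> \<in> wpartitions n" "\<rho> \<in> wpartitions n" and le: "wle n \<pi> \<rho>"
    and A: "(A, a) \<in> \<pi>" and B: "(B, b) \<in> \<pi>" and "A \<noteq> B" "u \<le> 1"
    and C: "(C, v) \<in> \<rho>" and sub: "A \<subseteq> C" "B \<subseteq> C"
  shows "wle n (merge u A B \<pi>) \<rho> \<longleftrightarrow>
    wsum \<pi> C + int u \<le> int v \<and> int v < wsum \<pi> C + int u + int (card (parts_in \<pi> C)) - 1"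
proof -
  let ?m = "merge u A B \<pi>"
  note eq = merge_eq[OF wp(1) A B, of u]
  have wm: "?m \<in> wpartitions n" using merge_in_wpartitions wp A B \<open>A \<noteq> B\<close> \<open>u \<le> 1\<close> by blast
  have C_parts: "parts_in ?m C = insert (A \<union> B, a + b + u) (parts_in \<pi> C - {(A, a), (B, b)})"
    unfolding eq parts_in_def using sub by auto
  have fin: "finite (parts_in \<pi> C)" by (rule finite_parts_in[OF wp(1)])
  have new: "(A \<union> B, a + b + u) \<notin> parts_in \<pi> C - {(A, a), (B, b)}"
    using union_not_block[OF wp(1) A B \<open>A \<noteq> B\<close>] by (simp add: parts_in_def)
  have in_C: "{(A, a), (B, b)} \<subseteq> parts_in \<pi> C" using A B sub by (simp add: parts_in_def)
  have "wsum \<pi> C = (\<Sum>p\<in>parts_in \<pi> C - {(A, a), (B, b)}. int (snd p)) + int a + int b"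
    unfolding wsum_def using sum.subset_diff[OF in_C fin, of "\<lambda>p. int (snd p)"] \<open>A \<noteq> B\<close> by simp
  then have ws: "wsum ?m C = wsum \<pi> C + int u"
    unfolding wsum_def[of ?m] C_parts using fin new by (subst sum.insert) auto
  have "card (parts_in \<pi> C - {(A, a), (B, b)}) = card (parts_in \<pi> C) - 2"
    using card_Diff_subset[of "{(A, a), (B, b)}" "parts_in \<pi> C"] in_C \<open>A \<noteq> B\<close> by simp
  moreover have "2 \<le> card (parts_in \<pi> C)"
    using card_mono[OF fin in_C] \<open>A \<noteq> B\<close> by simp
  ultimately have cs: "int (card (parts_in ?m C)) = int (card (parts_in \<pi> C)) - 1"
    unfolding C_parts using fin new by simp
  have other: "parts_in ?m D = parts_in \<pi> D" if "(D, w) \<in> \<rho>" "D \<noteq> C" for D w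
  proof -
    have "\<not> A \<subseteq> D" using wp_disj(1)[OF wp(2) that(1) C] sub that wp_nonempty[OF wp(1) A] by blast
    moreover have "\<not> B \<subseteq> D" using wp_disj(1)[OF wp(2) that(1) C] sub that wp_nonempty[OF wp(1) B] by blast
    ultimately show ?thesis unfolding eq parts_in_def by auto
  qed
  have ref: "\<exists>D w. (D, w) \<in> \<rho> \<and> X \<subseteq> D" if "(X, x) \<in> ?m" for X x
    using that sub C wle_sub[OF wp le] unfolding eq by (metis Diff_iff Pair_inject Un_least insert_iff)
  show ?thesis
  proof
    assume "wle n ?m \<rho>"
    then show "wsum \<pi> C + int u \<le> int v \<and> int v < wsum \<pi> C + int u + int (card (parts_in \<pi> C)) - 1"
      using C unfolding wle_iff[OF wm wp(2)] ws[symmetric] using cs by fastforce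
  next
    assume r: "wsum \<pi> C + int u \<le> int v \<and> int v < wsum \<pi> C + int u + int (card (parts_in \<pi> C)) - 1"
    have "wsum ?m D \<le> int w \<and> int w < wsum ?m D + int (card (parts_in ?m D))" if D: "(D, w) \<in> \<rho>" for D w
    proof (cases "D = C")
      case True
      then have "w = v" using wp_fst_eq[OF wp(2)] C D by blast
      then show ?thesis using r True ws cs by simp
    next
      case False
      then show ?thesis using le D unfolding wle_iff[OF wp] wsum_def other[OF D False] by blast
    qed
    then show "wle n ?m \<rho>" using ref unfolding wle_iff[OF wm wp(2)] by blast
  qed
qed

lemma wle_merge:
  assumes wp: "\<pi> \<in> wpartitions n" and A: "(A, a) \<in> \<pi>" and B: "(B, b) \<in> \<pi>" and "A \<noteq> B" "u \<le> 1"
  shows "wle n \<pi> (merge u A B \<pi>)"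
proof -
  have wm: "merge u A B \<pi> \<in> wpartitions n" using merge_in_wpartitions assms by blast
  note eq = merge_eq[OF wp A B, of u]
  show ?thesis
    unfolding wle_iff[OF wp wm]
  proof (intro conjI allI impI)
    fix C c assume "(C, c) \<in> \<pi>"
    then show "\<exists>D v. (D, v) \<in> merge u A B \<pi> \<and> C \<subseteq> D" unfolding eq by blast
  next
    fix C v assume C: "(C, v) \<in> merge u A B \<pi>"
    have "wsum \<pi> C \<le> int v \<and> int v < wsum \<pi> C + int (card (parts_in \<pi> C))"
    proof (cases "(C, v) \<in> \<pi>")
      case True
      then show ?thesis by (simp add: wsum_def parts_in_block[OF wp])
    next
      case False
      with C have "C = A \<union> B" "v = a + b + u" unfolding eq by auto
      then show ?thesis using \<open>A \<noteq> B\<close> \<open>u \<le> 1\<close> by (simp add: wsum_def parts_in_two[OF wp A B])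
    qed
    then show "wsum \<pi> C \<le> int v" "int v < wsum \<pi> C + int (card (parts_in \<pi> C))" by blast+
  qed
qed

text \<open>Some block of \<open>\<rho>\<close> has at least two parts, as otherwise the numbers of
  blocks would agree. Any two of them can be merged with a suitable \<open>u\<close>, so the poset
  is graded by the number of blocks.\<close>

lemma interpolate_merge:
  assumes wp: "\<pi> \<in> wpartitions n" "\<rho> \<in> wpartitions n" and le: "wle n \<pi> \<rho>" and "\<pi> \<noteq> \<rho>"
  obtains A a B b u where "(A, a) \<in> \<pi>" "(B, b) \<in> \<pi>" "A \<noteq> B" "u \<le> 1" "wle n (merge u A B \<pi>) \<rho>"
proof -
  have "\<exists>(C, v)\<in>\<rho>. 2 \<le> card (parts_in \<pi> C)"
  proof (rule ccontr)
    assume neg: "\<not> ?thesis"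
    have "card (parts_in \<pi> (fst c)) = 1" if "c \<in> \<rho>" for c
      using neg that card_parts_in_pos[OF wp le, of "fst c" "snd c"] by (force simp: split_beta)
    moreover have "parts_in \<pi> {1..n} = \<pi>" "parts_in \<rho> {1..n} = \<rho>"
      using wp_subset[OF wp(1)] wp_subset[OF wp(2)] by (force simp: parts_in_def)+
    ultimately have "card \<pi> = card \<rho>"
      using sum_parts_in_decomp[OF wp le, where B = "{1..n}" and g = "\<lambda>_. 1 :: nat"] wp_subset[OF wp(2)] by simp
    with wle_card(2)[OF wp le] \<open>\<pi> \<noteq> \<rho>\<close> show False by simp
  qed
  then obtain C v where C: "(C, v) \<in> \<rho>" "2 \<le> card (parts_in \<pi> C)" by blast
  then obtain p q where pq: "p \<in> parts_in \<pi> C" "q \<in> parts_in \<pi> C" "p \<noteq> q"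
    by (metis card_2_iff' card_le_Suc0_iff_eq finite_parts_in le_simps(3) numeral_2_eq_2 order_antisym_conv wp(1) not_less_eq_eq)
  obtain A a B b where AB: "p = (A, a)" "q = (B, b)" by fastforce
  have mem: "(A, a) \<in> \<pi>" "(B, b) \<in> \<pi>" "A \<subseteq> C" "B \<subseteq> C" using pq AB by (auto simp: parts_in_def)
  moreover have "A \<noteq> B" using wp_fst_eq[OF wp(1)] mem pq AB by blast
  \<comment> \<open>The excess of \<open>v\<close> lies between 0 and the number of parts minus one.
    An excess of 0 forces \<open>u = 0\<close>; from a positive one, 1 can be taken.\<close>
  moreover obtain u :: nat where "u \<le> 1" "wsum \<pi> C + int u \<le> int v"
    "int v < wsum \<pi> C + int u + int (card (parts_in \<pi> C)) - 1"
  proof -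
    have bounds: "wsum \<pi> C \<le> int v" "int v < wsum \<pi> C + int (card (parts_in \<pi> C))"
      using le C unfolding wle_iff[OF wp] by blast+
    show thesis
    proof (cases "int v = wsum \<pi> C")
      case True
      then show thesis using that[of 0] C(2) by simp
    next
      case False
      then show thesis using that[of 1] bounds by simp
    qed
  qed
  ultimately show thesis
    using that[of A a B b u] merge_le_iff[OF wp le mem(1,2) _ _ C(1) mem(3,4)] by blast
qed

lemma cover_is_merge:
  assumes wp: "\<pi> \<in> wpartitions n" "\<rho> \<in> wpartitions n" and le: "wle n \<pi> \<rho>"
    and "card \<pi> = Suc (card \<rho>)"
  obtains A a B b u where "(A, a) \<in> \<pi>" "(B, b) \<in> \<pi>" "A \<noteq> B" "u \<le> 1" "\<rho> = merge u A B \<pi>"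
proof -
  have "\<pi> \<noteq> \<rho>" using assms(4) by auto
  then obtain A a B b u where *: "(A, a) \<in> \<pi>" "(B, b) \<in> \<pi>" "A \<noteq> B" "u \<le> 1" "wle n (merge u A B \<pi>) \<rho>"
    using interpolate_merge[OF wp le] by metis
  moreover have "card \<rho> = card (merge u A B \<pi>)" using card_merge[OF wp(1) *(1-3), of u] assms(4) by simp
  ultimately show thesis
    using that wle_card(2)[OF merge_in_wpartitions[OF wp(1) *(1-4)] wp(2) *(5)] by blast
qed

text \<open>The union is the only block of the result that is not in \<open>\<pi>\<close>. Its parts
  give back the pair up to order, and the weights then give \<open>u\<close>.\<close>

lemma merge_inj:
  assumes wp: "\<pi> \<in> wpartitions n" and A: "(A, a) \<in> \<pi>" and B: "(B, b) \<in> \<pi>" and "A \<noteq> B"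
    and A': "(A', a') \<in> \<pi>" and B': "(B', b') \<in> \<pi>" and "A' \<noteq> B'"
    and eq: "merge u A B \<pi> = merge u' A' B' \<pi>"
  shows "A \<union> B = A' \<union> B'" and "u = u'"
proof -
  have "(A \<union> B, a + b + u) \<in> merge u' A' B' \<pi>"
    unfolding eq[symmetric] merge_eq[OF wp A B] by simp
  then have e: "(A \<union> B, a + b + u) = (A' \<union> B', a' + b' + u')"
    unfolding merge_eq[OF wp A' B'] using union_not_block[OF wp A B \<open>A \<noteq> B\<close>] by auto
  then show U: "A \<union> B = A' \<union> B'" by simp
  have "{(A, a), (B, b)} = {(A', a'), (B', b')}"
    using parts_in_two[OF wp A B] parts_in_two[OF wp A' B'] U by simp
  then have "a + b = a' + b'" by (auto simp: doubleton_eq_iff)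
  with e show "u = u'" by simp
qed

lemma merge_commute: "merge u A B \<pi> = merge u B A \<pi>"
  unfolding merge_def by (auto simp: Un_commute add.commute add.left_commute)

section \<open>Maximal chains from linear extensions of the nodes\<close>

definition blocks :: "nat \<Rightarrow> node set \<Rightarrow> nat set set" where
  "blocks n F = {X \<in> fst ` F \<union> (\<lambda>x. {x}) ` {1..n}. \<forall>Y\<in>fst ` F. X \<subseteq> Y \<longrightarrow> X = Y}"

definition red_wt :: "node set \<Rightarrow> nat set \<Rightarrow> nat" where
  "red_wt F X = card {y \<in> F. snd y = Red \<and> fst y \<subseteq> X}"

text \<open>The element of the chain that is reached after the merges \<open>F\<close>. Its blocks
  are the maximal sets among the nodes and the singletons; the weight of a block counts the red
  nodes inside it, as every red merge adds 1. It depends on the set of merges and not on their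
  order.\<close>

definition forest_wpart :: "nat \<Rightarrow> node set \<Rightarrow> wpart" where
  "forest_wpart n F = (\<lambda>X. (X, red_wt F X)) ` blocks n F"

text \<open>The invariant of a set of merges that can be carried out. That the result is a weighted
  partition supplies the disjointness of the blocks.\<close>

definition good_forest :: "nat \<Rightarrow> node set \<Rightarrow> bool" where
  "good_forest n F \<longleftrightarrow> finite F \<and> (\<forall>x\<in>F. fst x \<noteq> {} \<and> fst x \<subseteq> {1..n})
     \<and> forest_wpart n F \<in> wpartitions n"

lemma in_forest_wpart: "(X, v) \<in> forest_wpart n F \<longleftrightarrow> X \<in> blocks n F \<and> v = red_wt F X"
  by (auto simp: forest_wpart_def)

lemma blocks_disjoint:
  assumes "good_forest n F" "A \<in> blocks n F" "B \<in> blocks n F" "A \<noteq> B"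
  shows "A \<inter> B = {}"
proof (rule ccontr)
  assume "A \<inter> B \<noteq> {}"
  then obtain x where x: "x \<in> A" "x \<in> B" by blast
  have "forest_wpart n F \<in> wpartitions n" using assms(1) by (simp add: good_forest_def)
  moreover have "(A, red_wt F A) \<in> forest_wpart n F" "(B, red_wt F B) \<in> forest_wpart n F"
    using assms(2,3) by (simp_all add: in_forest_wpart)
  ultimately show False using wp_disj(1) x \<open>A \<noteq> B\<close> by metis
qed

lemma blocks_nonempty: "good_forest n F \<Longrightarrow> A \<in> blocks n F \<Longrightarrow> A \<noteq> {}"
  by (auto simp: good_forest_def blocks_def)

lemma node_in_block:
  assumes "good_forest n F" "y \<in> F"
  obtains C where "C \<in> blocks n F" "fst y \<subseteq> C"
proof -
  have "finite (fst ` F)" "fst y \<in> fst ` F" using assms by (auto simp: good_forest_def)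
  from finite_has_maximal2[OF this] obtain M where
    M: "M \<in> fst ` F" "fst y \<subseteq> M" "\<forall>Y\<in>fst ` F. M \<subseteq> Y \<longrightarrow> M = Y" by metis
  then have "M \<in> blocks n F" by (simp add: blocks_def)
  with M that show thesis by blast
qed

text \<open>Blocks are maximal among the nodes, so a node above both would be equal to both.\<close>

lemma union_not_subset_node:
  assumes g: "good_forest n F" and A: "A \<in> blocks n F" and B: "B \<in> blocks n F" and "A \<noteq> B" "y \<in> F"
  shows "\<not> A \<union> B \<subseteq> fst y"
proof
  assume "A \<union> B \<subseteq> fst y"
  then have sub: "A \<subseteq> fst y" "B \<subseteq> fst y" by auto
  have max: "\<forall>y\<in>F. A \<subseteq> fst y \<longrightarrow> A = fst y" "\<forall>y\<in>F. B \<subseteq> fst y \<longrightarrow> B = fst y"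
    using A B unfolding blocks_def by simp_all
  have "A = fst y" "B = fst y" using max \<open>y \<in> F\<close> sub by blast+
  with \<open>A \<noteq> B\<close> show False by simp
qed

lemma blocks_insert:
  assumes g: "good_forest n F" and A: "A \<in> blocks n F" and B: "B \<in> blocks n F" and "A \<noteq> B"
  shows "blocks n (insert (A \<union> B, c) F) = insert (A \<union> B) (blocks n F - {A, B})"
proof
  show "blocks n (insert (A \<union> B, c) F) \<subseteq> insert (A \<union> B) (blocks n F - {A, B})"
    unfolding blocks_def by auto
  have "A \<union> B \<in> blocks n (insert (A \<union> B, c) F)"
    using union_not_subset_node[OF assms] unfolding blocks_def by auto
  moreover have "Z \<in> blocks n (insert (A \<union> B, c) F)" if Z: "Z \<in> blocks n F - {A, B}" for Z
  proof -
    have "Z \<inter> A = {}" "Z \<inter> B = {}" "Z \<noteq> {}"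
      using blocks_disjoint[OF g _ A] blocks_disjoint[OF g _ B] blocks_nonempty[OF g] Z by auto
    then have "\<not> Z \<subseteq> A \<union> B" by blast
    with Z show ?thesis unfolding blocks_def by auto
  qed
  ultimately show "insert (A \<union> B) (blocks n F - {A, B}) \<subseteq> blocks n (insert (A \<union> B, c) F)" by auto
qed

lemma red_wt_insert_other: "\<not> X \<subseteq> Z \<Longrightarrow> red_wt (insert (X, c) F) Z = red_wt F Z"
  unfolding red_wt_def by (rule arg_cong[where f = card]) auto

text \<open>Every node lies inside a single block, and blocks are disjoint, so a nonempty node
  inside \<open>A \<union> B\<close> cannot meet both.\<close>

lemma forest_subset_union:
  assumes g: "good_forest n F" and A: "A \<in> blocks n F" and B: "B \<in> blocks n F" and y: "y \<in> F"
  shows "fst y \<subseteq> A \<union> B \<longleftrightarrow> fst y \<subseteq> A \<or> fst y \<subseteq> B"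
proof
  assume sub: "fst y \<subseteq> A \<union> B"
  obtain C where C: "C \<in> blocks n F" "fst y \<subseteq> C" using node_in_block[OF g y] .
  have "fst y \<noteq> {}" using g y by (auto simp: good_forest_def)
  then have "C \<inter> A \<noteq> {} \<or> C \<inter> B \<noteq> {}" using sub C(2) by blast
  then have "C = A \<or> C = B" using blocks_disjoint[OF g C(1)] A B by blast
  with C(2) show "fst y \<subseteq> A \<or> fst y \<subseteq> B" by blast
qed auto

text \<open>The old red nodes inside \<open>A \<union> B\<close> are those inside \<open>A\<close>
  and those inside \<open>B\<close>, without overlap; the new node counts exactly when its merge
  adds 1.\<close>

lemma forest_wpart_insert:
  assumes g: "good_forest n F" and A: "A \<in> blocks n F" and B: "B \<in> blocks n F" and "A \<noteq> B"
  shows "forest_wpart n (insert (A \<union> B, c) F) = merge (u_color c) A B (forest_wpart n F)"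
    and "good_forest n (insert (A \<union> B, c) F)"
proof -
  let ?F = "insert (A \<union> B, c) F"
  have fin: "finite F" and wp: "forest_wpart n F \<in> wpartitions n" using g by (auto simp: good_forest_def)
  have dis: "A \<inter> B = {}" by (rule blocks_disjoint[OF g A B \<open>A \<noteq> B\<close>])
  have mA: "(A, red_wt F A) \<in> forest_wpart n F" and mB: "(B, red_wt F B) \<in> forest_wpart n F"
    using A B by (simp_all add: in_forest_wpart)
  have "{y \<in> ?F. snd y = Red \<and> fst y \<subseteq> A \<union> B} =
      ({y \<in> F. snd y = Red \<and> fst y \<subseteq> A} \<union> {y \<in> F. snd y = Red \<and> fst y \<subseteq> B})
      \<union> (if c = Red then {(A \<union> B, c)} else {})"
    using forest_subset_union[OF g A B] by auto
  moreover have "(A \<union> B, d) \<notin> F" for d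
    using union_not_subset_node[OF g A B \<open>A \<noteq> B\<close>, of "(A \<union> B, d)"] by auto
  moreover have "{y \<in> F. snd y = Red \<and> fst y \<subseteq> A} \<inter> {y \<in> F. snd y = Red \<and> fst y \<subseteq> B} = {}"
  proof -
    have "\<not> (fst y \<subseteq> A \<and> fst y \<subseteq> B)" if "y \<in> F" for y
    proof -
      have "fst y \<noteq> {}" using g that by (simp add: good_forest_def)
      then show ?thesis using dis by blast
    qed
    then show ?thesis by blast
  qed
  ultimately have wt: "red_wt ?F (A \<union> B) = red_wt F A + red_wt F B + u_color c"
    unfolding red_wt_def using fin by (cases c) (simp_all add: card_Un_disjoint)
  have other: "red_wt ?F Z = red_wt F Z" if "Z \<in> blocks n F - {A, B}" for Z
  proof (rule red_wt_insert_other)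
    have "Z \<inter> A = {}" "A \<noteq> {}"
      using blocks_disjoint[OF g _ A] blocks_nonempty[OF g A] that by auto
    then show "\<not> A \<union> B \<subseteq> Z" by blast
  qed
  have "forest_wpart n F - {(A, red_wt F A), (B, red_wt F B)}
      = (\<lambda>X. (X, red_wt F X)) ` (blocks n F - {A, B})"
    unfolding forest_wpart_def by auto
  also have "\<dots> = (\<lambda>X. (X, red_wt ?F X)) ` (blocks n F - {A, B})"
    using other by (intro image_cong) auto
  finally show eq: "forest_wpart n ?F = merge (u_color c) A B (forest_wpart n F)"
    unfolding merge_eq[OF wp mA mB] by (simp add: forest_wpart_def blocks_insert[OF assms] wt)
  have "u_color c \<le> 1" by (cases c) simp_all
  then have "forest_wpart n ?F \<in> wpartitions n"
    unfolding eq by (rule merge_in_wpartitions[OF wp mA mB \<open>A \<noteq> B\<close>])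
  moreover have "A \<union> B \<noteq> {}" "A \<union> B \<subseteq> {1..n}"
    using wp_subset[OF wp mA] wp_subset[OF wp mB] blocks_nonempty[OF g A] by auto
  ultimately show "good_forest n ?F" using g by (simp add: good_forest_def)
qed

lemma forest_wpart_empty: "forest_wpart n {} = wbot n"
  by (auto simp: forest_wpart_def blocks_def red_wt_def wbot_def)

lemma wbot_in: "wbot n \<in> wpartitions n"
  by (rule wpartitionsI) (auto simp: wbot_def)

lemma good_forest_empty: "good_forest n {}"
  by (simp add: good_forest_def forest_wpart_empty wbot_in)

fun chain_from :: "nat \<Rightarrow> node set \<Rightarrow> node list \<Rightarrow> wpart list" where
  "chain_from n F [] = [forest_wpart n F]"
| "chain_from n F (x # L) = forest_wpart n F # chain_from n (insert x F) L"

text \<open>All elements but the last, so that a chain can be continued in a different way or after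
  an omission.\<close>

fun chain_init :: "nat \<Rightarrow> node set \<Rightarrow> node list \<Rightarrow> wpart list" where
  "chain_init n F [] = []"
| "chain_init n F (x # L) = forest_wpart n F # chain_init n (insert x F) L"

lemma chain_from_append: "chain_from n F (P @ Q) = chain_init n F P @ chain_from n (F \<union> set P) Q"
  by (induction P arbitrary: F) simp_all

lemma length_chain_from [simp]: "length (chain_from n F L) = Suc (length L)"
  by (induction L arbitrary: F) simp_all

lemma length_chain_init [simp]: "length (chain_init n F L) = length L"
  by (induction L arbitrary: F) simp_all

lemma last_chain_from: "last (chain_from n F L) = forest_wpart n (F \<union> set L)"
proof (induction L arbitrary: F)
  case (Cons x L)
  have "chain_from n (insert x F) L \<noteq> []" by (cases L) simp_all
  with Cons show ?case by simp
qed simp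

lemma hd_chain_from: "hd (chain_from n F L) = forest_wpart n F"
  by (cases L) simp_all

section \<open>Nodes of a bracketing inside a context\<close>

fun ctx_pre :: "nat ctx \<Rightarrow> node list" where
  "ctx_pre Hole = []"
| "ctx_pre (CtxL c K t) = ctx_pre K"
| "ctx_pre (CtxR c s K) = post s @ ctx_pre K"

text \<open>The nodes after the hole include its ancestors. Their letter sets depend on the filling,
  but only through its set \<open>S\<close> of letters.\<close>

fun ctx_suf :: "nat ctx \<Rightarrow> nat set \<Rightarrow> node list" where
  "ctx_suf Hole S = []"
| "ctx_suf (CtxL c K t) S = ctx_suf K S @ post t
     @ [(set (lets_before K) \<union> S \<union> set (lets_after K) \<union> lset t, c)]"
| "ctx_suf (CtxR c s K) S = ctx_suf K S
     @ [(lset s \<union> (set (lets_before K) \<union> S \<union> set (lets_after K)), c)]"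

lemma post_fill: "post (fill K g) = ctx_pre K @ post g @ ctx_suf K (lset g)"
  by (induction K) (simp_all add: letters_fill Un_assoc)

lemma ctx_pre_subset: "y \<in> set (ctx_pre K) \<Longrightarrow> fst y \<subseteq> set (lets_before K)"
proof (induction K)
  case (CtxR c s K)
  then show ?case using post_subset[of "fst y" "snd y" s] by auto
qed auto

lemma ctx_suf_cases: "y \<in> set (ctx_suf K S) \<Longrightarrow>
    S \<subseteq> fst y \<or> fst y \<subseteq> set (lets_before K) \<union> set (lets_after K)"
proof (induction K)
  case (CtxL c K t)
  then show ?case using post_subset[of "fst y" "snd y" t] by auto
qed auto

lemma post_decomp:
  assumes "x \<in> set (post m)"
  obtains K s t where "m = fill K (Bracket (snd x) s t)" "fst x = lset s \<union> lset t"
  using assms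
proof (induction m arbitrary: thesis)
  case (Bracket c s t)
  from Bracket.prems(2) show ?case
  proof (rule post_BracketE)
    assume "x \<in> set (post s)"
    then obtain K u v where "s = fill K (Bracket (snd x) u v)" "fst x = lset u \<union> lset v"
      using Bracket.IH(1) by blast
    then show ?case using Bracket.prems(1)[of "CtxL c K t" u v] by simp
  next
    assume "x \<in> set (post t)"
    then obtain K u v where "t = fill K (Bracket (snd x) u v)" "fst x = lset u \<union> lset v"
      using Bracket.IH(2) by blast
    then show ?case using Bracket.prems(1)[of "CtxR c s K" u v] by simp
  next
    assume "x = (lset s \<union> lset t, c)"
    then show ?case using Bracket.prems(1)[of Hole s t] by simp
  qed
qed simp

text \<open>The nodes form a laminar family: relative to a subbracketing, a node is inside, above or
  disjoint.\<close>

lemma fill_nodes_cases: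
  assumes "distinct (letters (fill K g))" "y \<in> set (post (fill K g))"
  obtains "y \<in> set (post g)" | "lset g \<subseteq> fst y" | "fst y \<inter> lset g = {}"
proof -
  have d: "set (lets_before K) \<inter> lset g = {}" "set (lets_after K) \<inter> lset g = {}"
    using assms(1) by (auto simp: letters_fill)
  from assms(2) consider "y \<in> set (ctx_pre K)" | "y \<in> set (post g)" | "y \<in> set (ctx_suf K (lset g))"
    unfolding post_fill by auto
  then show thesis
  proof cases
    case 1
    then have "fst y \<inter> lset g = {}" using ctx_pre_subset[OF 1] d(1) by blast
    then show thesis by (rule that(3))
  next
    case 2
    then show thesis by (rule that(1))
  next
    case 3
    from ctx_suf_cases[OF this] show thesis
    proof
      assume "lset g \<subseteq> fst y"
      then show thesis by (rule that(2))
    next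
      assume "fst y \<subseteq> set (lets_before K) \<union> set (lets_after K)"
      then have "fst y \<inter> lset g = {}" using d by blast
      then show thesis by (rule that(3))
    qed
  qed
qed

section \<open>Prefixes of a linear extension as elements of a chain\<close>

definition perm_bracket :: "nat \<Rightarrow> nat bracketing \<Rightarrow> bool" where
  "perm_bracket n m \<longleftrightarrow> distinct (letters m) \<and> lset m = {1..n}"

text \<open>A child that is not a letter is a node contained in the merged set, so it occurs earlier
  in the list. It is maximal at that moment, because every larger node contains the merged set and
  cannot have come before it.\<close>

lemma child_block:
  assumes "perm_bracket n (fill K (Bracket c s t))"
    and "linear_ext (fill K (Bracket c s t)) (P @ (lset s \<union> lset t, c) # Q)"
  shows "lset s \<in> blocks n (set P)" "lset t \<in> blocks n (set P)"
proof -
  let ?m = "fill K (Bracket c s t)" and ?x = "(lset s \<union> lset t, c)"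
  have d: "distinct (letters ?m)" and l: "lset ?m = {1..n}"
    using assms(1) by (auto simp: perm_bracket_def)
  have D: "lset s \<inter> lset t = {}" using d by (auto simp: letters_fill)
  have sp: "set P \<union> {?x} \<union> set Q = set (post ?m)" and so: "\<forall>y\<in>set P. \<not> fst ?x \<subseteq> fst y"
    "\<forall>y\<in>set Q. \<not> fst y \<subseteq> fst ?x"
    using assms(2) by (auto simp: linear_ext_def sorted_wrt_append)
  \<comment> \<open>Stated for either child \<open>u\<close> with sibling \<open>w\<close>.\<close>
  have *: "lset u \<in> blocks n (set P)" if u: "u = s \<and> w = t \<or> u = t \<and> w = s" for u w
  proof -
    have Du: "lset u \<inter> lset w = {}" using u D by auto
    have ux: "lset u \<subseteq> fst ?x" "\<not> fst ?x \<subseteq> lset u"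
      using u letters_not_subset[OF D] by auto
    have "lset u \<in> fst ` set P \<union> (\<lambda>x. {x}) ` {1..n}"
    proof (cases "\<exists>a. lset u = {a}")
      case True
      then obtain a where a: "lset u = {a}" by blast
      have "a \<in> {1..n}" unfolding l[symmetric] using u a by (auto simp: letters_fill)
      with a show ?thesis by blast
    next
      case False
      then obtain b where b: "(lset u, b) \<in> set (post u)" using letters_node by blast
      then have "(lset u, b) \<in> set (post ?m)" using u by (auto simp: post_fill)
      then have "(lset u, b) \<in> set P \<union> {?x} \<union> set Q" unfolding sp .
      moreover have "(lset u, b) \<noteq> ?x" using ux(2) by auto
      moreover have "(lset u, b) \<notin> set Q" using so(2) ux(1) by (metis fst_conv)
      ultimately have "(lset u, b) \<in> set P" by (metis Un_iff singletonD)
      then have "lset u \<in> fst ` set P" by (metis fst_conv image_eqI)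
      then show ?thesis by blast
    qed
    moreover have "lset u = fst y" if y: "y \<in> set P" "lset u \<subseteq> fst y" for y
    proof -
      have ne: "lset u \<noteq> {}" by simp
      have "y \<in> set (post ?m)" using sp y by blast
      from d this show ?thesis
      proof (rule fill_nodes_cases)
        assume "set (letters (Bracket c s t)) \<subseteq> fst y"
        then show ?thesis using so(1) y by auto
      next
        assume "fst y \<inter> set (letters (Bracket c s t)) = {}"
        moreover have "lset u \<subseteq> set (letters (Bracket c s t))" using u by auto
        ultimately have "fst y \<inter> lset u = {}" by blast
        then show ?thesis using ne Int_absorb1[OF y(2)] by simp
      next
        assume "y \<in> set (post (Bracket c s t))"
        then have "y \<in> set (post u) \<or> y \<in> set (post w) \<or> y = ?x" using u by auto
        then show ?thesis
        proof (elim disjE)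
          assume "y \<in> set (post u)"
          then have "fst y \<subseteq> lset u" using post_subset[of "fst y" "snd y" u] by simp
          with y(2) show ?thesis by (rule subset_antisym)
        next
          assume "y \<in> set (post w)"
          then have "fst y \<subseteq> lset w" using post_subset[of "fst y" "snd y" w] by auto
          then have "lset u \<subseteq> lset w" using y(2) by blast
          then show ?thesis using Du ne Int_absorb2 by metis
        next
          assume "y = ?x"
          then show ?thesis using so(1) y by auto
        qed
      qed
    qed
    ultimately show ?thesis unfolding blocks_def by blast
  qed
  show "lset s \<in> blocks n (set P)" "lset t \<in> blocks n (set P)"
    using *[of s t] *[of t s] by simp_all
qed

lemma linear_ext_step:
  assumes "perm_bracket n m" "linear_ext m (P @ x # Q)"
  obtains A B where "A \<in> blocks n (set P)" "B \<in> blocks n (set P)" "A \<noteq> B" "x = (A \<union> B, snd x)"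
proof -
  have "x \<in> set (post m)" using assms(2) by (auto simp: linear_ext_def)
  then obtain K s t where m: "m = fill K (Bracket (snd x) s t)" and x: "fst x = lset s \<union> lset t"
    by (rule post_decomp)
  then have x': "x = (lset s \<union> lset t, snd x)" by (metis prod.collapse)
  have "distinct (letters (Bracket (snd x) s t))"
    using assms(1) m by (auto simp: perm_bracket_def letters_fill)
  then have D: "lset s \<inter> lset t = {}" by simp
  have "lset s \<noteq> lset t" using letters_not_subset[OF D] by blast
  moreover have "linear_ext m (P @ (lset s \<union> lset t, snd x) # Q)"
    using assms(2) x' by simp
  ultimately show thesis
    using that child_block[of n K "snd x" s t P Q] assms(1) m x' by metis
qed

lemma good_prefix:
  assumes "perm_bracket n m" "linear_ext m (P @ Q)"
  shows "good_forest n (set P)"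
  using assms(2)
proof (induction P arbitrary: Q rule: rev_induct)
  case Nil
  then show ?case by (simp add: good_forest_empty)
next
  case (snoc x P)
  then have le: "linear_ext m (P @ x # Q)" by simp
  obtain A B where AB: "A \<in> blocks n (set P)" "B \<in> blocks n (set P)" "A \<noteq> B" "x = (A \<union> B, snd x)"
    using linear_ext_step[OF assms(1) le] .
  have "good_forest n (insert (A \<union> B, snd x) (set P))"
    using forest_wpart_insert(2)[OF snoc.IH[OF le] AB(1-3)] .
  then show ?case using AB(4) by simp
qed

lemma forest_wpart_in: "good_forest n F \<Longrightarrow> forest_wpart n F \<in> wpartitions n"
  by (simp add: good_forest_def)

lemma chain_step:
  assumes "perm_bracket n m" "linear_ext m (P @ x # Q)"
  shows "wle n (forest_wpart n (set P)) (forest_wpart n (insert x (set P)))"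
    and "Suc (card (forest_wpart n (insert x (set P)))) = card (forest_wpart n (set P))"
proof -
  obtain A B where AB: "A \<in> blocks n (set P)" "B \<in> blocks n (set P)" "A \<noteq> B" "x = (A \<union> B, snd x)"
    using linear_ext_step[OF assms] .
  have g: "good_forest n (set P)" by (rule good_prefix[OF assms])
  have e: "forest_wpart n (insert x (set P)) = merge (u_color (snd x)) A B (forest_wpart n (set P))"
    using forest_wpart_insert(1)[OF g AB(1-3), of "snd x"] AB(4) by simp
  have mem: "(A, red_wt (set P) A) \<in> forest_wpart n (set P)" "(B, red_wt (set P) B) \<in> forest_wpart n (set P)"
    using AB by (simp_all add: in_forest_wpart)
  have "u_color (snd x) \<le> 1" by (cases "snd x") simp_all
  then show "wle n (forest_wpart n (set P)) (forest_wpart n (insert x (set P)))"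
    unfolding e by (rule wle_merge[OF forest_wpart_in[OF g] mem AB(3)])
  show "Suc (card (forest_wpart n (insert x (set P)))) = card (forest_wpart n (set P))"
    unfolding e by (rule card_merge[OF forest_wpart_in[OF g] mem AB(3)])
qed

text \<open>By \<open>wle_card\<close> strictness can be read off the number of blocks, which makes
  the lengths of chains computable.\<close>

lemma lt_wle_card:
  assumes "\<pi> \<in> wpartitions n" "\<rho> \<in> wpartitions n"
  shows "lt_of (wle n) \<pi> \<rho> \<longleftrightarrow> wle n \<pi> \<rho> \<and> card \<rho> < card \<pi>"
  unfolding lt_of_def using wle_card[OF assms] by (metis less_irrefl order_le_less)

lemma lt_wle_trans:
  assumes "\<pi> \<in> wpartitions n" "\<rho> \<in> wpartitions n" "\<tau> \<in> wpartitions n"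
    and "lt_of (wle n) \<pi> \<rho>" "lt_of (wle n) \<rho> \<tau>"
  shows "lt_of (wle n) \<pi> \<tau>"
  using assms wle_trans[OF assms(1-3)] by (simp add: lt_wle_card)

lemma sorted_lt_Cons:
  assumes "\<pi> \<in> wpartitions n" "set (\<rho> # cs) \<subseteq> wpartitions n"
    and "lt_of (wle n) \<pi> \<rho>" "sorted_wrt (lt_of (wle n)) (\<rho> # cs)"
  shows "sorted_wrt (lt_of (wle n)) (\<pi> # \<rho> # cs)"
  using assms lt_wle_trans[OF assms(1)] by auto

lemma chain_from_sorted:
  assumes "perm_bracket n m" "linear_ext m (P @ Q)"
  shows "sorted_wrt (lt_of (wle n)) (chain_from n (set P) Q) \<and> set (chain_from n (set P) Q) \<subseteq> wpartitions n"
  using assms(2)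
proof (induction Q arbitrary: P)
  case Nil
  from forest_wpart_in[OF good_prefix[OF assms(1) this]] show ?case by simp
next
  case (Cons x Q)
  have IH: "sorted_wrt (lt_of (wle n)) (chain_from n (insert x (set P)) Q)"
    "set (chain_from n (insert x (set P)) Q) \<subseteq> wpartitions n"
    using Cons.IH[of "P @ [x]"] Cons.prems by simp_all
  obtain cs where cs: "chain_from n (insert x (set P)) Q = forest_wpart n (insert x (set P)) # cs"
    by (cases Q) simp_all
  have p: "forest_wpart n (set P) \<in> wpartitions n" by (rule forest_wpart_in[OF good_prefix[OF assms(1) Cons.prems]])
  have "forest_wpart n (insert x (set P)) \<in> wpartitions n" using IH(2) cs by simp
  then have lt: "lt_of (wle n) (forest_wpart n (set P)) (forest_wpart n (insert x (set P)))"
    using p chain_step[OF assms(1) Cons.prems] by (simp add: lt_wle_card)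
  show ?case
    using sorted_lt_Cons[OF p IH(2)[unfolded cs] lt IH(1)[unfolded cs]] p IH(2)
    unfolding chain_from.simps cs by simp
qed

lemma red_wt_post:
  assumes "distinct (letters m)"
  shows "red_wt (set (post m)) (lset m) = red_brackets m"
proof -
  have "{y \<in> set (post m). snd y = Red \<and> fst y \<subseteq> lset m} = set (filter (\<lambda>y. snd y = Red) (post m))"
    using post_subset[of _ _ m] by fastforce
  moreover have "distinct (filter (\<lambda>y. snd y = Red) (post m))"
    using distinct_fst_post[OF assms] by (simp add: distinct_map)
  moreover have "length (filter (\<lambda>y. snd y = Red) (post m)) = red_brackets m"
    by (induction m) auto
  ultimately show ?thesis unfolding red_wt_def by (metis distinct_card)
qed

lemma forest_wpart_full:
  assumes "perm_bracket n m" "n \<ge> 1"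
  shows "forest_wpart n (set (post m)) = wtop n (red_brackets m)"
proof -
  have d: "distinct (letters m)" and l: "lset m = {1..n}" using assms by (simp_all add: perm_bracket_def)
  have "blocks n (set (post m)) = {{1..n}}"
  proof
    have sub: "\<forall>Y\<in>fst ` set (post m). Y \<subseteq> {1..n}" using post_subset[of _ _ m] l by fastforce
    show "{{1..n}} \<subseteq> blocks n (set (post m))"
    proof -
      have "{1..n} \<in> fst ` set (post m) \<union> (\<lambda>x. {x}) ` {1..n}"
      \<comment> \<open>A single letter has no nodes; then \<open>{1..n}\<close> is itself one of
        the singletons.\<close>
      proof (cases "\<exists>a. lset m = {a}")
        case True
        then show ?thesis using l by auto
      next
        case False
        then obtain c where "(lset m, c) \<in> set (post m)" using letters_node by blast
        then show ?thesis unfolding l by force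
      qed
      then show ?thesis using sub unfolding blocks_def by blast
    qed
    show "blocks n (set (post m)) \<subseteq> {{1..n}}"
    proof
      fix X assume X: "X \<in> blocks n (set (post m))"
      show "X \<in> {{1..n}}"
      proof (cases "\<exists>a. lset m = {a}")
        case True
        then obtain a where a: "lset m = {a}" by blast
        then have p: "post m = []" using d distinct_card[OF d] length_post[of m] by (cases "post m") simp_all
        have "{1..n} = {a}" using l a by simp
        with X p show ?thesis unfolding blocks_def by auto
      next
        case False
        then obtain c where "(lset m, c) \<in> set (post m)" using letters_node by blast
        then have "{1..n} \<in> fst ` set (post m)" unfolding l by force
        moreover have "X \<subseteq> {1..n}" using X sub unfolding blocks_def by auto
        ultimately show ?thesis using X unfolding blocks_def by blast
      qed
    qed
  qed
  then show ?thesis using red_wt_post[OF d] l by (simp add: forest_wpart_def wtop_def)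
qed

text \<open>Two consecutive elements determine the set and the color of the merge between them, so
  the merges can be read off one by one. The two bracketings may differ by swapped children.\<close>

lemma linear_ext_inj:
  assumes m: "perm_bracket n m" "linear_ext m (P @ Q)" and m': "perm_bracket n m'" "linear_ext m' (P @ Q')"
    and eq: "chain_from n (set P) Q = chain_from n (set P) Q'"
  shows "Q = Q'"
  using m(2) m'(2) eq
proof (induction Q arbitrary: P Q')
  case Nil
  then have "length Q' = 0" by (metis length_chain_from list.size(3) nat.inject)
  then show ?case by simp
next
  case (Cons x Q)
  then obtain x' R where Q': "Q' = x' # R"
    by (metis length_chain_from length_Suc_conv nat.inject)
  have g: "good_forest n (set P)" by (rule good_prefix[OF m(1) Cons.prems(1)])
  note wp = forest_wpart_in[OF g]
  obtain A B where AB: "A \<in> blocks n (set P)" "B \<in> blocks n (set P)" "A \<noteq> B" "x = (A \<union> B, snd x)"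
    using linear_ext_step[OF m(1) Cons.prems(1)] .
  obtain A' B' where AB': "A' \<in> blocks n (set P)" "B' \<in> blocks n (set P)" "A' \<noteq> B'" "x' = (A' \<union> B', snd x')"
    using linear_ext_step[OF m'(1) Cons.prems(2)[unfolded Q']] .
  have ceq: "chain_from n (insert x (set P)) Q = chain_from n (insert x' (set P)) R"
    using Cons.prems(3) Q' by simp
  then have "forest_wpart n (insert x (set P)) = forest_wpart n (insert x' (set P))"
    by (metis hd_chain_from)
  then have meq: "merge (u_color (snd x)) A B (forest_wpart n (set P)) = merge (u_color (snd x')) A' B' (forest_wpart n (set P))"
    using forest_wpart_insert(1)[OF g AB(1-3), of "snd x"] forest_wpart_insert(1)[OF g AB'(1-3), of "snd x'"]
      AB(4) AB'(4) by simp
  have mem: "(X, red_wt (set P) X) \<in> forest_wpart n (set P)" if "X \<in> blocks n (set P)" for X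
    using that by (simp add: in_forest_wpart)
  have "A \<union> B = A' \<union> B'" "u_color (snd x) = u_color (snd x')"
    using merge_inj[OF wp mem[OF AB(1)] mem[OF AB(2)] AB(3) mem[OF AB'(1)] mem[OF AB'(2)] AB'(3) meq] by auto
  moreover from this(2) have "snd x = snd x'" by (cases "snd x"; cases "snd x'") simp_all
  ultimately have xx: "x = x'" using AB(4) AB'(4) by simp
  have "Q = R"
    using Cons.IH[of "P @ [x]" R] Cons.prems(1,2) Q' xx ceq by simp
  with xx Q' show ?case by simp
qed

section \<open>Maximal chains and open intervals\<close>

definition bracketed_blocks :: "nat \<Rightarrow> node set \<Rightarrow> bool" where
  "bracketed_blocks n F \<longleftrightarrow> (\<forall>Z\<in>blocks n F. \<exists>g. distinct (letters g) \<and> lset g = Z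
     \<and> set (post g) = {y \<in> F. fst y \<subseteq> Z})"

lemma bracketed_blocksE:
  assumes "bracketed_blocks n F" "Z \<in> blocks n F"
  obtains g where "distinct (letters g)" "lset g = Z" "set (post g) = {y \<in> F. fst y \<subseteq> Z}"
  using bspec[OF assms(1)[unfolded bracketed_blocks_def] assms(2)] that by blast

lemma bracketed_blocks_empty: "bracketed_blocks n {}"
  unfolding bracketed_blocks_def blocks_def
proof
  fix Z assume "Z \<in> {X \<in> fst ` {} \<union> (\<lambda>x. {x}) ` {1..n}. \<forall>Y\<in>fst ` {}. X \<subseteq> Y \<longrightarrow> X = Y}"
  then obtain x where "Z = {x}" by auto
  then show "\<exists>g. distinct (letters g) \<and> lset g = Z \<and> set (post g) = {y \<in> {}. fst y \<subseteq> Z}"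
    by (intro exI[of _ "Letter x"]) simp
qed

text \<open>The invariant of the decoding: each block carries a bracketing whose nodes are exactly
  the merges inside the block. A new merge brackets the two bracketings together; when a single
  block is left, its bracketing is the wanted one.\<close>

lemma bracketed_blocks_insert:
  assumes g: "good_forest n F" and bb: "bracketed_blocks n F"
    and A: "A \<in> blocks n F" and B: "B \<in> blocks n F" and "A \<noteq> B"
  shows "bracketed_blocks n (insert (A \<union> B, c) F)"
  unfolding bracketed_blocks_def blocks_insert[OF g A B \<open>A \<noteq> B\<close>]
proof
  have dis: "A \<inter> B = {}" by (rule blocks_disjoint[OF g A B \<open>A \<noteq> B\<close>])
  fix Z assume "Z \<in> insert (A \<union> B) (blocks n F - {A, B})"
  then show "\<exists>g. distinct (letters g) \<and> lset g = Z
      \<and> set (post g) = {y \<in> insert (A \<union> B, c) F. fst y \<subseteq> Z}"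
  proof
    assume Z: "Z = A \<union> B"
    obtain s where s: "distinct (letters s)" "lset s = A" "set (post s) = {y \<in> F. fst y \<subseteq> A}"
      using bb A by (rule bracketed_blocksE)
    obtain t where t: "distinct (letters t)" "lset t = B" "set (post t) = {y \<in> F. fst y \<subseteq> B}"
      using bb B by (rule bracketed_blocksE)
    have "set (post (Bracket c s t)) = {y \<in> insert (A \<union> B, c) F. fst y \<subseteq> Z}"
    proof -
      have "{y \<in> insert (A \<union> B, c) F. fst y \<subseteq> Z} = insert (A \<union> B, c) {y \<in> F. fst y \<subseteq> A \<union> B}"
        by (auto simp: Z)
      also have "{y \<in> F. fst y \<subseteq> A \<union> B} = {y \<in> F. fst y \<subseteq> A \<or> fst y \<subseteq> B}"
        using forest_subset_union[OF g A B] by (intro Collect_cong conj_cong refl)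
      also have "\<dots> = set (post s) \<union> set (post t)" unfolding s t by blast
      finally show ?thesis by (simp add: s t)
    qed
    then show ?thesis
      using s t dis Z by (intro exI[of _ "Bracket c s t"]) simp
  next
    assume Z: "Z \<in> blocks n F - {A, B}"
    have "Z \<inter> A = {}" "A \<noteq> {}"
      using blocks_disjoint[OF g _ A] blocks_nonempty[OF g A] Z by auto
    then have eq: "{y \<in> insert (A \<union> B, c) F. fst y \<subseteq> Z} = {y \<in> F. fst y \<subseteq> Z}" by auto
    have "Z \<in> blocks n F" using Z by simp
    then show ?thesis unfolding eq using bb unfolding bracketed_blocks_def by (rule bspec[rotated])
  qed
qed

lemma card_wpartition_pos:
  assumes "n \<ge> 1" "\<pi> \<in> wpartitions n"
  shows "1 \<le> card \<pi>"
proof -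
  have "1 \<in> {1..n}" using assms(1) by simp
  from wp_cover[OF assms(2) this] have "\<pi> \<noteq> {}" by blast
  then show ?thesis using wp_finite[OF assms(2)] by (simp add: Suc_le_eq card_gt_0_iff)
qed

text \<open>Every step loses at least one block, and the last element still has one.\<close>

lemma length_chain_le_card:
  assumes "n \<ge> 1" "sorted_wrt (lt_of (wle n)) (\<rho> # cs)" "set (\<rho> # cs) \<subseteq> wpartitions n"
  shows "length (\<rho> # cs) \<le> card \<rho>"
  using assms(2,3)
proof (induction cs arbitrary: \<rho>)
  case Nil
  then show ?case using card_wpartition_pos[OF assms(1)] by simp
next
  case (Cons \<tau> cs)
  have "length (\<tau> # cs) \<le> card \<tau>" using Cons by simp
  moreover have "card \<tau> < card \<rho>" using Cons.prems by (simp add: lt_wle_card)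
  ultimately show ?case by simp
qed

text \<open>The chain is as long as the number of blocks allows, so every step loses exactly one
  block. It is then a merge, which yields the next node. The induction carries the prefix
  \<open>L\<close> of merges already read, with its invariants.\<close>

lemma decode_from:
  assumes "n \<ge> 1" "good_forest n (set L)" "bracketed_blocks n (set L)"
    and "sorted_wrt (\<lambda>x y. \<not> fst y \<subseteq> fst x) L"
    and "sorted_wrt (lt_of (wle n)) (forest_wpart n (set L) # cs)" "set cs \<subseteq> wpartitions n"
    and "Suc (length cs) = card (forest_wpart n (set L))"
  shows "\<exists>L'. sorted_wrt (\<lambda>x y. \<not> fst y \<subseteq> fst x) (L @ L') \<and> good_forest n (set (L @ L'))
    \<and> bracketed_blocks n (set (L @ L')) \<and> forest_wpart n (set L) # cs = chain_from n (set L) L'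
    \<and> card (forest_wpart n (set (L @ L'))) = 1"
  using assms(2-)
proof (induction cs arbitrary: L)
  case Nil
  then show ?case by (intro exI[of _ "[]"]) simp
next
  case (Cons \<rho> cs)
  note wp = forest_wpart_in[OF Cons.prems(1)]
  have \<rho>: "\<rho> \<in> wpartitions n" using Cons.prems(5) by simp
  have lt: "wle n (forest_wpart n (set L)) \<rho>" "card \<rho> < card (forest_wpart n (set L))"
    using Cons.prems(4) lt_wle_card[OF wp \<rho>] by simp_all
  have "length (\<rho> # cs) \<le> card \<rho>"
    using Cons.prems by (intro length_chain_le_card[OF assms(1)]) simp_all
  then have "card (forest_wpart n (set L)) = Suc (card \<rho>)" using lt(2) Cons.prems(6) by simp
  from cover_is_merge[OF wp \<rho> lt(1) this] obtain A a B b u where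
    AB: "(A, a) \<in> forest_wpart n (set L)" "(B, b) \<in> forest_wpart n (set L)" "A \<noteq> B" "u \<le> 1"
    and m: "\<rho> = merge u A B (forest_wpart n (set L))" .
  have blk: "A \<in> blocks n (set L)" "B \<in> blocks n (set L)" using AB by (simp_all add: in_forest_wpart)
  obtain c where c: "u = u_color c"
  proof (cases "u = 0")
    case True
    then show thesis using that[of Blue] by simp
  next
    case False
    then show thesis using that[of Red] AB(4) by simp
  qed
  define x where "x = (A \<union> B, c)"
  have \<rho>_eq: "forest_wpart n (set (L @ [x])) = \<rho>"
    using forest_wpart_insert(1)[OF Cons.prems(1) blk AB(3)] by (simp add: m c x_def)
  have g: "good_forest n (set (L @ [x]))"
    using forest_wpart_insert(2)[OF Cons.prems(1) blk AB(3)] by (simp add: x_def)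
  have bb: "bracketed_blocks n (set (L @ [x]))"
    using bracketed_blocks_insert[OF Cons.prems(1,2) blk AB(3)] by (simp add: x_def)
  have so: "sorted_wrt (\<lambda>x y. \<not> fst y \<subseteq> fst x) (L @ [x])"
    using Cons.prems(3) union_not_subset_node[OF Cons.prems(1) blk AB(3)]
    unfolding sorted_wrt_append x_def by simp
  have "\<exists>L'. sorted_wrt (\<lambda>x y. \<not> fst y \<subseteq> fst x) ((L @ [x]) @ L') \<and> good_forest n (set ((L @ [x]) @ L'))
    \<and> bracketed_blocks n (set ((L @ [x]) @ L')) \<and> forest_wpart n (set (L @ [x])) # cs = chain_from n (set (L @ [x])) L'
    \<and> card (forest_wpart n (set ((L @ [x]) @ L'))) = 1"
  proof (rule Cons.IH[OF g bb so])
    show "sorted_wrt (lt_of (wle n)) (forest_wpart n (set (L @ [x])) # cs)"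
      using Cons.prems(4) unfolding \<rho>_eq by simp
    show "set cs \<subseteq> wpartitions n" using Cons.prems(5) by simp
    show "Suc (length cs) = card (forest_wpart n (set (L @ [x])))"
      unfolding \<rho>_eq using \<open>card (forest_wpart n (set L)) = Suc (card \<rho>)\<close> Cons.prems(6) by simp
  qed
  then obtain L' where L': "sorted_wrt (\<lambda>x y. \<not> fst y \<subseteq> fst x) ((L @ [x]) @ L')"
    "good_forest n (set ((L @ [x]) @ L'))" "bracketed_blocks n (set ((L @ [x]) @ L'))"
    "forest_wpart n (set (L @ [x])) # cs = chain_from n (set (L @ [x])) L'"
    "card (forest_wpart n (set ((L @ [x]) @ L'))) = 1" by blast
  have "forest_wpart n (set L) # \<rho> # cs = chain_from n (set L) (x # L')"
    using L'(4) unfolding \<rho>_eq by simp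
  with L' show ?case by (intro exI[of _ "x # L'"]) simp
qed

text \<open>Length \<open>n\<close> expresses maximality: the number of blocks goes from
  \<open>n\<close> to 1.\<close>

definition max_chains :: "nat \<Rightarrow> nat \<Rightarrow> wpart list set" where
  "max_chains n i = {cs. sorted_wrt (lt_of (wle n)) cs \<and> set cs \<subseteq> wpartitions n
     \<and> hd cs = wbot n \<and> last cs = wtop n i \<and> length cs = n}"

lemma card_wbot: "card (wbot n) = n"
  unfolding wbot_def by (subst card_image) (auto intro: inj_onI)

lemma max_chain_decode:
  assumes "n \<ge> 1" "cs \<in> max_chains n i"
  obtains m L where "perm_bracket n m" "red_brackets m = i" "linear_ext m L" "cs = chain_from n {} L"
proof -
  have cs: "sorted_wrt (lt_of (wle n)) cs" "set cs \<subseteq> wpartitions n" "hd cs = wbot n" "last cs = wtop n i"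
    "length cs = n" using assms(2) by (simp_all add: max_chains_def)
  then obtain cs' where cs': "cs = wbot n # cs'" using assms(1) by (cases cs) auto
  have "\<exists>L'. sorted_wrt (\<lambda>x y. \<not> fst y \<subseteq> fst x) ([] @ L') \<and> good_forest n (set ([] @ L'))
    \<and> bracketed_blocks n (set ([] @ L')) \<and> forest_wpart n (set []) # cs' = chain_from n (set []) L'
    \<and> card (forest_wpart n (set ([] @ L'))) = 1"
    by (rule decode_from[OF assms(1)])
      (use cs cs' in \<open>simp_all add: good_forest_empty bracketed_blocks_empty forest_wpart_empty card_wbot\<close>)
  then obtain L where L: "sorted_wrt (\<lambda>x y. \<not> fst y \<subseteq> fst x) L" "good_forest n (set L)"
    "bracketed_blocks n (set L)" "cs = chain_from n {} L" "card (forest_wpart n (set L)) = 1"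
    by (auto simp: cs' forest_wpart_empty)
  have last: "forest_wpart n (set L) = wtop n i"
    using last_chain_from[of n "{}" L] cs(4) L(4) by simp
  then have "({1..n}, i) \<in> forest_wpart n (set L)" by (simp add: wtop_def)
  then have top: "{1..n} \<in> blocks n (set L)" "i = red_wt (set L) {1..n}" by (simp_all add: in_forest_wpart)
  obtain m where m: "distinct (letters m)" "lset m = {1..n}"
    "set (post m) = {y \<in> set L. fst y \<subseteq> {1..n}}"
    by (rule bracketed_blocksE[OF L(3) top(1)])
  have "{y \<in> set L. fst y \<subseteq> {1..n}} = set L" using L(2) unfolding good_forest_def by blast
  with m(3) have post: "set (post m) = set L" by simp
  have "red_brackets m = i" using red_wt_post[OF m(1)] top(2) by (simp add: m(2) post)
  then show thesis
    using that[of m L] m post L by (simp add: perm_bracket_def linear_ext_def)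
qed

lemma linear_ext_length:
  assumes "perm_bracket n m" "linear_ext m L"
  shows "Suc (length L) = n"
proof -
  have "distinct L" using linear_ext_distinct_fst[OF assms(2)] by (simp add: distinct_map)
  moreover have "distinct (post m)" using distinct_fst_post assms(1) by (simp add: perm_bracket_def distinct_map)
  ultimately have "length L = length (post m)"
    using assms(2) by (simp add: linear_ext_def flip: distinct_card)
  moreover have "length (letters m) = n" using assms(1) by (simp add: perm_bracket_def flip: distinct_card)
  ultimately show ?thesis using length_post[of m] by simp
qed

lemma chain_from_max:
  assumes "n \<ge> 1" "perm_bracket n m" "linear_ext m L"
  shows "chain_from n {} L \<in> max_chains n (red_brackets m)"
  using chain_from_sorted[OF assms(2), of "[]" L] assms linear_ext_length[OF assms(2,3)]
    forest_wpart_full[OF assms(2,1)]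
  by (simp add: max_chains_def hd_chain_from last_chain_from forest_wpart_empty linear_ext_def)

text \<open>For \<open>n = 1\<close> the chain has one element and the result is the empty list,
  which stands for the generator of the degenerate cohomology.\<close>

definition bar :: "wpart list \<Rightarrow> wpart list" where
  "bar cs = butlast (tl cs)"

lemma max_chain_bar:
  assumes "n \<ge> 2" "cs \<in> max_chains n i"
  shows "cs = wbot n # bar cs @ [wtop n i]"
proof -
  have "hd cs = wbot n" "last cs = wtop n i" "length cs = n" using assms(2) by (simp_all add: max_chains_def)
  moreover from this(3) assms(1) obtain x ys where "cs = x # ys" by (cases cs) simp_all
  moreover from this \<open>length cs = n\<close> assms(1) have "ys \<noteq> []" by auto
  moreover from this have "ys = butlast ys @ [last ys]" by simp
  ultimately show ?thesis unfolding bar_def by (metis last_ConsR list.sel(1,3))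
qed

lemma bar_inj:
  assumes "n \<ge> 2" "cs \<in> max_chains n i" "cs' \<in> max_chains n i" "bar cs = bar cs'"
  shows "cs = cs'"
proof -
  have "cs = wbot n # bar cs' @ [wtop n i]" using max_chain_bar[OF assms(1,2)] unfolding assms(4) .
  also have "\<dots> = cs'" using max_chain_bar[OF assms(1,3)] by (rule sym)
  finally show ?thesis .
qed

section \<open>Chains of the open interval\<close>

lemma wtop_in: "n \<ge> 1 \<Longrightarrow> i \<le> n - 1 \<Longrightarrow> wtop n i \<in> wpartitions n"
  by (rule wpartitionsI) (auto simp: wtop_def)

lemma wbot_lt_wtop:
  assumes "n \<ge> 2" "i \<le> n - 1"
  shows "lt_of (wle n) (wbot n) (wtop n i)"
proof -
  have wp: "wtop n i \<in> wpartitions n" using assms by (intro wtop_in) simp_all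
  have "parts_in (wbot n) {1..n} = wbot n" by (auto simp: parts_in_def wbot_def)
  moreover have "(\<Sum>p\<in>wbot n. int (snd p)) = 0" by (rule sum.neutral) (auto simp: wbot_def)
  ultimately have "wle n (wbot n) (wtop n i)"
    unfolding wle_iff[OF wbot_in wp] using assms
    by (auto simp: wtop_def wsum_def card_wbot) (auto simp: wbot_def)
  moreover have "card (wtop n i) = 1" by (simp add: wtop_def)
  ultimately show ?thesis using assms by (simp add: lt_wle_card[OF wbot_in wp] card_wbot)
qed

abbreviation wint :: "nat \<Rightarrow> nat \<Rightarrow> wpart set" where
  "wint n i \<equiv> open_interval (wpartitions n) (wle n) (wbot n) (wtop n i)"

lemma chains_wint_iff:
  assumes "n \<ge> 2" "i \<le> n - 1"
  shows "xs \<in> chains (wint n i) (wle n) r \<longleftrightarrow>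
    sorted_wrt (lt_of (wle n)) (wbot n # xs @ [wtop n i]) \<and> set xs \<subseteq> wpartitions n \<and> int (length xs) = r + 1"
  using wbot_lt_wtop[OF assms] by (auto simp: chains_def open_interval_def sorted_wrt_append)

lemma top_chains_wint_iff:
  assumes "n \<ge> 2" "i \<le> n - 1"
  shows "xs \<in> chains (wint n i) (wle n) (int n - 3) \<longleftrightarrow> wbot n # xs @ [wtop n i] \<in> max_chains n i"
  unfolding chains_wint_iff[OF assms] max_chains_def
  using wbot_in[of n] wtop_in[of n i] assms by auto

text \<open>Once both ends are restored, the first and the last position are no longer exceptional:
  an insertion always takes place between two consecutive elements of \<open>full\<close>.\<close>

lemma insertable_wint:
  assumes n: "n \<ge> 2" "i \<le> n - 1" and xs: "xs \<in> chains (wint n i) (wle n) r" and j: "j \<le> length xs"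
  defines "full \<equiv> wbot n # xs @ [wtop n i]"
  shows "insertable (wint n i) (wle n) xs j
    = {a \<in> wpartitions n. lt_of (wle n) (full ! j) a \<and> lt_of (wle n) a (full ! Suc j)}"
proof -
  have so: "sorted_wrt (lt_of (wle n)) full" and sub: "set full \<subseteq> wpartitions n"
    using xs wbot_in[of n] wtop_in[of n i] n unfolding chains_wint_iff[OF n] full_def by auto
  have len: "length full = length xs + 2" by (simp add: full_def)
  have inW: "full ! k \<in> wpartitions n" if "k < length xs + 2" for k
    using sub nth_mem[of k full] that len by auto
  have lower: "(0 < j \<longrightarrow> lt_of (wle n) (xs ! (j - 1)) a) \<and> lt_of (wle n) (wbot n) a
      \<longleftrightarrow> lt_of (wle n) (full ! j) a" if a: "a \<in> wpartitions n" for a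
  proof (cases j)
    case 0
    then show ?thesis by (simp add: full_def)
  next
    case (Suc k)
    then have fj: "full ! j = xs ! (j - 1)" using j by (simp add: full_def nth_append)
    have "lt_of (wle n) (full ! 0) (full ! j)" using sorted_wrt_nth_less[OF so, of 0 j] Suc j len by simp
    then have "lt_of (wle n) (wbot n) (full ! j)" by (simp add: full_def)
    moreover have "full ! j \<in> wpartitions n" using inW j by simp
    ultimately show ?thesis
      using lt_wle_trans[OF wbot_in _ a, of "full ! j"] Suc fj by auto
  qed
  have upper: "(j < length xs \<longrightarrow> lt_of (wle n) a (xs ! j)) \<and> lt_of (wle n) a (wtop n i)
      \<longleftrightarrow> lt_of (wle n) a (full ! Suc j)" if a: "a \<in> wpartitions n" for a
  proof (cases "j < length xs")
    case False
    then have "j = length xs" using j by simp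
    then show ?thesis by (simp add: full_def)
  next
    case True
    then have fj: "full ! Suc j = xs ! j" by (simp add: full_def nth_append)
    have ft: "full ! Suc (length xs) = wtop n i" by (simp add: full_def)
    have "lt_of (wle n) (full ! Suc j) (full ! Suc (length xs))"
      using sorted_wrt_nth_less[OF so, of "Suc j" "Suc (length xs)"] True len by simp
    moreover have "full ! Suc j \<in> wpartitions n" "wtop n i \<in> wpartitions n"
      using inW[of "Suc j"] inW[of "Suc (length xs)"] j ft by simp_all
    ultimately show ?thesis
      using lt_wle_trans[OF a, of "full ! Suc j" "wtop n i"] True fj ft by auto
  qed
  show ?thesis
    unfolding insertable_def open_interval_def using lower upper by blast
qed

section \<open>Coboundaries of chains with one gap\<close>

lemma chain_from_nth:
  "k \<le> length L \<Longrightarrow> chain_from n F L ! k = forest_wpart n (F \<union> set (take k L))"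
proof (induction L arbitrary: F k)
  case (Cons x L)
  then show ?case by (cases k) simp_all
qed simp

lemma card_prefix:
  assumes "perm_bracket n m" "linear_ext m (P @ Q)"
  shows "card (forest_wpart n (set P)) + length P = n"
  using assms(2)
proof (induction P arbitrary: Q rule: rev_induct)
  case Nil
  then show ?case by (simp add: forest_wpart_empty card_wbot)
next
  case (snoc x P)
  then have le: "linear_ext m (P @ x # Q)" by simp
  show ?case using snoc.IH[OF le] chain_step(2)[OF assms(1) le] by simp
qed

lemma card_chain_nth:
  assumes "perm_bracket n m" "linear_ext m L" "k \<le> length L"
  shows "card (chain_from n {} L ! k) + k = n"
  using card_prefix[OF assms(1), of "take k L" "drop k L"] assms(2,3) by (simp add: chain_from_nth)

definition between :: "nat \<Rightarrow> wpart \<Rightarrow> wpart \<Rightarrow> wpart set" where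
  "between n \<pi> \<rho> = {a \<in> wpartitions n. lt_of (wle n) \<pi> a \<and> lt_of (wle n) a \<rho>}"

lemma bar_insert:
  assumes "full = x # xs @ [z]" "j \<le> length xs"
  shows "bar (take (Suc j) full @ a # drop (Suc j) full) = take j xs @ a # drop j xs"
  using assms by (simp add: bar_def butlast_append)

lemma sum_single:
  assumes "finite S" "j \<in> S" "\<And>k. k \<in> S \<Longrightarrow> k \<noteq> j \<Longrightarrow> g k = 0"
  shows "sum g S = g j"
  using assms by (simp add: sum.remove[OF assms(1,2)] sum.neutral)

lemma cobdry_basis:
  "cobdry P le (basis_vec xs) = (\<Sum>j\<in>{0..length xs}. \<Sum>a\<in>insertable P le xs j.
     fscale ((- 1) ^ j) (basis_vec (take j xs @ a # drop j xs)))"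
  by (simp add: cobdry_def)

text \<open>The chain of \<open>P @ x # y # Q\<close> without the element that follows the merge
  \<open>x\<close>, hence with one jump of rank 2.\<close>

definition gap_chain :: "nat \<Rightarrow> node list \<Rightarrow> node \<Rightarrow> node \<Rightarrow> node list \<Rightarrow> wpart list" where
  "gap_chain n P x y Q = chain_init n {} P @ forest_wpart n (set P)
     # chain_from n (insert y (insert x (set P))) Q"

text \<open>Away from the gap consecutive elements differ by one block, so nothing fits between
  them. The full chain starts with the minimum; the gap after its entry of index
  \<open>length P\<close> is therefore the insertion position \<open>length P\<close> of the open
  chain, which gives the sign.\<close>

lemma cobdry_gap:
  assumes m: "perm_bracket n m" "linear_ext m (P @ x # y # Q)" and i: "i = red_brackets m"
  shows "bar (gap_chain n P x y Q) \<in> chains (wint n i) (wle n) (int n - 4)"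
    and "gap_chain n P x y Q = wbot n # bar (gap_chain n P x y Q) @ [wtop n i]"
    and "cobdry (wint n i) (wle n) (basis_vec (bar (gap_chain n P x y Q))) =
      fscale ((- 1) ^ length P) (\<Sum>a\<in>between n (forest_wpart n (set P)) (forest_wpart n (insert y (insert x (set P)))).
        basis_vec (bar (chain_init n {} P @ forest_wpart n (set P) # a
          # chain_from n (insert y (insert x (set P))) Q)))"
proof -
  let ?L = "P @ x # y # Q" and ?full = "gap_chain n P x y Q"
  let ?cs = "chain_from n {} ?L" and ?p = "length P"
  have n: "n = length P + length Q + 3" using linear_ext_length[OF m] by simp
  have mc: "?cs \<in> max_chains n i" unfolding i using chain_from_max[OF _ m] n by simp
  have "red_brackets m \<le> length (post m)" by (induction m) auto
  moreover have "Suc (length (post m)) = n"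
    using m(1) length_post[of m] distinct_card[of "letters m"] by (simp add: perm_bracket_def)
  ultimately have i': "i \<le> n - 1" using i by simp
  have n2: "n \<ge> 2" using n by simp
  obtain V where V: "chain_from n (insert y (insert x (set P))) Q = forest_wpart n (insert y (insert x (set P))) # V"
    by (cases Q) simp_all
  have cs: "?cs = chain_init n {} P @ forest_wpart n (set P) # forest_wpart n (insert x (set P))
      # chain_from n (insert y (insert x (set P))) Q"
    by (simp add: chain_from_append)
  have so: "sorted_wrt (lt_of (wle n)) ?full" and sub: "set ?full \<subseteq> wpartitions n"
    using mc unfolding max_chains_def cs gap_chain_def by (auto simp: sorted_wrt_append)
  have len: "length ?full = n - 1" by (simp add: gap_chain_def n)
  have hd: "hd ?full = wbot n"
    unfolding gap_chain_def by (cases P) (simp_all add: forest_wpart_empty)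
  have ne: "chain_from n F R \<noteq> []" for F R by (cases R) simp_all
  have "last ?full = last ?cs" unfolding cs gap_chain_def using ne by simp
  then have last: "last ?full = wtop n i" using mc by (simp add: max_chains_def)
  obtain z zs where z: "?full = z # zs" by (cases ?full) (use len n in auto)
  have zs: "zs \<noteq> []" using len n z by auto
  show full: "?full = wbot n # bar ?full @ [wtop n i]"
  proof -
    have "zs = butlast zs @ [last zs]" using zs by simp
    moreover have "last zs = wtop n i" using last z zs by simp
    moreover have "z = wbot n" using hd z by simp
    ultimately show ?thesis unfolding z bar_def by simp
  qed
  let ?xs = "bar ?full"
  have lenxs: "length ?xs = length P + length Q"
    using arg_cong[OF full, of length] len n by simp
  show mem: "?xs \<in> chains (wint n i) (wle n) (int n - 4)"
  proof -
    have "sorted_wrt (lt_of (wle n)) (wbot n # ?xs @ [wtop n i])" by (subst full[symmetric]) (rule so)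
    moreover have "set (wbot n # ?xs @ [wtop n i]) \<subseteq> wpartitions n" by (subst full[symmetric]) (rule sub)
    ultimately show ?thesis unfolding chains_wint_iff[OF n2 i'] using lenxs n by simp
  qed
  have cn: "card (?cs ! k) + k = n" if "k < n" for k
    using card_chain_nth[OF m] that n by simp
  \<comment> \<open>\<open>?full\<close> is \<open>?cs\<close> with the entry of index
    \<open>Suc ?p\<close> removed.\<close>
  have low: "?full ! j = ?cs ! j" if "j \<le> ?p" for j
    using that unfolding cs gap_chain_def by (auto simp: nth_append nth_Cons')
  have high: "?full ! j = ?cs ! Suc j" if "j > ?p" for j
    using that unfolding cs gap_chain_def by (auto simp: nth_append nth_Cons')
  have ins: "insertable (wint n i) (wle n) ?xs j = between n (?full ! j) (?full ! Suc j)"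
    if "j \<le> length ?xs" for j
    using insertable_wint[OF n2 i' mem that] full by (simp add: between_def)
  have empty: "between n (?full ! j) (?full ! Suc j) = {}" if j: "j \<le> length ?xs" "j \<noteq> ?p" for j
  proof -
    have c: "card (?full ! j) = Suc (card (?full ! Suc j))"
    proof (cases "j < ?p")
      case True
      then show ?thesis using cn[of j] cn[of "Suc j"] low n by simp
    next
      case False
      then show ?thesis using cn[of "Suc j"] cn[of "Suc (Suc j)"] high n lenxs j by simp
    qed
    have w: "?full ! j \<in> wpartitions n" "?full ! Suc j \<in> wpartitions n"
      using sub nth_mem[of j ?full] nth_mem[of "Suc j" ?full] len lenxs j n by auto
    show ?thesis unfolding between_def using c lt_wle_card[OF w(1)] lt_wle_card[OF _ w(2)] by fastforce
  qed
  have at: "?full ! ?p = forest_wpart n (set P)" "?full ! Suc ?p = forest_wpart n (insert y (insert x (set P)))"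
    unfolding gap_chain_def V by (simp_all add: nth_append)
  have td: "take (Suc ?p) ?full = chain_init n {} P @ [forest_wpart n (set P)]"
    "drop (Suc ?p) ?full = chain_from n (insert y (insert x (set P))) Q"
    unfolding gap_chain_def by simp_all
  have "cobdry (wint n i) (wle n) (basis_vec ?xs) =
      (\<Sum>a\<in>insertable (wint n i) (wle n) ?xs ?p. fscale ((- 1) ^ ?p) (basis_vec (take ?p ?xs @ a # drop ?p ?xs)))"
    unfolding cobdry_basis by (rule sum_single) (use lenxs ins empty in auto)
  also have "\<dots> = (\<Sum>a\<in>between n (forest_wpart n (set P)) (forest_wpart n (insert y (insert x (set P)))).
      fscale ((- 1) ^ ?p) (basis_vec (bar (chain_init n {} P @ forest_wpart n (set P) # a
          # chain_from n (insert y (insert x (set P))) Q))))"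
  proof (rule sum.cong)
    show "insertable (wint n i) (wle n) ?xs ?p =
        between n (forest_wpart n (set P)) (forest_wpart n (insert y (insert x (set P))))"
      using ins[of ?p] lenxs at by simp
    fix a
    have "take ?p ?xs @ a # drop ?p ?xs = bar (take (Suc ?p) ?full @ a # drop (Suc ?p) ?full)"
      by (rule bar_insert[OF full, symmetric]) (simp add: lenxs)
    then show "fscale ((- 1) ^ ?p) (basis_vec (take ?p ?xs @ a # drop ?p ?xs)) =
      fscale ((- 1) ^ ?p) (basis_vec (bar (chain_init n {} P @ forest_wpart n (set P) # a
          # chain_from n (insert y (insert x (set P))) Q)))"
      unfolding td by simp
  qed
  finally show "cobdry (wint n i) (wle n) (basis_vec ?xs) =
      fscale ((- 1) ^ length P) (\<Sum>a\<in>between n (forest_wpart n (set P)) (forest_wpart n (insert y (insert x (set P)))).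
        basis_vec (bar (chain_init n {} P @ forest_wpart n (set P) # a
          # chain_from n (insert y (insert x (set P))) Q)))"
    by (simp add: fvs.scale_sum_right)
qed

section \<open>Intervals of rank two\<close>

lemma between_eq:
  assumes wp: "\<pi> \<in> wpartitions n" "\<rho> \<in> wpartitions n" and c: "card \<pi> = Suc (Suc (card \<rho>))"
  shows "a \<in> between n \<pi> \<rho> \<longleftrightarrow> (\<exists>A \<alpha> B \<beta> u. a = merge u A B \<pi> \<and> (A, \<alpha>) \<in> \<pi> \<and> (B, \<beta>) \<in> \<pi>
    \<and> A \<noteq> B \<and> u \<le> 1 \<and> wle n (merge u A B \<pi>) \<rho>)"
proof
  assume a: "a \<in> between n \<pi> \<rho>"
  then have aw: "a \<in> wpartitions n" by (simp add: between_def)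
  have le: "wle n \<pi> a" "card a < card \<pi>" "wle n a \<rho>" "card \<rho> < card a"
    using a lt_wle_card[OF wp(1) aw] lt_wle_card[OF aw wp(2)] by (auto simp: between_def)
  then have "card \<pi> = Suc (card a)" using c by simp
  from cover_is_merge[OF wp(1) aw le(1) this] le(3) show "\<exists>A \<alpha> B \<beta> u. a = merge u A B \<pi> \<and> (A, \<alpha>) \<in> \<pi> \<and> (B, \<beta>) \<in> \<pi>
    \<and> A \<noteq> B \<and> u \<le> 1 \<and> wle n (merge u A B \<pi>) \<rho>" by metis
next
  assume "\<exists>A \<alpha> B \<beta> u. a = merge u A B \<pi> \<and> (A, \<alpha>) \<in> \<pi> \<and> (B, \<beta>) \<in> \<pi>
    \<and> A \<noteq> B \<and> u \<le> 1 \<and> wle n (merge u A B \<pi>) \<rho>"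
  then obtain A \<alpha> B \<beta> u where a: "a = merge u A B \<pi>" "(A, \<alpha>) \<in> \<pi>" "(B, \<beta>) \<in> \<pi>" "A \<noteq> B" "u \<le> 1"
    "wle n a \<rho>" by blast
  have aw: "a \<in> wpartitions n" unfolding a(1) by (rule merge_in_wpartitions[OF wp(1) a(2-5)])
  have "Suc (card a) = card \<pi>" unfolding a(1) by (rule card_merge[OF wp(1) a(2-4)])
  moreover have "wle n \<pi> a" unfolding a(1) by (rule wle_merge[OF wp(1) a(2-5)])
  ultimately show "a \<in> between n \<pi> \<rho>"
    using aw a(6) c by (simp add: between_def lt_wle_card[OF wp(1) aw] lt_wle_card[OF aw wp(2)])
qed

lemma merge_le_block:
  assumes wp: "\<pi> \<in> wpartitions n" "\<rho> \<in> wpartitions n" and A: "(A, \<alpha>) \<in> \<pi>" and B: "(B, \<beta>) \<in> \<pi>"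
    and "A \<noteq> B" "u \<le> 1" "wle n (merge u A B \<pi>) \<rho>"
  obtains E v where "(E, v) \<in> \<rho>" "A \<subseteq> E" "B \<subseteq> E"
proof -
  have "(A \<union> B, \<alpha> + \<beta> + u) \<in> merge u A B \<pi>" by (simp add: merge_eq[OF wp(1) A B])
  from wle_sub[OF merge_in_wpartitions[OF wp(1) A B assms(5,6)] wp(2) assms(7) this] show thesis
    using that by (metis Un_subset_iff)
qed

lemma block_of_pair:
  assumes "\<pi> \<in> wpartitions n" "(A, a) \<in> \<pi>" "(B, b) \<in> \<pi>" "A \<noteq> B" "A \<subseteq> E" "B \<subseteq> E"
  shows "(E, e) \<notin> \<pi>"
  using wp_subset_eq[OF assms(1,2) _ assms(5)] wp_subset_eq[OF assms(1,3) _ assms(6)] assms(4) by metis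

text \<open>When \<open>A\<close> and \<open>B\<close> are the only parts of their block in
  \<open>\<rho>\<close>, the weight of that block leaves no freedom for \<open>w\<close>.\<close>

lemma merge_pair_le:
  assumes wp: "\<pi> \<in> wpartitions n" "\<rho> \<in> wpartitions n" and le: "wle n \<pi> \<rho>"
    and A: "(A, a) \<in> \<pi>" and B: "(B, b) \<in> \<pi>" and "A \<noteq> B" and "w \<le> 1"
    and r: "(A \<union> B, a + b + u) \<in> \<rho>"
  shows "wle n (merge w A B \<pi>) \<rho> \<longleftrightarrow> w = u"
  using merge_le_iff[OF wp le A B assms(6,7) r] assms(6)
  by (auto simp: wsum_def parts_in_two[OF wp(1) A B])

text \<open>A merge that stays below the top joins two parts of one new block. Both new blocks have
  exactly two parts, so only the two given merges remain, with forced weights.\<close>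

lemma between_disjoint:
  assumes wp: "\<pi> \<in> wpartitions n"
    and A: "(A, a) \<in> \<pi>" and B: "(B, b) \<in> \<pi>" and C: "(C, c) \<in> \<pi>" and D: "(D, d) \<in> \<pi>"
    and ne: "A \<noteq> B" "C \<noteq> D" "C \<notin> {A, B}" "D \<notin> {A, B}" and u: "u \<le> 1" "v \<le> 1"
  shows "between n \<pi> (merge v C D (merge u A B \<pi>)) = {merge u A B \<pi>, merge v C D \<pi>}"
    and "merge u A B \<pi> \<noteq> merge v C D \<pi>"
proof -
  let ?m = "merge u A B \<pi>" and ?r = "merge v C D (merge u A B \<pi>)"
  note em = merge_eq[OF wp A B, of u]
  have wm: "?m \<in> wpartitions n" by (rule merge_in_wpartitions[OF wp A B ne(1) u(1)])
  have Cm: "(C, c) \<in> ?m" "(D, d) \<in> ?m" using C D ne unfolding em by auto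
  have wr: "?r \<in> wpartitions n" by (rule merge_in_wpartitions[OF wm Cm ne(2) u(2)])
  note er = merge_eq[OF wm Cm, of v]
  have le: "wle n \<pi> ?r"
    using wle_trans[OF wp wm wr wle_merge[OF wp A B ne(1) u(1)] wle_merge[OF wm Cm ne(2) u(2)]] .
  have card: "card \<pi> = Suc (Suc (card ?r))"
    using card_merge[OF wp A B ne(1), of u] card_merge[OF wm Cm ne(2), of v] by simp
  have "(A \<union> B, x) \<noteq> (C, c)" "(A \<union> B, x) \<noteq> (D, d)" for x
    using union_not_block[OF wp A B ne(1)] C D by auto
  then have rAB: "(A \<union> B, a + b + u) \<in> ?r" unfolding er unfolding em by auto
  have rCD: "(C \<union> D, c + d + v) \<in> ?r" unfolding er by simp
  have other: "E = A \<union> B \<or> E = C \<union> D \<or> (E, e) \<in> \<pi>" if "(E, e) \<in> ?r" for E e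
    using that unfolding er unfolding em by auto
  have wAB: "wle n (merge w A B \<pi>) ?r \<longleftrightarrow> w = u" if "w \<le> 1" for w
    by (rule merge_pair_le[OF wp wr le A B ne(1) that rAB])
  have wCD: "wle n (merge w C D \<pi>) ?r \<longleftrightarrow> w = v" if "w \<le> 1" for w
    by (rule merge_pair_le[OF wp wr le C D ne(2) that rCD])
  show "between n \<pi> ?r = {?m, merge v C D \<pi>}"
  proof (intro set_eqI iffI)
    fix z assume "z \<in> between n \<pi> ?r"
    then obtain X x Y y w where z: "z = merge w X Y \<pi>" "(X, x) \<in> \<pi>" "(Y, y) \<in> \<pi>" "X \<noteq> Y" "w \<le> 1"
      "wle n (merge w X Y \<pi>) ?r"
      unfolding between_eq[OF wp wr card] by blast
    obtain E e where E: "(E, e) \<in> ?r" "X \<subseteq> E" "Y \<subseteq> E"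
      by (rule merge_le_block[OF wp wr z(2-6)])
    have "(E, e) \<notin> \<pi>" by (rule block_of_pair[OF wp z(2-4) E(2,3)])
    then have "E = A \<union> B \<or> E = C \<union> D" using other[OF E(1)] by simp
    then show "z \<in> {?m, merge v C D \<pi>}"
    proof
      assume "E = A \<union> B"
      then have "(X, x) \<in> parts_in \<pi> (A \<union> B)" "(Y, y) \<in> parts_in \<pi> (A \<union> B)"
        using z E by (simp_all add: parts_in_def)
      then have "X = A \<and> Y = B \<or> X = B \<and> Y = A" unfolding parts_in_two[OF wp A B] using z(4) by auto
      then have "z = merge w A B \<pi>" unfolding z(1) using merge_commute by metis
      moreover from this have "w = u" using wAB[OF z(5)] z(1,6) by simp
      ultimately show ?thesis by simp
    next
      assume "E = C \<union> D"
      then have "(X, x) \<in> parts_in \<pi> (C \<union> D)" "(Y, y) \<in> parts_in \<pi> (C \<union> D)"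
        using z E by (simp_all add: parts_in_def)
      then have "X = C \<and> Y = D \<or> X = D \<and> Y = C" unfolding parts_in_two[OF wp C D] using z(4) by auto
      then have "z = merge w C D \<pi>" unfolding z(1) using merge_commute by metis
      moreover from this have "w = v" using wCD[OF z(5)] z(1,6) by simp
      ultimately show ?thesis by simp
    qed
  next
    fix z assume "z \<in> {?m, merge v C D \<pi>}"
    then show "z \<in> between n \<pi> ?r"
      unfolding between_eq[OF wp wr card] using A B C D ne(1,2) u wAB[OF u(1)] wCD[OF u(2)] by blast
  qed
  show "?m \<noteq> merge v C D \<pi>"
  proof
    assume "?m = merge v C D \<pi>"
    from merge_inj(1)[OF wp A B ne(1) C D ne(2) this] have "A \<union> B = C \<union> D" .
    then have "(A, a) \<in> parts_in \<pi> (C \<union> D)" using A by (auto simp: parts_in_def)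
    then show False unfolding parts_in_two[OF wp C D] using ne by auto
  qed
qed

lemma parts_in_three:
  assumes "\<pi> \<in> wpartitions n" "(A, a) \<in> \<pi>" "(B, b) \<in> \<pi>" "(D, d) \<in> \<pi>"
  shows "parts_in \<pi> (A \<union> B \<union> D) = {(A, a), (B, b), (D, d)}"
  using parts_in_Union[OF assms(1), of "{(A, a), (B, b), (D, d)}"] assms by (simp add: Un_assoc)

lemma merge_merge:
  assumes wp: "\<pi> \<in> wpartitions n"
    and A: "(A, a) \<in> \<pi>" and B: "(B, b) \<in> \<pi>" and D: "(D, d) \<in> \<pi>"
    and ne: "A \<noteq> B" "D \<noteq> A" "D \<noteq> B" and u: "u \<le> 1"
  shows "merge v (A \<union> B) D (merge u A B \<pi>)
    = insert (A \<union> B \<union> D, a + b + d + (u + v)) (\<pi> - {(A, a), (B, b), (D, d)})"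
proof -
  note em = merge_eq[OF wp A B, of u]
  have wm: "merge u A B \<pi> \<in> wpartitions n" by (rule merge_in_wpartitions[OF wp A B ne(1) u])
  have mem: "(A \<union> B, a + b + u) \<in> merge u A B \<pi>" "(D, d) \<in> merge u A B \<pi>" using D ne unfolding em by auto
  have "(A \<union> B, a + b + u) \<notin> \<pi>" by (rule union_not_block[OF wp A B ne(1)])
  then have "insert (A \<union> B, a + b + u) (\<pi> - {(A, a), (B, b)}) - {(A \<union> B, a + b + u), (D, d)}
      = \<pi> - {(A, a), (B, b), (D, d)}" by auto
  then show ?thesis unfolding merge_eq[OF wm mem] unfolding em by (simp add: ac_simps)
qed

text \<open>The new block has three parts and excess \<open>u + v\<close>. A first merge with
  \<open>w\<close> leaves two parts and excess \<open>u + v - w\<close>, which must be 0 or 1; this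
  happens exactly when \<open>w\<close> is \<open>u\<close> or \<open>v\<close>. The pairs are
  listed cyclically to match the Jacobi relation.\<close>

lemma between_nested:
  assumes wp: "\<pi> \<in> wpartitions n"
    and A: "(A, a) \<in> \<pi>" and B: "(B, b) \<in> \<pi>" and D: "(D, d) \<in> \<pi>"
    and ne: "A \<noteq> B" "D \<noteq> A" "D \<noteq> B" and u: "u \<le> 1" "v \<le> 1"
  shows "between n \<pi> (merge v (A \<union> B) D (merge u A B \<pi>)) =
    (\<lambda>(p, w). merge w (fst p) (snd p) \<pi>) ` ({(A, B), (B, D), (D, A)} \<times> {u, v})"
proof -
  let ?m = "merge u A B \<pi>" and ?r = "merge v (A \<union> B) D (merge u A B \<pi>)" and ?U = "A \<union> B \<union> D"
  note em = merge_eq[OF wp A B, of u]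
  note er = merge_merge[OF wp A B D ne u(1), of v]
  have wm: "?m \<in> wpartitions n" by (rule merge_in_wpartitions[OF wp A B ne(1) u(1)])
  have mem: "(A \<union> B, a + b + u) \<in> ?m" "(D, d) \<in> ?m" using D ne unfolding em by auto
  have neD: "A \<union> B \<noteq> D" using union_not_block[OF wp A B ne(1)] D by auto
  have wr: "?r \<in> wpartitions n" by (rule merge_in_wpartitions[OF wm mem neD u(2)])
  have le: "wle n \<pi> ?r"
    using wle_trans[OF wp wm wr wle_merge[OF wp A B ne(1) u(1)] wle_merge[OF wm mem neD u(2)]] .
  have card: "card \<pi> = Suc (Suc (card ?r))"
    using card_merge[OF wp A B ne(1), of u] card_merge[OF wm mem neD, of v] by simp
  have rU: "(?U, a + b + d + (u + v)) \<in> ?r" unfolding er by simp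
  have pU: "parts_in \<pi> ?U = {(A, a), (B, b), (D, d)}" by (rule parts_in_three[OF wp A B D])
  have ws: "wsum \<pi> ?U = int (a + b + d)" "card (parts_in \<pi> ?U) = 3"
    unfolding wsum_def pU using ne by auto
  have key: "wle n (merge w X Y \<pi>) ?r \<longleftrightarrow> w \<in> {u, v}"
    if "(X, x) \<in> \<pi>" "(Y, y) \<in> \<pi>" "X \<noteq> Y" "w \<le> 1" "X \<subseteq> ?U" "Y \<subseteq> ?U" for X x Y y w
  proof -
    have "w = 0 \<or> w = 1" "u = 0 \<or> u = 1" "v = 0 \<or> v = 1" using u that(4) by auto
    then show ?thesis
      unfolding merge_le_iff[OF wp wr le that(1-4) rU that(5,6)] ws by auto
  qed
  show ?thesis
  proof (intro set_eqI iffI)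
    fix z assume "z \<in> between n \<pi> ?r"
    then obtain X x Y y w where z: "z = merge w X Y \<pi>" "(X, x) \<in> \<pi>" "(Y, y) \<in> \<pi>" "X \<noteq> Y" "w \<le> 1"
      "wle n (merge w X Y \<pi>) ?r"
      unfolding between_eq[OF wp wr card] by blast
    obtain E e where E: "(E, e) \<in> ?r" "X \<subseteq> E" "Y \<subseteq> E"
      by (rule merge_le_block[OF wp wr z(2-6)])
    have "(E, e) \<notin> \<pi>" by (rule block_of_pair[OF wp z(2-4) E(2,3)])
    then have EU: "E = ?U" using E(1) unfolding er by auto
    then have w: "w \<in> {u, v}" using key[OF z(2-5)] E z(6) by simp
    have "(X, x) \<in> parts_in \<pi> ?U" "(Y, y) \<in> parts_in \<pi> ?U"
      using z E EU by (simp_all add: parts_in_def)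
    then have "(X, Y) \<in> {(A, B), (B, D), (D, A)} \<or> (Y, X) \<in> {(A, B), (B, D), (D, A)}"
      unfolding pU using z(4) by auto
    then show "z \<in> (\<lambda>(p, w). merge w (fst p) (snd p) \<pi>) ` ({(A, B), (B, D), (D, A)} \<times> {u, v})"
    proof
      assume "(X, Y) \<in> {(A, B), (B, D), (D, A)}"
      then show ?thesis using w z(1) by (intro image_eqI[of _ _ "((X, Y), w)"]) auto
    next
      assume "(Y, X) \<in> {(A, B), (B, D), (D, A)}"
      moreover have "z = merge w Y X \<pi>" unfolding z(1) by (rule merge_commute)
      ultimately show ?thesis using w by (intro image_eqI[of _ _ "((Y, X), w)"]) auto
    qed
  next
    fix z assume "z \<in> (\<lambda>(p, w). merge w (fst p) (snd p) \<pi>) ` ({(A, B), (B, D), (D, A)} \<times> {u, v})"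
    then obtain X Y w where z: "z = merge w X Y \<pi>" "(X, Y) \<in> {(A, B), (B, D), (D, A)}" "w \<in> {u, v}"
      by auto
    from z(2) obtain x y where XY: "(X, x) \<in> \<pi>" "(Y, y) \<in> \<pi>" "X \<noteq> Y" "X \<subseteq> ?U" "Y \<subseteq> ?U"
    proof -
      assume t: "\<And>x y. (X, x) \<in> \<pi> \<Longrightarrow> (Y, y) \<in> \<pi> \<Longrightarrow> X \<noteq> Y \<Longrightarrow> X \<subseteq> ?U \<Longrightarrow> Y \<subseteq> ?U \<Longrightarrow> thesis"
      from z(2) consider "X = A" "Y = B" | "X = B" "Y = D" | "X = D" "Y = A" by auto
      then show thesis
      proof cases
        case 1
        then show thesis using t[of a b] A B ne by auto
      next
        case 2
        then show thesis using t[of b d] B D ne by auto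
      next
        case 3
        then show thesis using t[of d a] A D ne by auto
      qed
    qed
    have w1: "w \<le> 1" using z(3) u by auto
    have "wle n (merge w X Y \<pi>) ?r" using key[OF XY(1-3) w1 XY(4,5)] z(3) by simp
    then show "z \<in> between n \<pi> ?r"
      unfolding between_eq[OF wp wr card] using z(1) XY(1-3) w1 by blast
  qed
qed

section \<open>The two kinds of coboundary relations\<close>

definition chain_vec :: "nat \<Rightarrow> node list \<Rightarrow> (('k::field) chain_vecs)" where
  "chain_vec n L = basis_vec (bar (chain_from n {} L))"

lemma u_color_le: "u_color c \<le> 1"
  by (cases c) simp_all

lemma u_color_inj: "u_color c = u_color d \<Longrightarrow> c = d"
  by (cases c; cases d) simp_all

lemma linear_ext_swap:
  assumes "linear_ext m (P @ x # y # Q)" "\<not> fst x \<subseteq> fst y"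
  shows "linear_ext m (P @ y # x # Q)"
  using assms by (auto simp: linear_ext_def sorted_wrt_append)

text \<open>If \<open>y\<close> merged one of the blocks \<open>A\<close> and \<open>B\<close> of
  \<open>x\<close>, then after the merge \<open>x\<close> it would have to contain the block
  \<open>A \<union> B\<close>, against the hypothesis. So four different blocks are involved, and
  the interval has two inner elements.\<close>

lemma cobdry_swap:
  assumes m: "perm_bracket n m" "linear_ext m (P @ x # y # Q)" and xy: "\<not> fst x \<subseteq> fst y"
  shows "cobdry (wint n (red_brackets m)) (wle n) (basis_vec (bar (gap_chain n P x y Q))) =
    fscale ((- 1) ^ length P) (chain_vec n (P @ x # y # Q) + chain_vec n (P @ y # x # Q))"
proof -
  let ?F = "set P"
  have m': "linear_ext m (P @ y # x # Q)" by (rule linear_ext_swap[OF m(2) xy])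
  have yx: "\<not> fst y \<subseteq> fst x" using m(2) by (auto simp: linear_ext_def sorted_wrt_append)
  obtain A B where AB: "A \<in> blocks n ?F" "B \<in> blocks n ?F" "A \<noteq> B" "x = (A \<union> B, snd x)"
    using linear_ext_step[OF m] .
  obtain C D where CD: "C \<in> blocks n ?F" "D \<in> blocks n ?F" "C \<noteq> D" "y = (C \<union> D, snd y)"
    using linear_ext_step[OF m(1) m'] .
  have g: "good_forest n ?F" by (rule good_prefix[OF m])
  have gx: "good_forest n (insert x ?F)" using forest_wpart_insert(2)[OF g AB(1-3)] AB(4) by metis
  have bx: "blocks n (insert x ?F) = insert (A \<union> B) (blocks n ?F - {A, B})"
    using blocks_insert[OF g AB(1-3)] AB(4) by metis
  have sep: "Z \<notin> {A, B}" if Z: "Z \<in> {C, D}" for Z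
  proof
    assume "Z \<in> {A, B}"
    obtain C' D' where CD': "C' \<in> blocks n (set (P @ [x]))" "D' \<in> blocks n (set (P @ [x]))" "C' \<noteq> D'" "y = (C' \<union> D', snd y)"
      using linear_ext_step[of n m "P @ [x]" y Q] m by auto
    have U: "C \<union> D = C' \<union> D'" using CD(4) CD'(4) by (metis fst_conv)
    have "Z \<in> blocks n ?F" using Z CD by auto
    then have "Z \<noteq> {}" by (rule blocks_nonempty[OF g])
    then obtain z where "z \<in> Z" by blast
    then have z: "z \<in> A \<union> B" "z \<in> C' \<union> D'" using Z \<open>Z \<in> {A, B}\<close> U by auto
    then obtain E where E: "E \<in> {C', D'}" "z \<in> E" by blast
    have "E \<in> blocks n (insert x ?F)" using E CD' by auto
    moreover have "A \<union> B \<in> blocks n (insert x ?F)" unfolding bx by simp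
    ultimately have "E = A \<union> B" using blocks_disjoint[OF gx] E(2) z(1) by blast
    then have "A \<union> B \<subseteq> C' \<union> D'" using E(1) by blast
    then show False using xy AB(4) CD'(4) by (metis fst_conv)
  qed
  let ?\<pi> = "forest_wpart n ?F"
  have mem: "(Z, red_wt ?F Z) \<in> ?\<pi>" if "Z \<in> blocks n ?F" for Z
    using that by (simp add: in_forest_wpart)
  have ex: "forest_wpart n (insert x ?F) = merge (u_color (snd x)) A B ?\<pi>"
    using forest_wpart_insert(1)[OF g AB(1-3), of "snd x"] AB(4) by simp
  have ey: "forest_wpart n (insert y ?F) = merge (u_color (snd y)) C D ?\<pi>"
    using forest_wpart_insert(1)[OF g CD(1-3), of "snd y"] CD(4) by simp
  have CDx: "C \<in> blocks n (insert x ?F)" "D \<in> blocks n (insert x ?F)"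
    unfolding bx using CD sep by auto
  have exy: "forest_wpart n (insert y (insert x ?F)) = merge (u_color (snd y)) C D (merge (u_color (snd x)) A B ?\<pi>)"
    using forest_wpart_insert(1)[OF gx CDx CD(3), of "snd y"] CD(4) ex by simp
  have sepCD: "C \<notin> {A, B}" "D \<notin> {A, B}" using sep by blast+
  note bd = between_disjoint[OF forest_wpart_in[OF g] mem[OF AB(1)] mem[OF AB(2)] mem[OF CD(1)] mem[OF CD(2)]
      AB(3) CD(3) sepCD u_color_le[of "snd x"] u_color_le[of "snd y"]]
  have "(\<Sum>a\<in>between n ?\<pi> (forest_wpart n (insert y (insert x ?F))).
        basis_vec (bar (chain_init n {} P @ ?\<pi> # a # chain_from n (insert y (insert x ?F)) Q)))
      = chain_vec n (P @ x # y # Q) + chain_vec n (P @ y # x # Q)"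
    unfolding exy bd(1) using bd(2)
    by (simp add: chain_vec_def chain_from_append ex ey insert_commute[of x y])
  then show ?thesis unfolding cobdry_gap(3)[OF m refl] by simp
qed

text \<open>The rest of a chain depends on the earlier merges only through the weighted partition
  they reach. This matters where different merges with different sets of nodes lead to the same top
  of an interval of rank two.\<close>

lemma chain_from_cong:
  assumes "perm_bracket n m" "linear_ext m (P @ Q)" "good_forest n F"
    and "forest_wpart n (set P) = forest_wpart n F"
  shows "chain_from n (set P) Q = chain_from n F Q"
  using assms(2-)
proof (induction Q arbitrary: P F)
  case (Cons x Q)
  obtain A B where AB: "A \<in> blocks n (set P)" "B \<in> blocks n (set P)" "A \<noteq> B" "x = (A \<union> B, snd x)"
    using linear_ext_step[OF assms(1) Cons.prems(1)] .
  have b: "blocks n G = fst ` forest_wpart n G" for G by (simp add: forest_wpart_def image_image)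
  have AB': "A \<in> blocks n F" "B \<in> blocks n F" using AB(1,2) unfolding b Cons.prems(3) by simp_all
  have g: "good_forest n (set P)" by (rule good_prefix[OF assms(1) Cons.prems(1)])
  have "forest_wpart n (insert x (set P)) = forest_wpart n (insert x F)"
    using forest_wpart_insert(1)[OF g AB(1-3), of "snd x"]
      forest_wpart_insert(1)[OF Cons.prems(2) AB' AB(3), of "snd x"] AB(4) Cons.prems(3) by simp
  moreover have "good_forest n (insert x F)"
    using forest_wpart_insert(2)[OF Cons.prems(2) AB' AB(3), of "snd x"] AB(4) by simp
  moreover have "linear_ext m ((P @ [x]) @ Q)" using Cons.prems(1) by simp
  ultimately have "chain_from n (set (P @ [x])) Q = chain_from n (insert x F) Q"
    by (intro Cons.IH) simp_all
  then show ?case using Cons.prems(3) by simp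
qed simp

text \<open>The lower merge takes a color \<open>e\<close> in \<open>{c, d}\<close> and the upper
  one the other color, which \<open>rest e\<close> records. For \<open>c = d\<close> the index set
  collapses and three of the six terms remain.\<close>

lemma cobdry_nested:
  assumes m: "perm_bracket n m" "linear_ext m (P @ (A \<union> B, c) # (A \<union> B \<union> D, d) # Q)"
    and blk: "A \<in> blocks n (set P)" "B \<in> blocks n (set P)" "D \<in> blocks n (set P)"
    and ne: "A \<noteq> B" "D \<noteq> A" "D \<noteq> B"
  defines "rest \<equiv> (\<lambda>e. (A \<union> B \<union> D, if e = c then d else c) # Q)"
  shows "cobdry (wint n (red_brackets m)) (wle n) (basis_vec (bar (gap_chain n P (A \<union> B, c) (A \<union> B \<union> D, d) Q))) =
    fscale ((- 1) ^ length P) (\<Sum>e\<in>{c, d}. chain_vec n (P @ (A \<union> B, e) # rest e)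
      + chain_vec n (P @ (B \<union> D, e) # rest e) + chain_vec n (P @ (D \<union> A, e) # rest e))"
proof -
  let ?F = "set P" and ?\<pi> = "forest_wpart n (set P)" and ?x = "(A \<union> B, c)" and ?y = "(A \<union> B \<union> D, d)"
  let ?I = "{(A, B), (B, D), (D, A)}"
  have g: "good_forest n ?F" by (rule good_prefix[OF m])
  note wp = forest_wpart_in[OF g]
  have mem: "(Z, red_wt ?F Z) \<in> ?\<pi>" if "Z \<in> blocks n ?F" for Z
    using that by (simp add: in_forest_wpart)
  \<comment> \<open>The common top of the interval; this form is symmetric in the three blocks and
    in the two colors.\<close>
  define \<tau> where "\<tau> = insert (A \<union> B \<union> D, red_wt ?F A + red_wt ?F B + red_wt ?F D + (u_color c + u_color d))
    (?\<pi> - {(A, red_wt ?F A), (B, red_wt ?F B), (D, red_wt ?F D)})"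
  have two: "forest_wpart n (insert (A \<union> B \<union> D, e') (insert (X \<union> Y, e) ?F)) = \<tau>
      \<and> good_forest n (insert (A \<union> B \<union> D, e') (insert (X \<union> Y, e) ?F))
      \<and> forest_wpart n (insert (X \<union> Y, e) ?F) = merge (u_color e) X Y ?\<pi>
      \<and> forest_wpart n (insert (A \<union> B \<union> D, e') (insert (X \<union> Y, e) ?F)) =
        merge (u_color e') (X \<union> Y) Z (merge (u_color e) X Y ?\<pi>)"
    if XYZ: "(X, Y, Z) \<in> {(A, B, D), (B, D, A), (D, A, B)}" and e: "u_color e + u_color e' = u_color c + u_color d"
    for X Y Z e e'
  proof -
    have b: "X \<in> blocks n ?F" "Y \<in> blocks n ?F" "Z \<in> blocks n ?F" "X \<noteq> Y" "Z \<noteq> X" "Z \<noteq> Y"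
      using XYZ blk ne by auto
    have U: "A \<union> B \<union> D = X \<union> Y \<union> Z" using XYZ by auto
    note ins = forest_wpart_insert[OF g b(1,2,4), of e]
    have "X \<union> Y \<noteq> Z" using union_not_block[OF wp mem[OF b(1)] mem[OF b(2)] b(4)] mem[OF b(3)] by auto
    moreover have "X \<union> Y \<in> blocks n (insert (X \<union> Y, e) ?F)" "Z \<in> blocks n (insert (X \<union> Y, e) ?F)"
      unfolding blocks_insert[OF g b(1,2,4)] using b by auto
    ultimately have ins2: "forest_wpart n (insert (X \<union> Y \<union> Z, e') (insert (X \<union> Y, e) ?F)) =
        merge (u_color e') (X \<union> Y) Z (merge (u_color e) X Y ?\<pi>)"
      "good_forest n (insert (X \<union> Y \<union> Z, e') (insert (X \<union> Y, e) ?F))"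
      using forest_wpart_insert[OF ins(2), of "X \<union> Y" Z e'] ins(1) by simp_all
    have "merge (u_color e') (X \<union> Y) Z (merge (u_color e) X Y ?\<pi>) = \<tau>"
      unfolding merge_merge[OF wp mem[OF b(1)] mem[OF b(2)] mem[OF b(3)] b(4-6) u_color_le] e \<tau>_def U[symmetric]
      using XYZ by (auto simp: insert_commute)
    with ins ins2 show ?thesis unfolding U by simp
  qed
  note two0 = two[of A B D c d, OF insertI1 refl]
  have summand: "basis_vec (bar (chain_init n {} P @ ?\<pi> # merge (u_color e) X Y ?\<pi> # chain_from n (insert ?y (insert ?x ?F)) Q))
      = chain_vec n (P @ (X \<union> Y, e) # rest e)" if "(X, Y) \<in> ?I" "e \<in> {c, d}" for X Y e
  proof -
    obtain Z where XYZ: "(X, Y, Z) \<in> {(A, B, D), (B, D, A), (D, A, B)}" using \<open>(X, Y) \<in> ?I\<close> by auto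
    let ?e = "if e = c then d else c"
    have e: "u_color e + u_color ?e = u_color c + u_color d" using that(2) by auto
    note t = two[OF XYZ e]
    \<comment> \<open>The two sets of nodes differ, but their weighted partitions agree.\<close>
    have "chain_from n (set (P @ [?x, ?y])) Q = chain_from n (insert (A \<union> B \<union> D, ?e) (insert (X \<union> Y, e) ?F)) Q"
    proof (rule chain_from_cong[OF m(1)])
      show "linear_ext m ((P @ [?x, ?y]) @ Q)" using m(2) by simp
      show "good_forest n (insert (A \<union> B \<union> D, ?e) (insert (X \<union> Y, e) ?F))" using t by blast
      show "forest_wpart n (set (P @ [?x, ?y])) = forest_wpart n (insert (A \<union> B \<union> D, ?e) (insert (X \<union> Y, e) ?F))"
        using t two0 by (simp add: insert_commute)
    qed
    moreover have "set (P @ [?x, ?y]) = insert ?y (insert ?x ?F)" by auto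
    ultimately show ?thesis
      using t by (simp add: chain_vec_def chain_from_append rest_def)
  qed
  have btw: "between n ?\<pi> (forest_wpart n (insert ?y (insert ?x ?F))) =
      (\<lambda>(p, e). merge (u_color e) (fst p) (snd p) ?\<pi>) ` (?I \<times> {c, d})"
  proof -
    have "forest_wpart n (insert ?y (insert ?x ?F)) = merge (u_color d) (A \<union> B) D (merge (u_color c) A B ?\<pi>)"
      by (rule two0[THEN conjunct2, THEN conjunct2, THEN conjunct2])
    then have "between n ?\<pi> (forest_wpart n (insert ?y (insert ?x ?F))) =
      (\<lambda>(p, w). merge w (fst p) (snd p) ?\<pi>) ` (?I \<times> {u_color c, u_color d})"
      using between_nested[OF wp mem[OF blk(1)] mem[OF blk(2)] mem[OF blk(3)] ne u_color_le u_color_le] by metis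
    also have "?I \<times> {u_color c, u_color d} = (\<lambda>(p, e). (p, u_color e)) ` (?I \<times> {c, d})" by auto
    finally show ?thesis by (simp only: image_image case_prod_unfold fst_conv snd_conv)
  qed
  \<comment> \<open>Different pairs and colors give different elements, so the sum over the interval
    can be indexed by pairs and colors.\<close>
  have inj: "inj_on (\<lambda>(p, e). merge (u_color e) (fst p) (snd p) ?\<pi>) (?I \<times> {c, d})"
  proof (rule inj_onI)
    fix a a' assume a: "a \<in> ?I \<times> {c, d}" "a' \<in> ?I \<times> {c, d}"
      and "(\<lambda>(p, e). merge (u_color e) (fst p) (snd p) ?\<pi>) a = (\<lambda>(p, e). merge (u_color e) (fst p) (snd p) ?\<pi>) a'"
    then obtain X Y e X' Y' e' where XY: "a = ((X, Y), e)" "a' = ((X', Y'), e')" "(X, Y) \<in> ?I" "(X', Y') \<in> ?I"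
      and eq: "merge (u_color e) X Y ?\<pi> = merge (u_color e') X' Y' ?\<pi>"
      by (cases a, cases a') auto
    have b: "X \<in> blocks n ?F" "Y \<in> blocks n ?F" "X \<noteq> Y" "X' \<in> blocks n ?F" "Y' \<in> blocks n ?F" "X' \<noteq> Y'"
      using XY(3,4) blk ne by auto
    note mi = merge_inj[OF wp mem[OF b(1)] mem[OF b(2)] b(3) mem[OF b(4)] mem[OF b(5)] b(6) eq]
    have "parts_in ?\<pi> (X \<union> Y) = parts_in ?\<pi> (X' \<union> Y')" using mi(1) by simp
    then have "{(X, red_wt ?F X), (Y, red_wt ?F Y)} = {(X', red_wt ?F X'), (Y', red_wt ?F Y')}"
      unfolding parts_in_two[OF wp mem[OF b(1)] mem[OF b(2)]] parts_in_two[OF wp mem[OF b(4)] mem[OF b(5)]] .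
    then have "(X, Y) = (X', Y') \<or> (X, Y) = (Y', X')" by (auto simp: doubleton_eq_iff)
    then have "(X, Y) = (X', Y')" using XY(3,4) ne by auto
    with XY u_color_inj[OF mi(2)] show "a = a'" by simp
  qed
  have "(\<Sum>a\<in>between n ?\<pi> (forest_wpart n (insert ?y (insert ?x ?F))).
        basis_vec (bar (chain_init n {} P @ ?\<pi> # a # chain_from n (insert ?y (insert ?x ?F)) Q)))
      = (\<Sum>(p, e)\<in>?I \<times> {c, d}. chain_vec n (P @ (fst p \<union> snd p, e) # rest e) :: _ \<Rightarrow>\<^sub>0 'a)"
    unfolding btw sum.reindex[OF inj] comp_def
  proof (rule sum.cong[OF refl])
    fix z assume "z \<in> ?I \<times> {c, d}"
    then obtain X Y e where z: "z = ((X, Y), e)" "(X, Y) \<in> ?I" "e \<in> {c, d}" by (metis SigmaE surj_pair)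
    show "basis_vec (bar (chain_init n {} P @ ?\<pi> # (case z of (p, e) \<Rightarrow> merge (u_color e) (fst p) (snd p) ?\<pi>)
        # chain_from n (insert ?y (insert ?x ?F)) Q))
      = ((case z of (p, e) \<Rightarrow> chain_vec n (P @ (fst p \<union> snd p, e) # rest e)) :: _ \<Rightarrow>\<^sub>0 'a)"
      unfolding z(1) using summand[OF z(2,3)] by (simp only: prod.case fst_conv snd_conv)
  qed
  also have "\<dots> = (\<Sum>e\<in>{c, d}. \<Sum>p\<in>?I. chain_vec n (P @ (fst p \<union> snd p, e) # rest e))"
    unfolding sum.cartesian_product[symmetric] by (rule sum.swap)
  also have "\<dots> = (\<Sum>e\<in>{c, d}. chain_vec n (P @ (A \<union> B, e) # rest e)
      + chain_vec n (P @ (B \<union> D, e) # rest e) + chain_vec n (P @ (D \<union> A, e) # rest e))"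
    by (rule sum.cong[OF refl]) (use ne in \<open>simp add: add.assoc\<close>)
  finally show ?thesis unfolding cobdry_gap(3)[OF m refl] by simp
qed

section \<open>From brackets to chains\<close>

abbreviation wcobdries :: "nat \<Rightarrow> nat \<Rightarrow> (('k::field) chain_vecs) set" where
  "wcobdries n i \<equiv> int_cobdries (wpartitions n) (wle n) (wbot n) (wtop n i) (int n - 3)"

section \<open>The space of coboundaries\<close>

lemma cobdry_add [simp]: "cobdry P le (p + q) = cobdry P le p + cobdry P le q"
  by (simp add: cobdry_def)

lemma cobdry_scale [simp]: "cobdry P le (fscale c p) = fscale c (cobdry P le p)"
  by (simp add: cobdry_def)

lemma cobdry_0 [simp]: "cobdry P le 0 = 0"
  by (simp add: cobdry_def)

lemma subspace_cobdries: "fvs.subspace (int_cobdries P le x y r :: ('p list \<Rightarrow>\<^sub>0 'k::field) set)"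
proof (cases "x = y")
  case True
  then show ?thesis by (simp add: int_cobdries_def subspace_zero_set)
next
  case False
  let ?P = "open_interval P le x y"
  have S: "fvs.subspace (cochains ?P le (r - 1) :: ('p list \<Rightarrow>\<^sub>0 'k) set)" unfolding cochains_def by (rule fvs.subspace_span)
  show ?thesis
  proof (rule fvs.subspaceI)
    show "0 \<in> (int_cobdries P le x y r :: ('p list \<Rightarrow>\<^sub>0 'k) set)"
      using False fvs.subspace_0[OF S] by (auto simp: int_cobdries_def intro: image_eqI[of _ _ 0])
    fix p q :: "'p list \<Rightarrow>\<^sub>0 'k" assume "p \<in> int_cobdries P le x y r" "q \<in> int_cobdries P le x y r"
    then obtain a b where "a \<in> cochains ?P le (r - 1)" "p = cobdry ?P le a"
      "b \<in> cochains ?P le (r - 1)" "q = cobdry ?P le b" using False by (auto simp: int_cobdries_def)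
    then show "p + q \<in> int_cobdries P le x y r"
      using False fvs.subspace_add[OF S] by (auto simp: int_cobdries_def intro!: image_eqI[of _ _ "a + b"])
  next
    fix c and p :: "'p list \<Rightarrow>\<^sub>0 'k" assume "p \<in> int_cobdries P le x y r"
    then obtain a where "a \<in> cochains ?P le (r - 1)" "p = cobdry ?P le a" using False by (auto simp: int_cobdries_def)
    then show "fscale c p \<in> int_cobdries P le x y r"
      using False fvs.subspace_scale[OF S] by (auto simp: int_cobdries_def intro!: image_eqI[of _ _ "fscale c a"])
  qed
qed

lemma linear_ext_distinct: "linear_ext m L \<Longrightarrow> distinct L"
  by (metis distinct_map linear_ext_distinct_fst)

lemma wbot_neq_wtop: "n \<ge> 2 \<Longrightarrow> wbot n \<noteq> wtop n i"
  using card_wbot[of n] by (auto simp: wtop_def)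

lemma wcobdries_eq:
  "n \<ge> 2 \<Longrightarrow> wcobdries n i = cobdry (wint n i) (wle n) ` cochains (wint n i) (wle n) (int n - 4)"
  using wbot_neq_wtop[of n i] by (simp add: int_cobdries_def)

lemma unscale_in_subspace:
  assumes "fvs.subspace B" "fscale ((- 1) ^ k) v \<in> B"
  shows "v \<in> B"
proof -
  have "fscale ((- 1) ^ k) (fscale ((- 1) ^ k) v) \<in> B" by (rule fvs.subspace_scale[OF assms])
  then show ?thesis by (simp flip: power_mult_distrib)
qed

lemma cobdry_gap_in:
  assumes "perm_bracket n m" "linear_ext m (P @ x # y # Q)"
  shows "cobdry (wint n (red_brackets m)) (wle n) (basis_vec (bar (gap_chain n P x y Q))) \<in> (wcobdries n (red_brackets m) :: (('k::field) chain_vecs) set)"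
proof -
  have "n \<ge> 2" using linear_ext_length[OF assms] by simp
  have "basis_vec (bar (gap_chain n P x y Q)) \<in> cochains (wint n (red_brackets m)) (wle n) (int n - 4)"
    using cobdry_gap(1)[OF assms refl] unfolding cochains_def by (intro fvs.span_base) simp
  then show ?thesis unfolding wcobdries_eq[OF \<open>n \<ge> 2\<close>] by (rule imageI)
qed

lemma swap_in_cobdries:
  assumes "perm_bracket n m" "linear_ext m (P @ x # y # Q)" "\<not> fst x \<subseteq> fst y"
  shows "chain_vec n (P @ x # y # Q) + chain_vec n (P @ y # x # Q) \<in> (wcobdries n (red_brackets m) :: (('k::field) chain_vecs) set)"
  using cobdry_gap_in[OF assms(1,2)] unfolding cobdry_swap[OF assms]
  by (rule unscale_in_subspace[OF subspace_cobdries])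

lemma nested_in_cobdries:
  assumes m: "perm_bracket n m" "linear_ext m (P @ (A \<union> B, c) # (A \<union> B \<union> D, d) # Q)"
    and blk: "A \<in> blocks n (set P)" "B \<in> blocks n (set P)" "D \<in> blocks n (set P)"
    and ne: "A \<noteq> B" "D \<noteq> A" "D \<noteq> B"
  shows "(\<Sum>e\<in>{c, d}. let R = (A \<union> B \<union> D, if e = c then d else c) # Q in
    chain_vec n (P @ (A \<union> B, e) # R) + chain_vec n (P @ (B \<union> D, e) # R) + chain_vec n (P @ (D \<union> A, e) # R))
    \<in> (wcobdries n (red_brackets m) :: (('k::field) chain_vecs) set)"
  using cobdry_gap_in[OF m] unfolding cobdry_nested[OF assms] Let_def
  by (rule unscale_in_subspace[OF subspace_cobdries])

text \<open>The factor \<open>nsgn\<close> changes when two adjacent merges are exchanged. It turns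
  the relation that a sum of two chains is a coboundary into a congruence between signed
  chains.\<close>

definition signed_chain :: "nat \<Rightarrow> node list \<Rightarrow> (('k::field) chain_vecs)" where
  "signed_chain n L = fscale (of_int (nsgn L)) (chain_vec n L)"

lemma nsgn_swap:
  assumes "linear_ext m (P @ x # y # Q)"
  shows "nsgn (P @ y # x # Q) = - nsgn (P @ x # y # Q)"
  using linear_ext_distinct_key[OF assms] lsgn_swap_elems[of "map node_key P" "node_key x" "[]" "node_key y" "map node_key Q"]
  by (simp add: nsgn_def)

lemma signed_chain_swap:
  assumes "perm_bracket n m" "linear_ext m (P @ x # y # Q)" "\<not> fst x \<subseteq> fst y"
  shows "signed_chain n (P @ x # y # Q) - signed_chain n (P @ y # x # Q) \<in> (wcobdries n (red_brackets m) :: (('k::field) chain_vecs) set)"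
proof -
  have "(signed_chain n (P @ x # y # Q) - signed_chain n (P @ y # x # Q) :: 'k chain_vecs) =
    fscale (of_int (nsgn (P @ x # y # Q))) (chain_vec n (P @ x # y # Q) + chain_vec n (P @ y # x # Q))"
    unfolding signed_chain_def nsgn_swap[OF assms(2)] by (simp add: fvs.scale_right_distrib)
  then show ?thesis
    using fvs.subspace_scale[OF subspace_cobdries swap_in_cobdries[OF assms]] by simp
qed

lemma signed_chain_move:
  assumes "perm_bracket n m" "linear_ext m (P @ U @ x # V)" "\<forall>u\<in>set U. \<not> fst u \<subseteq> fst x"
  shows "linear_ext m (P @ x # U @ V)
    \<and> signed_chain n (P @ U @ x # V) - signed_chain n (P @ x # U @ V) \<in> (wcobdries n (red_brackets m) :: (('k::field) chain_vecs) set)"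
  using assms(2,3)
proof (induction U arbitrary: V rule: rev_induct)
  case Nil
  then show ?case using fvs.subspace_0[OF subspace_cobdries] by simp
next
  case (snoc u U)
  have le: "linear_ext m ((P @ U) @ u # x # V)" and ux: "\<not> fst u \<subseteq> fst x" using snoc.prems by simp_all
  have le': "linear_ext m (P @ U @ x # u # V)" using linear_ext_swap[OF le ux] by simp
  have "signed_chain n (P @ U @ u # x # V) - signed_chain n (P @ U @ x # u # V) \<in> (wcobdries n (red_brackets m) :: (('k::field) chain_vecs) set)"
    using signed_chain_swap[OF assms(1) le ux] by simp
  moreover have "linear_ext m (P @ x # U @ u # V) \<and>
      signed_chain n (P @ U @ x # u # V) - signed_chain n (P @ x # U @ u # V) \<in> (wcobdries n (red_brackets m) :: (('k::field) chain_vecs) set)"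
    using snoc.IH[OF le'] snoc.prems(2) by simp
  ultimately show ?case using fvs.subspace_add[OF subspace_cobdries] by fastforce
qed

text \<open>Sorting by selection: the first node \<open>x\<close> of the goal list is moved to the
  front of the other list. It passes only nodes that come after \<open>x\<close> in the goal list
  and so are not contained in it; all intermediate lists remain linear extensions.\<close>

lemma signed_chain_cong_prefix:
  assumes "perm_bracket n m" "linear_ext m (P @ Q)" "linear_ext m (P @ Q')"
  shows "signed_chain n (P @ Q) - signed_chain n (P @ Q') \<in> (wcobdries n (red_brackets m) :: (('k::field) chain_vecs) set)"
  using assms(2,3)
proof (induction Q' arbitrary: P Q)
  case Nil
  have "length (P @ Q) = length (P @ [])"
    using linear_ext_length[OF assms(1) Nil(1)] linear_ext_length[OF assms(1) Nil(2)] by (metis nat.inject)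
  then show ?case using fvs.subspace_0[OF subspace_cobdries] by simp
next
  case (Cons x Q')
  have dP: "distinct (P @ x # Q')" "set (P @ Q) = set (P @ x # Q')"
    using linear_ext_distinct[OF Cons.prems(2)] Cons.prems unfolding linear_ext_def by simp_all
  then have "x \<in> set Q" by auto
  then obtain U V where Q: "Q = U @ x # V" by (meson split_list)
  have dQ: "distinct (P @ Q)" by (rule linear_ext_distinct[OF Cons.prems(1)])
  have "set U \<subseteq> set Q'" using dP dQ Q by auto
  then have "\<forall>u\<in>set U. \<not> fst u \<subseteq> fst x"
    using Cons.prems(2) by (auto simp: linear_ext_def sorted_wrt_append)
  note move = signed_chain_move[OF assms(1) Cons.prems(1)[unfolded Q] this]
  have mv: "linear_ext m ((P @ [x]) @ U @ V)"
    "(signed_chain n (P @ Q) - signed_chain n ((P @ [x]) @ U @ V) :: 'k chain_vecs) \<in> (wcobdries n (red_brackets m) :: (('k::field) chain_vecs) set)"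
    unfolding Q append_assoc append.simps
    by (rule move[THEN conjunct1], rule move[THEN conjunct2])
  have "signed_chain n ((P @ [x]) @ U @ V) - signed_chain n ((P @ [x]) @ Q') \<in> (wcobdries n (red_brackets m) :: (('k::field) chain_vecs) set)"
    by (rule Cons.IH[OF mv(1)]) (use Cons.prems(2) in simp)
  from fvs.subspace_add[OF subspace_cobdries mv(2) this] show ?case by simp
qed

lemma signed_chain_cong:
  assumes "perm_bracket n m" "linear_ext m L" "linear_ext m L'"
  shows "signed_chain n L - signed_chain n L' \<in> (wcobdries n (red_brackets m) :: (('k::field) chain_vecs) set)"
  using signed_chain_cong_prefix[OF assms(1), of "[]" L L'] assms by simp

text \<open>The sign is the one of the theorem, expressed for bracketings. Monomials of another type
  go to 0, so that the map can be tested on an ideal that is not multilinear.\<close>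

definition lie_to_chain :: "nat \<Rightarrow> nat \<Rightarrow> (('k::field) bracket_vec) \<Rightarrow> ('k chain_vecs)" where
  "lie_to_chain n i = lin_ext (\<lambda>m. if perm_bracket n m \<and> red_brackets m = i
     then fscale (of_int (lsgn (letters m) * bsgn m)) (chain_vec n (post m)) else 0)"

lemma lie_to_chain_linear [simp]:
  "lie_to_chain n i (p + q) = lie_to_chain n i p + lie_to_chain n i q"
  "lie_to_chain n i (fscale c p) = fscale c (lie_to_chain n i p)"
  "lie_to_chain n i (p - q) = lie_to_chain n i p - lie_to_chain n i q"
  by (simp_all add: lie_to_chain_def)

lemma lie_to_chain_other: "\<not> (perm_bracket n m \<and> red_brackets m = i) \<Longrightarrow> lie_to_chain n i (basis_vec m) = 0"
  by (auto simp: lie_to_chain_def)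

lemma lie_to_chain_basis:
  assumes "perm_bracket n m"
  shows "lie_to_chain n (red_brackets m) (basis_vec m) =
    fscale (of_int (lsgn (letters m) * bsgn m)) (chain_vec n (post m))"
  using assms by (simp add: lie_to_chain_def)

text \<open>As \<open>nsgn (post m)\<close> squares to 1, the sign of the letters and of the tree
  equals \<open>osgn m * nsgn (post m)\<close>. In this form the postorder can be replaced by any
  linear extension.\<close>

lemma lie_to_chain_signed:
  assumes "perm_bracket n m"
  shows "lie_to_chain n (red_brackets m) (basis_vec m) = fscale (of_int (osgn m)) (signed_chain n (post m))"
proof -
  have "osgn m * nsgn (post m) = lsgn (letters m) * bsgn m * (nsgn (post m) * nsgn (post m))"
    by (simp only: osgn_def mult.assoc)
  then have "osgn m * nsgn (post m) = lsgn (letters m) * bsgn m" by simp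
  then show ?thesis
    unfolding lie_to_chain_basis[OF assms] signed_chain_def by (simp only: fvs.scale_scale flip: of_int_mult)
qed

lemma lie_to_chain_cong:
  assumes "perm_bracket n m" "linear_ext m L"
  shows "lie_to_chain n (red_brackets m) (basis_vec m) - fscale (of_int (osgn m)) (signed_chain n L)
    \<in> (wcobdries n (red_brackets m) :: (('k::field) chain_vecs) set)"
proof -
  have "linear_ext m (post m)" using assms(1) by (simp add: perm_bracket_def linear_ext_post)
  from fvs.subspace_scale[OF subspace_cobdries signed_chain_cong[OF assms(1) this assms(2)]]
  have "fscale (of_int (osgn m)) (signed_chain n (post m) - signed_chain n L)
    \<in> (wcobdries n (red_brackets m) :: (('k::field) chain_vecs) set)" .
  then show ?thesis by (simp add: lie_to_chain_signed[OF assms(1)] fvs.scale_right_diff_distrib)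
qed

text \<open>\<open>merge_sgn\<close> only sees the sets of letters and nodes of a child, and these
  stay the same when children are swapped deeper down.\<close>

lemma osgn_fill_antisym:
  assumes "distinct (letters (fill K (Bracket c s t)))"
  shows "osgn (fill K (Bracket c t s)) = - osgn (fill K (Bracket c s t))"
  using assms
proof (induction K)
  case Hole
  then show ?case by (simp add: osgn_antisym)
next
  case (CtxL c' K u)
  have d: "distinct (letters (Bracket c' (fill K (Bracket c s t)) u))"
    "distinct (letters (Bracket c' (fill K (Bracket c t s)) u))"
    using CtxL.prems by (auto simp: letters_fill)
  have IH: "osgn (fill K (Bracket c t s)) = - osgn (fill K (Bracket c s t))"
    using CtxL.IH d(1) by (simp del: post.simps)
  have "set (letters (fill K (Bracket c t s))) = set (letters (fill K (Bracket c s t)))"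
    by (auto simp: letters_fill)
  moreover have "set (post (fill K (Bracket c t s))) = set (post (fill K (Bracket c s t)))"
    by (simp add: post_fill Un_commute Un_left_commute Un_assoc)
  ultimately show ?case unfolding fill.simps osgn_Bracket[OF d(1)] osgn_Bracket[OF d(2)] IH by simp
next
  case (CtxR c' u K)
  have d: "distinct (letters (Bracket c' u (fill K (Bracket c s t))))"
    "distinct (letters (Bracket c' u (fill K (Bracket c t s))))"
    using CtxR.prems by (auto simp: letters_fill)
  have IH: "osgn (fill K (Bracket c t s)) = - osgn (fill K (Bracket c s t))"
    using CtxR.IH d(1) by (simp del: post.simps)
  have "set (letters (fill K (Bracket c t s))) = set (letters (fill K (Bracket c s t)))"
    by (auto simp: letters_fill)
  moreover have "set (post (fill K (Bracket c t s))) = set (post (fill K (Bracket c s t)))"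
    by (simp add: post_fill Un_commute Un_left_commute Un_assoc)
  ultimately show ?case unfolding fill.simps osgn_Bracket[OF d(1)] osgn_Bracket[OF d(2)] IH by simp
qed

text \<open>The context contributes a factor that depends only on the number of nodes in the hole;
  comparing two fillings crosswise avoids naming it.\<close>

lemma bsgn_fill:
  assumes "length (post g) = length (post g')"
  shows "bsgn (fill K g) * bsgn g' = bsgn (fill K g') * bsgn g"
proof (induction K)
  case (CtxL c K t)
  then show ?case by simp
next
  case (CtxR c s K)
  have "length (post (fill K g)) = length (post (fill K g'))"
  proof -
    have "length (ctx_suf K S) = length (ctx_suf K S')" for S S' by (induction K) simp_all
    then show ?thesis using assms by (simp add: post_fill)
  qed
  with CtxR show ?case by simp
qed simp

lemma remove_elem_eq:
  assumes "distinct (u @ x # v)" "distinct (u' @ x # v')" "set (u @ x # v) = set (u' @ x # v')"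
  shows "set u \<union> set v = set u' \<union> set v'"
proof -
  have "set u \<union> set v = set (u @ x # v) - {x}" using assms(1) by auto
  also have "\<dots> = set u' \<union> set v'" unfolding assms(3) using assms(2) by auto
  finally show ?thesis .
qed

text \<open>Passing from \<open>r (s t)\<close> to \<open>s (t r)\<close> replaces only the inner
  node as a set, and the new one fits into the same place between \<open>P\<close> and
  \<open>Q\<close>. The new colors are arbitrary, because containment does not see them.\<close>

lemma linear_ext_rotate:
  assumes m: "perm_bracket n (fill K (Bracket d r (Bracket c s t)))"
    and le: "linear_ext (fill K (Bracket d r (Bracket c s t)))
      (P @ (lset s \<union> lset t, c) # (lset s \<union> lset t \<union> lset r, d) # Q)"
  shows "perm_bracket n (fill K (Bracket d' s (Bracket c' t r)))"
    and "linear_ext (fill K (Bracket d' s (Bracket c' t r)))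
      (P @ (lset t \<union> lset r, c') # (lset t \<union> lset r \<union> lset s, d') # Q)"
proof -
  let ?g = "Bracket d r (Bracket c s t)" and ?g' = "Bracket d' s (Bracket c' t r)"
  let ?m = "fill K ?g" and ?m' = "fill K ?g'"
  let ?Y = "lset s \<union> lset t \<union> lset r"
  let ?x = "(lset s \<union> lset t, c)" and ?y = "(?Y, d)"
  let ?x' = "(lset t \<union> lset r, c')" and ?y' = "(lset t \<union> lset r \<union> lset s, d')"
  show m': "perm_bracket n ?m'" using m by (auto simp: perm_bracket_def letters_fill)
  have dis: "lset s \<inter> lset t = {}" "lset t \<inter> lset r = {}"
    "lset s \<inter> lset r = {}"
    using m by (auto simp: perm_bracket_def letters_fill)
  have Y: "lset t \<union> lset r \<union> lset s = ?Y"
    "lset s \<union> (lset t \<union> lset r) = ?Y"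
    "lset r \<union> (lset s \<union> lset t) = ?Y" by auto
  have lg: "lset ?g = ?Y" "lset ?g' = ?Y" by auto
  let ?R = "ctx_pre K @ post r @ post s @ post t" and ?S = "ctx_suf K ?Y"
  have pm: "post ?m = ?R @ ?x # ?y # ?S" unfolding post_fill lg by (simp add: Y)
  have pm': "set (post ?m') = set ?R \<union> {?x', ?y'} \<union> set ?S" unfolding post_fill lg by (auto simp: Y)
  have "distinct (?R @ ?x # ?y # ?S)" unfolding pm[symmetric]
    using distinct_fst_post m by (simp add: perm_bracket_def distinct_map)
  moreover have "distinct (P @ ?x # ?y # Q)" by (rule linear_ext_distinct[OF le])
  moreover have "set (P @ ?x # ?y # Q) = set (?R @ ?x # ?y # ?S)" using le unfolding linear_ext_def pm by (rule conjunct1)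
  ultimately have PQ: "set P \<union> set Q = set ?R \<union> set ?S"
  proof -
    assume d: "distinct (?R @ ?x # ?y # ?S)" "distinct (P @ ?x # ?y # Q)"
      and e: "set (P @ ?x # ?y # Q) = set (?R @ ?x # ?y # ?S)"
    have "set P \<union> set (?y # Q) = set ?R \<union> set (?y # ?S)" by (rule remove_elem_eq[OF d(2,1) e])
    then have "set (P @ ?y # Q) = set (?R @ ?y # ?S)" by (simp only: set_append)
    moreover have "distinct (P @ ?y # Q)" "distinct (?R @ ?y # ?S)"
      using d unfolding distinct_append distinct.simps by auto
    ultimately show "set P \<union> set Q = set ?R \<union> set ?S" by (metis remove_elem_eq)
  qed
  have so: "sorted_wrt (\<lambda>x y. \<not> fst y \<subseteq> fst x) (P @ ?x # ?y # Q)" using le by (simp add: linear_ext_def)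
  have soY: "\<forall>p\<in>set P. \<not> ?Y \<subseteq> fst p" "\<forall>q\<in>set Q. \<not> fst q \<subseteq> ?Y"
    and soX: "\<forall>p\<in>set P. \<not> fst ?x \<subseteq> fst p"
    using so by (auto simp: sorted_wrt_append)
  \<comment> \<open>By laminarity a node above both \<open>t\<close> and \<open>r\<close> contains
    \<open>?Y\<close>, and no node of \<open>P\<close> does.\<close>
  have P': "\<not> fst ?x' \<subseteq> fst p" if p: "p \<in> set P" for p
  proof
    assume sub: "fst ?x' \<subseteq> fst p"
    have subs: "lset t \<subseteq> fst p" "lset r \<subseteq> fst p" using sub by auto
    have ne: "lset t \<noteq> {}" by simp
    have dm: "distinct (letters ?m)" using m by (simp add: perm_bracket_def)
    have "p \<in> set (post ?m)" using le p unfolding linear_ext_def by auto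
    with dm show False
    proof (rule fill_nodes_cases)
      assume "lset ?g \<subseteq> fst p"
      then show False using soY(1) p unfolding lg by blast
    next
      assume "fst p \<inter> lset ?g = {}"
      then have "fst p \<inter> lset t = {}" unfolding lg Int_Un_distrib by simp
      then show False using ne Int_absorb1[OF subs(1)] by simp
    next
      assume "p \<in> set (post ?g)"
      then have "p \<in> set (post r) \<or> p \<in> set (post s) \<or> p \<in> set (post t) \<or> fst p = fst ?x \<or> fst p = ?Y"
        by (auto simp: Y)
      then show False
      proof (elim disjE)
        assume "p \<in> set (post r)"
        then have "fst p \<subseteq> lset r" using post_subset[of "fst p" "snd p" r] by simp
        then have "lset t \<subseteq> lset r" using subs(1) by (rule order_trans[rotated])
        then show False using letters_not_subset(1)[OF dis(2)] by simp
      next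
        assume "p \<in> set (post s)"
        then have "fst p \<subseteq> lset s" using post_subset[of "fst p" "snd p" s] by simp
        then have "lset t \<subseteq> lset s" using subs(1) by (rule order_trans[rotated])
        then show False using letters_not_subset(2)[OF dis(1)] by simp
      next
        assume "p \<in> set (post t)"
        then have "fst p \<subseteq> lset t" using post_subset[of "fst p" "snd p" t] by simp
        then have "lset r \<subseteq> lset t" using subs(2) by (rule order_trans[rotated])
        then show False using letters_not_subset(2)[OF dis(2)] by simp
      next
        assume "fst p = fst ?x"
        then show False using soX p by blast
      next
        assume "fst p = ?Y"
        then show False using soY(1) p by blast
      qed
    qed
  qed
  have Q': "\<not> fst q \<subseteq> fst ?x'" if "q \<in> set Q" for q
  proof
    assume "fst q \<subseteq> fst ?x'"
    then have "fst q \<subseteq> ?Y" by auto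
    then show False using soY(2) that by blast
  qed
  have xy: "\<not> fst ?y' \<subseteq> fst ?x'"
  proof
    assume "fst ?y' \<subseteq> fst ?x'"
    then have "lset s \<subseteq> lset t \<union> lset r" by auto
    then have "lset s \<inter> (lset t \<union> lset r) = lset s" by (rule Int_absorb2)
    then have "lset s = {}" using dis unfolding Int_Un_distrib by simp
    then show False by simp
  qed
  have "set (P @ ?x' # ?y' # Q) = set (post ?m')" unfolding pm' using PQ by auto
  moreover have "sorted_wrt (\<lambda>x y. \<not> fst y \<subseteq> fst x) (P @ ?x' # ?y' # Q)"
    using so P' Q' xy soY unfolding sorted_wrt_append sorted_wrt.simps set_append list.set ball_Un
    by (auto simp: Y simp del: Un_subset_iff)
  ultimately show "linear_ext ?m' (P @ ?x' # ?y' # Q)" by (simp add: linear_ext_def)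
qed

text \<open>All terms of a Jacobi relation carry the same sign. Once the inner nodes are removed by
  \<open>lsgn_replace\<close>, the rotation moves one block of letters and one block of nodes. If
  \<open>r\<close>, \<open>s\<close>, \<open>t\<close> have \<open>p\<close>, \<open>q\<close>,
  \<open>k\<close> nodes, the exponents are \<open>(p + 1) * (q + k + 2)\<close> for the letters,
  \<open>q + k\<close> for the trees and \<open>p * (q + k)\<close> for the nodes; their sum is
  even.\<close>

lemma osgn_rotate:
  assumes m: "perm_bracket n (fill K (Bracket d r (Bracket c s t)))"
    and le: "linear_ext (fill K (Bracket d r (Bracket c s t)))
      (P @ (lset s \<union> lset t, c) # (lset s \<union> lset t \<union> lset r, d) # Q)"
  shows "osgn (fill K (Bracket d' s (Bracket c' t r))) * nsgn
      (P @ (lset t \<union> lset r, c') # (lset t \<union> lset r \<union> lset s, d') # Q)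
    = osgn (fill K (Bracket d r (Bracket c s t))) * nsgn
      (P @ (lset s \<union> lset t, c) # (lset s \<union> lset t \<union> lset r, d) # Q)"
proof -
  let ?g = "Bracket d r (Bracket c s t)" and ?g' = "Bracket d' s (Bracket c' t r)"
  let ?m = "fill K ?g" and ?m' = "fill K ?g'"
  let ?Y = "lset s \<union> lset t \<union> lset r"
  let ?x = "(lset s \<union> lset t, c)" and ?y = "(?Y, d)"
  let ?x' = "(lset t \<union> lset r, c')" and ?y' = "(lset t \<union> lset r \<union> lset s, d')"
  let ?k = "map node_key"
  note m' = linear_ext_rotate[OF m le, of d' c']
  have d: "distinct (letters ?m)" "distinct (letters ?m')" using m m'(1) by (simp_all add: perm_bracket_def)
  have Y: "lset t \<union> lset r \<union> lset s = ?Y"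
    "lset s \<union> (lset t \<union> lset r) = ?Y"
    "lset r \<union> (lset s \<union> lset t) = ?Y" by auto
  have lg: "lset ?g = ?Y" "lset ?g' = ?Y" by auto
  have ky: "node_key ?y' = node_key ?y" "node_key (?Y, d') = node_key ?y" by (simp_all add: node_key_def Y)
  let ?a = "?k (ctx_pre K)" and ?z = "node_key ?y # ?k (ctx_suf K ?Y)"
  have pm: "?k (post ?m) = (?a @ ?k (post r) @ ?k (post s) @ ?k (post t)) @ node_key ?x # ?z"
    unfolding post_fill lg by (simp add: Y)
  have pm': "?k (post ?m') = (?a @ ?k (post s) @ ?k (post t) @ ?k (post r)) @ node_key ?x' # ?z"
    unfolding post_fill lg by (simp add: Y ky)
  have kL: "?k (P @ ?x # ?y # Q) = ?k P @ node_key ?x # node_key ?y # ?k Q"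
    "?k (P @ ?x' # ?y' # Q) = ?k P @ node_key ?x' # node_key ?y # ?k Q" by (simp_all add: ky)
  have dp: "distinct (?k (post ?m))" "distinct (?k (post ?m'))" using distinct_key_post d by blast+
  have dL: "distinct (?k (P @ ?x # ?y # Q))" "distinct (?k (P @ ?x' # ?y' # Q))"
    using linear_ext_distinct_key le m'(2) by blast+
  have sets: "set (?k (post ?m)) = set (?k (P @ ?x # ?y # Q))" "set (?k (post ?m')) = set (?k (P @ ?x' # ?y' # Q))"
    using le m'(2) by (simp_all only: linear_ext_def set_map)
  let ?l = "(- 1 :: int) ^ (length (post r) + length (post s) + length (post t) + length (ctx_pre K) + length P)"
  have n1: "nsgn (post ?m) * nsgn (P @ ?x # ?y # Q) = ?l *
      (lsgn ((?a @ ?k (post r) @ ?k (post s) @ ?k (post t)) @ ?z) * lsgn (?k P @ node_key ?y # ?k Q))"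
    unfolding nsgn_def pm kL
    using lsgn_replace[OF dp(1)[unfolded pm] dL(1)[unfolded kL(1)] remove_elem_eq[OF dp(1)[unfolded pm] dL(1)[unfolded kL(1)] sets(1)[unfolded pm kL(1)]]]
    by (simp add: add_ac)
  have n2: "nsgn (post ?m') * nsgn (P @ ?x' # ?y' # Q) = ?l *
      (lsgn ((?a @ ?k (post s) @ ?k (post t) @ ?k (post r)) @ ?z) * lsgn (?k P @ node_key ?y # ?k Q))"
    unfolding nsgn_def pm' kL
    using lsgn_replace[OF dp(2)[unfolded pm'] dL(2)[unfolded kL(2)] remove_elem_eq[OF dp(2)[unfolded pm'] dL(2)[unfolded kL(2)] sets(2)[unfolded pm' kL(2)]]]
    by (simp add: add_ac)
  have n3: "lsgn ((?a @ ?k (post r) @ ?k (post s) @ ?k (post t)) @ ?z) =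
      (- 1) ^ (length (post r) * (length (post s) + length (post t))) *
      lsgn ((?a @ ?k (post s) @ ?k (post t) @ ?k (post r)) @ ?z)"
    using lsgn_swap_blocks[of ?a "?k (post r)" "?k (post s) @ ?k (post t)" ?z] dp(1)[unfolded pm] by simp
  have n4: "lsgn (letters ?m) = (- 1) ^ (length (letters r) * (length (letters s) + length (letters t))) * lsgn (letters ?m')"
    using lsgn_swap_blocks[of "lets_before K" "letters r" "letters s @ letters t" "lets_after K"] d(1)
    by (simp add: letters_fill)
  have "length (post ?g) = length (post ?g')" by simp
  from bsgn_fill[OF this, of K] have n5: "bsgn ?m * bsgn ?g' = bsgn ?m' * bsgn ?g" .
  have b: "bsgn ?m = bsgn ?m' * (bsgn ?g * bsgn ?g')"
  proof -
    have "bsgn ?m = (bsgn ?m * bsgn ?g') * bsgn ?g'" by (simp only: mult.assoc bsgn_square mult_1_right)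
    then show ?thesis unfolding n5 by (simp only: mult.assoc)
  qed
  have gg: "bsgn ?g * bsgn ?g' = (- 1) ^ (length (post s) + length (post t))"
  proof -
    have "bsgn ?g * bsgn ?g' = ((- 1) ^ length (post (Bracket c s t)) * (- 1) ^ length (post t)
        * (- 1) ^ length (post (Bracket c' t r)) * (- 1) ^ length (post r))
      * ((bsgn r * bsgn r) * (bsgn s * bsgn s) * (bsgn t * bsgn t))"
      by (simp only: bsgn.simps mult_ac)
    also have "(- 1 :: int) ^ length (post (Bracket c s t)) * (- 1) ^ length (post t)
        * (- 1) ^ length (post (Bracket c' t r)) * (- 1) ^ length (post r)
      = (- 1) ^ (length (post s) + length (post t))"
      by (simp add: minus_one_power_iff)
    finally show ?thesis by (simp only: bsgn_square mult_1_right)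
  qed
  have e: "(- 1 :: int) ^ (length (letters r) * (length (letters s) + length (letters t)))
      * (- 1) ^ (length (post s) + length (post t)) * (- 1) ^ (length (post r) * (length (post s) + length (post t))) = 1"
    unfolding length_post[symmetric] by (auto simp: minus_one_power_iff)
  have "osgn ?m * nsgn (P @ ?x # ?y # Q) = lsgn (letters ?m) * bsgn ?m * (nsgn (post ?m) * nsgn (P @ ?x # ?y # Q))"
    by (simp only: osgn_def mult.assoc)
  also have "\<dots> = ((- 1) ^ (length (letters r) * (length (letters s) + length (letters t)))
      * (- 1) ^ (length (post s) + length (post t)) * (- 1) ^ (length (post r) * (length (post s) + length (post t))))
      * (lsgn (letters ?m') * bsgn ?m' * (nsgn (post ?m') * nsgn (P @ ?x' # ?y' # Q)))"
    unfolding n1 n2 n3 n4 b gg by (simp only: mult_ac)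
  also have "\<dots> = osgn ?m' * nsgn (P @ ?x' # ?y' # Q)"
    unfolding e by (simp only: osgn_def mult.assoc mult_1_left)
  finally show ?thesis by (rule sym)
qed

section \<open>From chains to brackets\<close>

definition triple :: "nat ctx \<Rightarrow> color \<Rightarrow> nat bracketing \<Rightarrow> color \<Rightarrow> nat bracketing \<Rightarrow> nat bracketing \<Rightarrow> nat bracketing" where
  "triple K d r c s t = fill K (Bracket d r (Bracket c s t))"

definition triple_nodes :: "node list \<Rightarrow> node list \<Rightarrow> color \<Rightarrow> nat bracketing \<Rightarrow> color
    \<Rightarrow> nat bracketing \<Rightarrow> nat bracketing \<Rightarrow> node list" where
  "triple_nodes P Q d r c s t = P @ (lset s \<union> lset t, c)
     # (lset s \<union> lset t \<union> lset r, d) # Q"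

text \<open>The lists \<open>P\<close> and \<open>Q\<close>, the context and the sign
  \<open>\<epsilon>\<close> are shared by all terms of a relation; only the roles of the three
  bracketings and the two colors vary. By \<open>triple_ok_rotate\<close> one term entails the
  others.\<close>

definition triple_ok :: "nat \<Rightarrow> node list \<Rightarrow> node list \<Rightarrow> nat ctx \<Rightarrow> int \<Rightarrow> color \<Rightarrow> nat bracketing
    \<Rightarrow> color \<Rightarrow> nat bracketing \<Rightarrow> nat bracketing \<Rightarrow> bool" where
  "triple_ok n P Q K \<epsilon> d r c s t \<longleftrightarrow> perm_bracket n (triple K d r c s t)
     \<and> linear_ext (triple K d r c s t) (triple_nodes P Q d r c s t)
     \<and> osgn (triple K d r c s t) * nsgn (triple_nodes P Q d r c s t) = \<epsilon>"

lemma triple_ok_rotate: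
  "triple_ok n P Q K \<epsilon> d r c s t \<Longrightarrow> triple_ok n P Q K \<epsilon> d' s c' t r"
  unfolding triple_ok_def triple_def triple_nodes_def
  using linear_ext_rotate[of n K d r c s t P Q d' c'] osgn_rotate[of n K d r c s t P Q d' c'] by metis

lemma red_fill: "red_brackets (fill K g) + red_brackets g' = red_brackets (fill K g') + red_brackets g"
  by (induction K) simp_all

lemma red_triple:
  "red_brackets (triple K d s c t r) = red_brackets (triple K d r c s t)"
  "red_brackets (triple K c r d s t) = red_brackets (triple K d r c s t)"
  unfolding triple_def
  using red_fill[of K "Bracket d s (Bracket c t r)" "Bracket d r (Bracket c s t)"]
    red_fill[of K "Bracket c r (Bracket d s t)" "Bracket d r (Bracket c s t)"] by simp_all

text \<open>The Jacobi expression if \<open>c = d\<close> and the mixed one otherwise. With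
  \<open>f\<close> as a parameter the same sum is formed over monomials, over chains and over their
  images.\<close>

definition triple_sum :: "(color \<Rightarrow> nat bracketing \<Rightarrow> color \<Rightarrow> nat bracketing \<Rightarrow> nat bracketing \<Rightarrow> 'v)
    \<Rightarrow> color \<Rightarrow> nat bracketing \<Rightarrow> color \<Rightarrow> nat bracketing \<Rightarrow> nat bracketing \<Rightarrow> 'v::comm_monoid_add" where
  "triple_sum f d r c s t = (\<Sum>e\<in>{c, d}. let o' = if e = c then d else c in
     f o' r e s t + f o' s e t r + f o' t e r s)"

lemma triple_sum_same: "triple_sum f c r c s t = f c r c s t + f c s c t r + f c t c r s"
  by (simp add: triple_sum_def)

lemma triple_sum_mixed:
  "triple_sum f Blue r Red s t = f Blue r Red s t + f Blue s Red t r + f Blue t Red r s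
     + (f Red r Blue s t + f Red s Blue t r + f Red t Blue r s)"
  by (simp add: triple_sum_def)

text \<open>Transports a relation between chains and monomials in either direction. The congruence
  is only required of terms with the same \<open>\<epsilon>\<close> and the same number of red
  brackets, both of which are kept by rotation and exchange of colors.\<close>

lemma triple_sum_congruent:
  fixes f g :: "color \<Rightarrow> nat bracketing \<Rightarrow> color \<Rightarrow> nat bracketing \<Rightarrow> nat bracketing \<Rightarrow> ('x \<Rightarrow>\<^sub>0 'k::field)"
  assumes W: "fvs.subspace W" and ok: "triple_ok n P Q K \<epsilon> d r c s t"
    and fg: "\<And>d' r' c' s' t'. triple_ok n P Q K \<epsilon> d' r' c' s' t' \<Longrightarrow>
      red_brackets (triple K d' r' c' s' t') = red_brackets (triple K d r c s t) \<Longrightarrow>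
      f d' r' c' s' t' - g d' r' c' s' t' \<in> W"
    and f: "triple_sum f d r c s t \<in> W"
  shows "triple_sum g d r c s t \<in> W"
proof -
  have *: "(let o' = if e = c then d else c in f o' r e s t + f o' s e t r + f o' t e r s)
      - (let o' = if e = c then d else c in g o' r e s t + g o' s e t r + g o' t e r s) \<in> W"
    if e: "e \<in> {c, d}" for e
  proof -
    let ?o = "if e = c then d else c"
    have k: "triple_ok n P Q K \<epsilon> ?o r e s t" "triple_ok n P Q K \<epsilon> ?o s e t r" "triple_ok n P Q K \<epsilon> ?o t e r s"
      using ok by (blast intro: triple_ok_rotate)+
    have r: "red_brackets (triple K ?o r e s t) = red_brackets (triple K d r c s t)"
      using e red_triple(2)[of K c r d s t] by auto
    have r': "red_brackets (triple K ?o s e t r) = red_brackets (triple K d r c s t)"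
      "red_brackets (triple K ?o t e r s) = red_brackets (triple K d r c s t)"
      using r red_triple(1) by metis+
    have "(f ?o r e s t - g ?o r e s t) + (f ?o s e t r - g ?o s e t r) + (f ?o t e r s - g ?o t e r s) \<in> W"
      by (intro fvs.subspace_add[OF W] fg k r r')
    moreover have "(f ?o r e s t - g ?o r e s t) + (f ?o s e t r - g ?o s e t r) + (f ?o t e r s - g ?o t e r s)
      = (f ?o r e s t + f ?o s e t r + f ?o t e r s) - (g ?o r e s t + g ?o s e t r + g ?o t e r s)"
      by (simp add: algebra_simps)
    ultimately show ?thesis unfolding Let_def by simp
  qed
  have "triple_sum f d r c s t - triple_sum g d r c s t \<in> W"
    unfolding triple_sum_def sum_subtractf[symmetric] by (rule fvs.subspace_sum[OF W *])
  then have "triple_sum f d r c s t - (triple_sum f d r c s t - triple_sum g d r c s t) \<in> W"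
    by (rule fvs.subspace_diff[OF W f])
  then show ?thesis by simp
qed

lemma triple_sum_scale: "triple_sum (\<lambda>d r c s t. fscale a (f d r c s t)) d r c s t = fscale a (triple_sum f d r c s t)"
  by (simp add: triple_sum_def fvs.scale_sum_right fvs.scale_right_distrib Let_def)

text \<open>\<open>s\<close> and \<open>t\<close> are blocks before the inner merge by
  \<open>child_block\<close>. For \<open>r\<close> the same lemma at the outer merge gives a block
  after the inner one, and it is not the block just formed.\<close>

lemma triple_blocks:
  assumes "triple_ok n P Q K \<epsilon> d r c s t"
  shows "lset s \<in> blocks n (set P)" "lset t \<in> blocks n (set P)" "lset r \<in> blocks n (set P)"
    and "lset s \<noteq> lset t" "lset r \<noteq> lset s" "lset r \<noteq> lset t"
proof -
  let ?x = "(lset s \<union> lset t, c)"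
  let ?y = "(lset s \<union> lset t \<union> lset r, d)"
  have m: "perm_bracket n (triple K d r c s t)" and le: "linear_ext (triple K d r c s t) (P @ ?x # ?y # Q)"
    using assms by (simp_all add: triple_ok_def triple_nodes_def)
  have eq: "triple K d r c s t = fill (comp_ctx K (CtxR d r Hole)) (Bracket c s t)"
    by (simp add: triple_def fill_comp_ctx)
  show st: "lset s \<in> blocks n (set P)" "lset t \<in> blocks n (set P)"
    using child_block[OF m[unfolded eq] le[unfolded eq]] by blast+
  have D: "lset s \<inter> lset t = {}" "lset r \<inter> lset s = {}" "lset r \<inter> lset t = {}"
    using m by (auto simp: perm_bracket_def triple_def letters_fill)
  show ne: "lset s \<noteq> lset t" "lset r \<noteq> lset s" "lset r \<noteq> lset t"
    using D(1)[THEN letters_not_subset(1)] D(2)[THEN letters_not_subset(1)] D(3)[THEN letters_not_subset(1)] by simp_all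
  have y: "(lset r \<union> set (letters (Bracket c s t)), d) = ?y" by auto
  have "linear_ext (fill K (Bracket d r (Bracket c s t))) ((P @ [?x]) @ (lset r \<union> set (letters (Bracket c s t)), d) # Q)"
    using le unfolding y triple_def by simp
  from child_block(1)[OF m[unfolded triple_def] this] have "lset r \<in> blocks n (insert ?x (set P))" by simp
  moreover have "good_forest n (set P)" by (rule good_prefix[OF m le])
  ultimately have "lset r \<in> insert (lset s \<union> lset t) (blocks n (set P) - {lset s, lset t})"
    using blocks_insert[OF _ st ne(1)] by simp
  moreover have "lset r \<noteq> lset s \<union> lset t"
    using letters_not_subset(2)[OF D(2)] by auto
  ultimately show "lset r \<in> blocks n (set P)" by simp
qed

lemma Un_rotate: "A \<union> B \<union> C = C \<union> A \<union> B"
  by blast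

lemma triple_nodes_rotate:
  "triple_nodes P Q d s c t r = P @ (lset t \<union> lset r, c)
     # (lset s \<union> lset t \<union> lset r, d) # Q"
  "triple_nodes P Q d t c r s = P @ (lset r \<union> lset s, c)
     # (lset s \<union> lset t \<union> lset r, d) # Q"
  unfolding triple_nodes_def by (metis Un_rotate)+

lemma triple_chain_eq:
  "triple_sum (\<lambda>d r c s t. chain_vec n (triple_nodes P Q d r c s t)) d r c s t =
   (\<Sum>e\<in>{c, d}. let R = (lset s \<union> lset t \<union> lset r, if e = c then d else c) # Q in
    chain_vec n (P @ (lset s \<union> lset t, e) # R) + chain_vec n (P @ (lset t \<union> lset r, e) # R)
    + chain_vec n (P @ (lset r \<union> lset s, e) # R))"
  unfolding triple_sum_def Let_def triple_nodes_rotate[where r = r and s = s and t = t]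
  unfolding triple_nodes_def ..

lemma triple_chain_in_cobdries:
  assumes "triple_ok n P Q K \<epsilon> d r c s t"
  shows "triple_sum (\<lambda>d r c s t. chain_vec n (triple_nodes P Q d r c s t)) d r c s t
    \<in> (wcobdries n (red_brackets (triple K d r c s t)) :: (('k::field) chain_vecs) set)"
proof -
  have "perm_bracket n (triple K d r c s t)"
    "linear_ext (triple K d r c s t) (P @ (lset s \<union> lset t, c)
     # (lset s \<union> lset t \<union> lset r, d) # Q)"
    using assms by (simp_all add: triple_ok_def triple_nodes_def)
  from nested_in_cobdries[OF this triple_blocks[OF assms]] show ?thesis unfolding triple_chain_eq .
qed

lemma triple_lie_to_chain:
  assumes "triple_ok n P Q K \<epsilon> d r c s t"
  shows "fscale (of_int \<epsilon>) (chain_vec n (triple_nodes P Q d r c s t))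
      - lie_to_chain n (red_brackets (triple K d r c s t)) (basis_vec (triple K d r c s t))
    \<in> (wcobdries n (red_brackets (triple K d r c s t)) :: (('k::field) chain_vecs) set)"
proof -
  let ?m = "triple K d r c s t" and ?L = "triple_nodes P Q d r c s t"
  have m: "perm_bracket n ?m" "linear_ext ?m ?L" and \<epsilon>: "\<epsilon> = osgn ?m * nsgn ?L"
    using assms by (simp_all add: triple_ok_def)
  have "fscale (- 1) (lie_to_chain n (red_brackets ?m) (basis_vec ?m) - fscale (of_int (osgn ?m)) (signed_chain n ?L))
    \<in> (wcobdries n (red_brackets ?m) :: (('k::field) chain_vecs) set)"
    by (rule fvs.subspace_scale[OF subspace_cobdries lie_to_chain_cong[OF m]])
  then show ?thesis by (simp add: \<epsilon> signed_chain_def)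
qed

lemma triple_relation:
  assumes "triple_ok n P Q K \<epsilon> d r c s t"
  shows "triple_sum (\<lambda>d' r' c' s' t'. lie_to_chain n (red_brackets (triple K d r c s t)) (basis_vec (triple K d' r' c' s' t'))) d r c s t
    \<in> (wcobdries n (red_brackets (triple K d r c s t)) :: (('k::field) chain_vecs) set)"
proof (rule triple_sum_congruent[OF subspace_cobdries assms])
  show "triple_sum (\<lambda>d r c s t. fscale (of_int \<epsilon>) (chain_vec n (triple_nodes P Q d r c s t))) d r c s t
    \<in> (wcobdries n (red_brackets (triple K d r c s t)) :: (('k::field) chain_vecs) set)"
    unfolding triple_sum_scale by (rule fvs.subspace_scale[OF subspace_cobdries triple_chain_in_cobdries[OF assms]])
next
  fix d' r' c' s' t'
  assume "triple_ok n P Q K \<epsilon> d' r' c' s' t'"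
    "red_brackets (triple K d' r' c' s' t') = red_brackets (triple K d r c s t)"
  then show "fscale (of_int \<epsilon>) (chain_vec n (triple_nodes P Q d' r' c' s' t'))
      - lie_to_chain n (red_brackets (triple K d r c s t)) (basis_vec (triple K d' r' c' s' t'))
    \<in> (wcobdries n (red_brackets (triple K d r c s t)) :: (('k::field) chain_vecs) set)"
    using triple_lie_to_chain by metis
qed

text \<open>The inner bracket is the right child, so the inner and the outer node are adjacent in
  postorder. This is why triples have the form \<open>r (s t)\<close>.\<close>

lemma triple_ok_post:
  assumes "perm_bracket n (triple K d r c s t)"
  obtains P Q \<epsilon> where "triple_ok n P Q K \<epsilon> d r c s t"
proof -
  let ?m = "triple K d r c s t"
  let ?P = "ctx_pre K @ post r @ post s @ post t" and ?Q = "ctx_suf K (set (letters (Bracket d r (Bracket c s t))))"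
  have Y: "lset r \<union> (lset s \<union> lset t) = lset s \<union> lset t \<union> lset r" by auto
  have "triple_nodes ?P ?Q d r c s t = post ?m"
    unfolding triple_def post_fill triple_nodes_def by (simp add: Y)
  then have "triple_ok n ?P ?Q K (osgn ?m * nsgn (triple_nodes ?P ?Q d r c s t)) d r c s t"
    using assms linear_ext_post[of ?m] by (simp add: triple_ok_def perm_bracket_def)
  then show thesis by (rule that)
qed

lemma perm_triple:
  "perm_bracket n (triple K d' s c' t r) \<longleftrightarrow> perm_bracket n (triple K d r c s t)"
  by (auto simp: perm_bracket_def triple_def letters_fill)

text \<open>Rotation and exchange of colors keep the letters and the number of red brackets, so the
  terms are either all of the right type or all sent to 0.\<close>

lemma triple_relation':
  "triple_sum (\<lambda>d r c s t. lie_to_chain n i (basis_vec (triple K d r c s t))) d r c s t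
    \<in> (wcobdries n i :: (('k::field) chain_vecs) set)"
proof (cases "perm_bracket n (triple K d r c s t) \<and> red_brackets (triple K d r c s t) = i")
  case True
  then obtain P Q \<epsilon> where "triple_ok n P Q K \<epsilon> d r c s t" using triple_ok_post by blast
  from triple_relation[OF this] True show ?thesis by simp
next
  case False
  have "(let o' = if e = c then d else c in lie_to_chain n i (basis_vec (triple K o' r e s t))
      + lie_to_chain n i (basis_vec (triple K o' s e t r)) + lie_to_chain n i (basis_vec (triple K o' t e r s)))
      = (0 :: 'k chain_vecs)" if e: "e \<in> {c, d}" for e
  proof -
    let ?o = "if e = c then d else c"
    have p: "perm_bracket n (triple K ?o r e s t) \<longleftrightarrow> perm_bracket n (triple K d r c s t)"
      "perm_bracket n (triple K ?o s e t r) \<longleftrightarrow> perm_bracket n (triple K d r c s t)"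
      "perm_bracket n (triple K ?o t e r s) \<longleftrightarrow> perm_bracket n (triple K d r c s t)"
      using perm_triple by metis+
    have r: "red_brackets (triple K ?o r e s t) = red_brackets (triple K d r c s t)"
      using e red_triple(2)[of K c r d s t] by auto
    have r': "red_brackets (triple K ?o s e t r) = red_brackets (triple K d r c s t)"
      "red_brackets (triple K ?o t e r s) = red_brackets (triple K d r c s t)"
      using r red_triple(1) by metis+
    have "lie_to_chain n i (basis_vec (triple K ?o r e s t)) = (0 :: 'k chain_vecs)"
      by (rule lie_to_chain_other) (unfold p r, rule False)
    moreover have "lie_to_chain n i (basis_vec (triple K ?o s e t r)) = (0 :: 'k chain_vecs)"
      by (rule lie_to_chain_other) (unfold p r', rule False)
    moreover have "lie_to_chain n i (basis_vec (triple K ?o t e r s)) = (0 :: 'k chain_vecs)"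
      by (rule lie_to_chain_other) (unfold p r', rule False)
    ultimately show ?thesis by (simp add: Let_def)
  qed
  then have "triple_sum (\<lambda>d r c s t. lie_to_chain n i (basis_vec (triple K d r c s t))) d r c s t = (0 :: 'k chain_vecs)"
    unfolding triple_sum_def by (intro sum.neutral ballI)
  then show ?thesis using fvs.subspace_0[OF subspace_cobdries] by simp
qed

text \<open>Both bracketings have the same nodes and share a linear extension. Their images are
  congruent to multiples of one signed chain, with opposite \<open>osgn\<close>.\<close>

lemma antisym_relation:
  "lie_to_chain n i (basis_vec (fill K (Bracket c s t))) + lie_to_chain n i (basis_vec (fill K (Bracket c t s)))
    \<in> (wcobdries n i :: (('k::field) chain_vecs) set)"
proof -
  let ?m = "fill K (Bracket c s t)" and ?m' = "fill K (Bracket c t s)"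
  have p: "perm_bracket n ?m' \<longleftrightarrow> perm_bracket n ?m" by (auto simp: perm_bracket_def letters_fill)
  have r: "red_brackets ?m' = red_brackets ?m"
    using red_fill[of K "Bracket c s t" "Bracket c t s"] by simp
  show ?thesis
  proof (cases "perm_bracket n ?m \<and> red_brackets ?m = i")
    case True
    then have m: "perm_bracket n ?m" "perm_bracket n ?m'" "red_brackets ?m = i" "red_brackets ?m' = i" using p r by auto
    have le: "linear_ext ?m (post ?m)" using m(1) by (simp add: perm_bracket_def linear_ext_post)
    have "set (post ?m') = set (post ?m)"
      by (simp add: post_fill Un_commute Un_left_commute Un_assoc)
    then have le': "linear_ext ?m' (post ?m)" using le by (simp add: linear_ext_def)
    have "osgn ?m' = - osgn ?m" using osgn_fill_antisym m(1) by (simp add: perm_bracket_def)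
    then have eq: "(lie_to_chain n i (basis_vec ?m) - fscale (of_int (osgn ?m)) (signed_chain n (post ?m)))
      + (lie_to_chain n i (basis_vec ?m') - fscale (of_int (osgn ?m')) (signed_chain n (post ?m)))
      = lie_to_chain n i (basis_vec ?m) + (lie_to_chain n i (basis_vec ?m') :: 'k chain_vecs)"
      by simp
    have "(lie_to_chain n i (basis_vec ?m) - fscale (of_int (osgn ?m)) (signed_chain n (post ?m)))
      + (lie_to_chain n i (basis_vec ?m') - fscale (of_int (osgn ?m')) (signed_chain n (post ?m)))
      \<in> (wcobdries n i :: ('k chain_vecs) set)"
      using lie_to_chain_cong[OF m(1) le] lie_to_chain_cong[OF m(2) le'] unfolding m(3,4)
      by (rule fvs.subspace_add[OF subspace_cobdries])
    then show ?thesis unfolding eq .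
  next
    case False
    have "lie_to_chain n i (basis_vec ?m) = (0 :: 'k chain_vecs)"
      by (rule lie_to_chain_other[OF False])
    moreover have "lie_to_chain n i (basis_vec ?m') = (0 :: 'k chain_vecs)"
      by (rule lie_to_chain_other) (unfold p r, rule False)
    ultimately show ?thesis using fvs.subspace_0[OF subspace_cobdries] by simp
  qed
qed

lemma lie_to_chain_ideal:
  assumes "p \<in> (lie2_ideal A :: (('k::field) bracket_vec) set)"
  shows "lie_to_chain n i p \<in> wcobdries n i"
proof (rule ideal_vanishing[where \<Phi> = "lie_to_chain n i" and B = "wcobdries n i", OF subspace_cobdries _ _ antisym_relation _ _ assms])
  fix K c x y z
  show "lie_to_chain n i (basis_vec (fill K (Bracket c x (Bracket c y z))))
      + lie_to_chain n i (basis_vec (fill K (Bracket c z (Bracket c x y))))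
      + lie_to_chain n i (basis_vec (fill K (Bracket c y (Bracket c z x))))
      \<in> (wcobdries n i :: ('k chain_vecs) set)"
    using triple_relation'[of n i K c x c y z] by (simp add: triple_sum_same triple_def ac_simps)
  show "lie_to_chain n i (basis_vec (fill K (Bracket Blue x (Bracket Red y z))))
      + lie_to_chain n i (basis_vec (fill K (Bracket Blue z (Bracket Red x y))))
      + lie_to_chain n i (basis_vec (fill K (Bracket Blue y (Bracket Red z x))))
      + lie_to_chain n i (basis_vec (fill K (Bracket Red x (Bracket Blue y z))))
      + lie_to_chain n i (basis_vec (fill K (Bracket Red z (Bracket Blue x y))))
      + lie_to_chain n i (basis_vec (fill K (Bracket Red y (Bracket Blue z x))))
      \<in> (wcobdries n i :: ('k chain_vecs) set)"
    using triple_relation'[of n i K Blue x Red y z] by (simp add: triple_sum_mixed triple_def ac_simps)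
qed simp_all

section \<open>The inverse map and its relations\<close>

definition represents :: "nat \<Rightarrow> nat \<Rightarrow> wpart list \<Rightarrow> nat bracketing \<Rightarrow> node list \<Rightarrow> bool" where
  "represents n i xs m L \<longleftrightarrow> perm_bracket n m \<and> red_brackets m = i \<and> linear_ext m L
     \<and> bar (chain_from n {} L) = xs"

text \<open>The chain determines the list of merges but the bracketing only up to swapped children,
  so one is chosen; \<open>signed_vec_cong\<close> makes the result independent of the choice modulo
  the ideal.\<close>

definition chain_to_lie :: "nat \<Rightarrow> nat \<Rightarrow> (('k::field) chain_vecs) \<Rightarrow> ('k bracket_vec)" where
  "chain_to_lie n i = lin_ext (\<lambda>xs. if \<exists>m L. represents n i xs m L
     then (let r = SOME r. represents n i xs (fst r) (snd r)
       in fscale (of_int (nsgn (snd r))) (signed_vec (fst r))) else 0)"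

lemma chain_to_lie_linear [simp]:
  "chain_to_lie n i (p + q) = chain_to_lie n i p + chain_to_lie n i q"
  "chain_to_lie n i (fscale c p) = fscale c (chain_to_lie n i p)"
  "chain_to_lie n i (p - q) = chain_to_lie n i p - chain_to_lie n i q"
  by (simp_all add: chain_to_lie_def)

lemma chain_to_lie_sum: "chain_to_lie n i (\<Sum>x\<in>S. f x) = (\<Sum>x\<in>S. chain_to_lie n i (f x))"
  by (simp add: chain_to_lie_def lin_ext_sum)

lemma chain_to_lie_choice:
  assumes "represents n i xs m L"
  obtains m' L' where "represents n i xs m' L'"
    "chain_to_lie n i (basis_vec xs) = (fscale (of_int (nsgn L')) (signed_vec m') :: ('k::field) bracket_vec)"
proof -
  define r where "r = (SOME r. represents n i xs (fst r) (snd r))"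
  have "represents n i xs (fst (m, L)) (snd (m, L))" using assms by simp
  then have "represents n i xs (fst r) (snd r)" unfolding r_def by (rule someI)
  moreover have "chain_to_lie n i (basis_vec xs) = (fscale (of_int (nsgn (snd r))) (signed_vec (fst r)) :: 'k bracket_vec)"
    using assms by (auto simp: chain_to_lie_def r_def Let_def)
  ultimately show thesis by (rule that)
qed

lemma represents_inj:
  assumes "n \<ge> 1" "represents n i xs m L" "represents n i xs m' L'"
  shows "L = L'"
proof -
  have m: "perm_bracket n m" "red_brackets m = i" "linear_ext m L" "bar (chain_from n {} L) = xs"
    and m': "perm_bracket n m'" "red_brackets m' = i" "linear_ext m' L'" "bar (chain_from n {} L') = xs"
    using assms(2,3) by (simp_all add: represents_def)
  show ?thesis
  \<comment> \<open>For \<open>n = 1\<close> the two ends coincide and cannot be restored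
    separately; there the lists are empty.\<close>
  proof (cases "n = 1")
    case True
    then show ?thesis using linear_ext_length[OF m(1,3)] linear_ext_length[OF m'(1,3)] by simp
  next
    case False
    then have n: "n \<ge> 2" using assms(1) by simp
    have "chain_from n {} L = chain_from n {} L'"
      using bar_inj[OF n, of "chain_from n {} L" i "chain_from n {} L'"] chain_from_max[OF assms(1) m(1,3)]
        chain_from_max[OF assms(1) m'(1,3)] m m' by simp
    then show ?thesis using linear_ext_inj[of n m "[]" L m' L'] m m' by simp
  qed
qed

lemma chain_to_lie_cong:
  assumes "n \<ge> 1" "perm_bracket n m" "linear_ext m L"
  shows "chain_to_lie n (red_brackets m) (chain_vec n L) - fscale (of_int (nsgn L)) (signed_vec m)
    \<in> (lie2_ideal {1..n} :: (('k::field) bracket_vec) set)"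
proof -
  let ?xs = "bar (chain_from n {} L)"
  have r: "represents n (red_brackets m) ?xs m L" using assms by (simp add: represents_def)
  obtain m' L' where r': "represents n (red_brackets m) ?xs m' L'"
    and eq: "chain_to_lie n (red_brackets m) (basis_vec ?xs) = (fscale (of_int (nsgn L')) (signed_vec m') :: 'k bracket_vec)"
    using chain_to_lie_choice[OF r] by metis
  have L: "L' = L" by (rule represents_inj[OF assms(1) r' r])
  have m': "perm_bracket n m'" "linear_ext m' L" using r' L by (simp_all add: represents_def)
  have "signed_vec m' - signed_vec m \<in> (lie2_ideal {1..n} :: (('k::field) bracket_vec) set)"
    using assms m' by (intro signed_vec_cong) (simp_all add: perm_bracket_def linear_ext_def)
  from lie2_ideal.scale[OF this] have "fscale (of_int (nsgn L)) (signed_vec m' - signed_vec m)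
    \<in> (lie2_ideal {1..n} :: (('k::field) bracket_vec) set)" .
  then show ?thesis unfolding chain_vec_def eq L by (simp add: fvs.scale_right_diff_distrib)
qed

text \<open>At the moment of the merge \<open>y\<close>, its two children and the freshly merged
  \<open>x\<close> are blocks; since \<open>x\<close> lies inside \<open>y\<close>, it is one of the
  children. The triple puts it on the right, so it may differ from \<open>m\<close> by a swap and
  only has the same nodes.\<close>

lemma nested_triple:
  assumes m: "perm_bracket n m" "linear_ext m (P @ x # y # Q)" and xy: "fst x \<subseteq> fst y"
  obtains K \<epsilon> d r c s t where "triple_ok n P Q K \<epsilon> d r c s t" "P @ x # y # Q = triple_nodes P Q d r c s t"
    "x = (lset s \<union> lset t, c)"
    "y = (lset s \<union> lset t \<union> lset r, d)"
    "set (post (triple K d r c s t)) = set (post m)"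
proof -
  have "y \<in> set (post m)" using m(2) by (auto simp: linear_ext_def)
  then obtain K p q where mK: "m = fill K (Bracket (snd y) p q)" and y1: "fst y = lset p \<union> lset q"
    by (rule post_decomp)
  have y: "y = (lset p \<union> lset q, snd y)" using y1 by (metis prod.collapse)
  have dm: "distinct (letters m)" using m(1) by (simp add: perm_bracket_def)
  have D: "lset p \<inter> lset q = {}" using dm unfolding mK by (auto simp: letters_fill)
  have le': "linear_ext (fill K (Bracket (snd y) p q)) ((P @ [x]) @ (lset p \<union> lset q, snd y) # Q)"
    using m(2) y mK by simp
  have pq: "lset p \<in> blocks n (insert x (set P))" "lset q \<in> blocks n (insert x (set P))"
    using child_block[OF m(1)[unfolded mK] le'] by simp_all
  obtain A B where AB: "A \<in> blocks n (set P)" "B \<in> blocks n (set P)" "A \<noteq> B" "x = (A \<union> B, snd x)"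
    using linear_ext_step[OF m] .
  have g: "good_forest n (set P)" by (rule good_prefix[OF m])
  have gx: "good_forest n (insert x (set P))" using forest_wpart_insert(2)[OF g AB(1-3)] AB(4) by metis
  have xb: "fst x \<in> blocks n (insert x (set P))" using blocks_insert[OF g AB(1-3), of "snd x"] AB(4) by (metis fst_conv insertI1)
  have x_eq: "fst x = lset p \<or> fst x = lset q"
  proof (rule ccontr)
    assume neg: "\<not> ?thesis"
    then have "fst x \<inter> lset p = {}" "fst x \<inter> lset q = {}"
      using blocks_disjoint[OF gx xb pq(1)] blocks_disjoint[OF gx xb pq(2)] by blast+
    then have "fst x \<inter> fst y = {}" unfolding y1 Int_Un_distrib by simp
    then show False using Int_absorb2[OF xy] blocks_nonempty[OF gx xb] by simp
  qed
  obtain r h where rh: "fst x = lset h" "(r = p \<and> h = q) \<or> (r = q \<and> h = p)" using x_eq by blast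
  have Drh: "lset r \<inter> lset h = {}" using rh(2) D by auto
  have xm: "x \<in> set (post m)" using m(2) by (auto simp: linear_ext_def)
  have "x \<in> set (post h)"
  proof -
    have "x \<in> set (post (Bracket (snd y) p q))"
      using dm xm unfolding mK
    proof (rule fill_nodes_cases)
      assume "set (letters (Bracket (snd y) p q)) \<subseteq> fst x"
      then have "lset r \<subseteq> lset h" using rh by auto
      then show ?thesis using letters_not_subset(1)[OF Drh] by simp
    next
      assume "fst x \<inter> set (letters (Bracket (snd y) p q)) = {}"
      then have "fst x \<inter> lset h = {}" using rh(2) by auto
      then show ?thesis unfolding rh(1) by simp
    qed
    then have "x \<in> {z \<in> set (post (Bracket (snd y) p q)). fst z \<subseteq> lset h}" using rh(1) by simp
    moreover have "distinct (letters (Bracket (snd y) p q))" using dm unfolding mK by (auto simp: letters_fill)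
    note pc = post_child[OF this]
    have "set (post h) = {z \<in> set (post (Bracket (snd y) p q)). fst z \<subseteq> lset h}"
      using rh(2)
    proof
      assume "r = p \<and> h = q"
      then show ?thesis using pc(2) by (simp only:)
    next
      assume "r = q \<and> h = p"
      then show ?thesis using pc(1) by (simp only:)
    qed
    ultimately show ?thesis by (simp only:)
  qed
  then obtain c s t where h: "h = Bracket c s t" by (cases h) auto
  have "x = (lset h, c)"
  proof -
    have "(lset h, c) \<in> set (post h)" unfolding h by simp
    moreover have "inj_on fst (set (post h))"
    proof -
      have "distinct (letters h)" using dm rh(2) unfolding mK by (auto simp: letters_fill)
      from distinct_fst_post[OF this] show ?thesis by (simp add: distinct_map)
    qed
    ultimately show ?thesis using \<open>x \<in> set (post h)\<close> rh(1) by (metis fst_conv inj_onD)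
  qed
  then have x: "x = (lset s \<union> lset t, c)" unfolding h by simp
  have y2: "y = (lset s \<union> lset t \<union> lset r, snd y)"
  proof -
    have "lset p \<union> lset q = lset h \<union> lset r" using rh(2) by auto
    then show ?thesis using y unfolding h by simp
  qed
  have post: "set (post (triple K (snd y) r c s t)) = set (post m)"
    unfolding mK triple_def h[symmetric] post_fill using rh(2) by (elim disjE) (auto simp: Un_commute)
  have "set (letters (triple K (snd y) r c s t)) = lset m" "distinct (letters (triple K (snd y) r c s t))"
    using rh(2) dm unfolding mK triple_def h[symmetric] by (auto simp: letters_fill)
  then have pb: "perm_bracket n (triple K (snd y) r c s t)" using m(1) by (simp add: perm_bracket_def)
  have nodes: "P @ x # y # Q = triple_nodes P Q (snd y) r c s t"
    unfolding triple_nodes_def using x y2 by simp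
  have "triple_ok n P Q K (osgn (triple K (snd y) r c s t) * nsgn (triple_nodes P Q (snd y) r c s t)) (snd y) r c s t"
    using pb m(2) post unfolding triple_ok_def nodes[symmetric] by (simp add: linear_ext_def)
  then show thesis using nodes x y2 post by (rule that)
qed

lemma triple_in_ideal:
  assumes "perm_bracket n (triple K d r c s t)"
  shows "triple_sum (\<lambda>d r c s t. basis_vec (triple K d r c s t)) d r c s t
    \<in> (lie2_ideal {1..n} :: (('k::field) bracket_vec) set)"
proof -
  have sub: "lset r \<subseteq> {1..n}" "lset s \<subseteq> {1..n}" "lset t \<subseteq> {1..n}"
    "set (lets_before K) \<subseteq> {1..n}" "set (lets_after K) \<subseteq> {1..n}"
    using assms unfolding perm_bracket_def triple_def letters_fill by auto
  \<comment> \<open>The relation without its context, which \<open>fill_lin\<close> restores at the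
    end.\<close>
  define R :: "'k bracket_vec" where "R = triple_sum (\<lambda>d r c s t. basis_vec (Bracket d r (Bracket c s t))) d r c s t"
  have mixed: "br Blue (basis_vec x) (br Red (basis_vec y) (basis_vec z))
      + br Blue (basis_vec z) (br Red (basis_vec x) (basis_vec y))
      + br Blue (basis_vec y) (br Red (basis_vec z) (basis_vec x))
      + br Red (basis_vec x) (br Blue (basis_vec y) (basis_vec z))
      + br Red (basis_vec z) (br Blue (basis_vec x) (basis_vec y))
      + br Red (basis_vec y) (br Blue (basis_vec z) (basis_vec x))
      \<in> (lie2_ideal {1..n} :: ('k bracket_vec) set)"
    if "lset x \<subseteq> {1..n}" "lset y \<subseteq> {1..n}" "lset z \<subseteq> {1..n}" for x y z
    using that by (intro lie2_ideal.mixed_jacobi) simp_all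
  have "R \<in> lie2_ideal {1..n}"
  proof (cases "c = d")
    case True
    have "br c (basis_vec r) (br c (basis_vec s) (basis_vec t)) + br c (basis_vec t) (br c (basis_vec r) (basis_vec s))
      + br c (basis_vec s) (br c (basis_vec t) (basis_vec r)) \<in> (lie2_ideal {1..n} :: ('k bracket_vec) set)"
      using sub by (intro lie2_ideal.jacobi) simp_all
    then show ?thesis unfolding R_def True[symmetric] triple_sum_same by (simp add: ac_simps)
  next
    case False
    then have cd: "{c, d} = {Blue, Red}" "c = Blue \<and> d = Red \<or> c = Red \<and> d = Blue"
      by (cases c; cases d; auto)+
    \<comment> \<open>The sum is symmetric in the two colors, so they may be put into a fixed
      order.\<close>
    have "R = triple_sum (\<lambda>d r c s t. basis_vec (Bracket d r (Bracket c s t))) Blue r Red s t"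
      using cd(2) unfolding R_def triple_sum_def by (auto simp: ac_simps)
    then show ?thesis using mixed[OF sub(1-3)] by (simp add: triple_sum_mixed ac_simps)
  qed
  then have "fill_lin K R \<in> lie2_ideal {1..n}" by (rule fill_lin_in_ideal[OF _ sub(4,5)])
  moreover have "fill_lin K R = triple_sum (\<lambda>d r c s t. basis_vec (triple K d r c s t)) d r c s t"
    unfolding R_def triple_sum_def triple_def fill_lin_def
    by (simp add: lin_ext_sum Let_def)
  ultimately show ?thesis by simp
qed

lemma chain_to_lie_triple:
  assumes "triple_ok n P Q K \<epsilon> d r c s t"
  shows "fscale (of_int \<epsilon>) (basis_vec (triple K d r c s t)) -
      chain_to_lie n (red_brackets (triple K d r c s t)) (chain_vec n (triple_nodes P Q d r c s t))
    \<in> (lie2_ideal {1..n} :: (('k::field) bracket_vec) set)"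
proof -
  let ?m = "triple K d r c s t" and ?L = "triple_nodes P Q d r c s t"
  have m: "perm_bracket n ?m" "linear_ext ?m ?L" and \<epsilon>: "\<epsilon> = osgn ?m * nsgn ?L"
    using assms by (simp_all add: triple_ok_def)
  have "n \<ge> 1" using linear_ext_length[OF m] by simp
  have "fscale (- 1) (chain_to_lie n (red_brackets ?m) (chain_vec n ?L) - fscale (of_int (nsgn ?L)) (signed_vec ?m))
    \<in> (lie2_ideal {1..n} :: ('k bracket_vec) set)"
    by (rule lie2_ideal.scale[OF chain_to_lie_cong[OF \<open>n \<ge> 1\<close> m]])
  then show ?thesis by (simp add: \<epsilon> signed_vec_def mult.commute)
qed

text \<open>For incomparable nodes both chains come from the same bracketing and the signs cancel;
  for nested nodes the chains are the terms of a Jacobi triple.\<close>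

lemma chain_to_lie_gap:
  assumes m: "perm_bracket n m" "linear_ext m (P @ x # y # Q)"
  shows "chain_to_lie n (red_brackets m) (cobdry (wint n (red_brackets m)) (wle n) (basis_vec (bar (gap_chain n P x y Q))))
    \<in> (lie2_ideal {1..n} :: (('k::field) bracket_vec) set)"
proof (cases "fst x \<subseteq> fst y")
  case False
  have n: "n \<ge> 1" using linear_ext_length[OF m] by simp
  have m': "linear_ext m (P @ y # x # Q)" by (rule linear_ext_swap[OF m(2) False])
  let ?a = "chain_to_lie n (red_brackets m) (chain_vec n (P @ x # y # Q)) - fscale (of_int (nsgn (P @ x # y # Q))) (signed_vec m) :: 'k bracket_vec"
  let ?b = "chain_to_lie n (red_brackets m) (chain_vec n (P @ y # x # Q)) - fscale (of_int (nsgn (P @ y # x # Q))) (signed_vec m) :: 'k bracket_vec"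
  have "?a + ?b \<in> lie2_ideal {1..n}"
    by (rule lie2_ideal.add[OF chain_to_lie_cong[OF n m] chain_to_lie_cong[OF n m(1) m']])
  moreover have "?a + ?b = chain_to_lie n (red_brackets m) (chain_vec n (P @ x # y # Q) + chain_vec n (P @ y # x # Q))"
    unfolding nsgn_swap[OF m(2)] by simp
  ultimately show ?thesis unfolding cobdry_swap[OF m False] chain_to_lie_linear(2)
    by (intro lie2_ideal.scale) simp
next
  case True
  obtain K \<epsilon> d r c s t where ok: "triple_ok n P Q K \<epsilon> d r c s t" and nodes: "P @ x # y # Q = triple_nodes P Q d r c s t"
    and x: "x = (lset s \<union> lset t, c)"
    and y: "y = (lset s \<union> lset t \<union> lset r, d)"
    and post: "set (post (triple K d r c s t)) = set (post m)"
    by (rule nested_triple[OF m True])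
  let ?m = "triple K d r c s t"
  have pb: "perm_bracket n ?m" using ok by (simp add: triple_ok_def)
  \<comment> \<open>The number of red brackets can be read off the set of nodes.\<close>
  have red: "red_brackets ?m = red_brackets m"
    using red_wt_post[of ?m] red_wt_post[of m] post m(1) pb by (simp add: perm_bracket_def)
  have le: "linear_ext ?m (P @ x # y # Q)" using m(2) post by (simp add: linear_ext_def)
  have co: "cobdry (wint n (red_brackets ?m)) (wle n) (basis_vec (bar (gap_chain n P x y Q)))
    = fscale ((- 1) ^ length P) (triple_sum (\<lambda>d r c s t. chain_vec n (triple_nodes P Q d r c s t)) d r c s t :: 'k chain_vecs)"
    unfolding triple_chain_eq Let_def x y
    by (rule cobdry_nested[OF pb le[unfolded x y] triple_blocks[OF ok]])
  have "triple_sum (\<lambda>d' r' c' s' t'. chain_to_lie n (red_brackets ?m) (chain_vec n (triple_nodes P Q d' r' c' s' t'))) d r c s t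
    \<in> (lie2_ideal {1..n} :: ('k bracket_vec) set)"
  proof (rule triple_sum_congruent[OF subspace_lie2_ideal ok])
    show "triple_sum (\<lambda>d r c s t. fscale (of_int \<epsilon>) (basis_vec (triple K d r c s t))) d r c s t
      \<in> (lie2_ideal {1..n} :: ('k bracket_vec) set)"
      unfolding triple_sum_scale by (rule lie2_ideal.scale[OF triple_in_ideal[OF pb]])
  next
    fix d' r' c' s' t'
    assume "triple_ok n P Q K \<epsilon> d' r' c' s' t'"
      "red_brackets (triple K d' r' c' s' t') = red_brackets ?m"
    then show "fscale (of_int \<epsilon>) (basis_vec (triple K d' r' c' s' t')) -
        chain_to_lie n (red_brackets ?m) (chain_vec n (triple_nodes P Q d' r' c' s' t'))
      \<in> (lie2_ideal {1..n} :: ('k bracket_vec) set)"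
      using chain_to_lie_triple by metis
  qed
  moreover have "triple_sum (\<lambda>d' r' c' s' t'. chain_to_lie n (red_brackets ?m) (chain_vec n (triple_nodes P Q d' r' c' s' t'))) d r c s t
    = (chain_to_lie n (red_brackets ?m) (triple_sum (\<lambda>d r c s t. chain_vec n (triple_nodes P Q d r c s t)) d r c s t) :: 'k bracket_vec)"
    unfolding triple_sum_def chain_to_lie_sum Let_def by simp
  ultimately show ?thesis
    unfolding red[symmetric] co chain_to_lie_linear(2) by (intro lie2_ideal.scale) simp
qed

text \<open>If every step lost only one block, the chain would be longer.\<close>

lemma chain_gap:
  assumes "sorted_wrt (lt_of (wle n)) (\<pi> # cs)" "set (\<pi> # cs) \<subseteq> wpartitions n"
    and "length cs + card (last (\<pi> # cs)) < card \<pi>"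
  shows "\<exists>U \<sigma> \<rho> V. \<pi> # cs = U @ \<sigma> # \<rho> # V \<and> Suc (Suc (card \<rho>)) \<le> card \<sigma>"
  using assms
proof (induction cs arbitrary: \<pi>)
  case (Cons \<rho> cs)
  show ?case
  proof (cases "Suc (Suc (card \<rho>)) \<le> card \<pi>")
    case True
    then show ?thesis by (intro exI[of _ "[]"]) auto
  next
    case False
    moreover have "card \<rho> < card \<pi>" using Cons.prems by (simp add: lt_wle_card)
    ultimately have "card \<pi> = Suc (card \<rho>)" by simp
    then have "\<exists>U \<sigma> \<tau> V. \<rho> # cs = U @ \<sigma> # \<tau> # V \<and> Suc (Suc (card \<tau>)) \<le> card \<sigma>"
      using Cons.prems by (intro Cons.IH) simp_all
    then obtain U \<sigma> \<tau> V where "\<rho> # cs = U @ \<sigma> # \<tau> # V" "Suc (Suc (card \<tau>)) \<le> card \<sigma>" by blast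
    then show ?thesis by (intro exI[of _ "\<pi> # U"]) auto
  qed
qed simp

text \<open>A chain that is one element short of maximal has a jump. Any interpolating merge
  completes it to a maximal chain, which can be decoded; the inserted element is then dropped
  again.\<close>

lemma gap_decode:
  assumes n: "n \<ge> 2" "i \<le> n - 1" and xs: "xs \<in> chains (wint n i) (wle n) (int n - 4)"
  obtains m P x y Q where "perm_bracket n m" "red_brackets m = i" "linear_ext m (P @ x # y # Q)"
    "xs = bar (gap_chain n P x y Q)"
proof -
  let ?full = "wbot n # xs @ [wtop n i]"
  have so: "sorted_wrt (lt_of (wle n)) ?full" and sub: "set xs \<subseteq> wpartitions n" and len: "int (length xs) = int n - 3"
    using xs unfolding chains_wint_iff[OF n] by auto
  have subf: "set ?full \<subseteq> wpartitions n" using sub wbot_in[of n] wtop_in[of n i] n by auto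
  have "\<exists>U \<sigma> \<rho> V. ?full = U @ \<sigma> # \<rho> # V \<and> Suc (Suc (card \<rho>)) \<le> card \<sigma>"
    using so subf len n by (intro chain_gap) (simp_all add: card_wbot wtop_def)
  then obtain U \<sigma> \<rho> V where full: "?full = U @ \<sigma> # \<rho> # V" and gap: "Suc (Suc (card \<rho>)) \<le> card \<sigma>" by blast
  have so': "sorted_wrt (lt_of (wle n)) (U @ \<sigma> # \<rho> # V)" and sub': "set (U @ \<sigma> # \<rho> # V) \<subseteq> wpartitions n"
    using so subf unfolding full by blast+
  have w: "\<sigma> \<in> wpartitions n" "\<rho> \<in> wpartitions n" and wU: "set U \<subseteq> wpartitions n" and wV: "set V \<subseteq> wpartitions n"
    using sub' by simp_all
  have lt: "lt_of (wle n) \<sigma> \<rho>" and ltU: "\<forall>u\<in>set U. lt_of (wle n) u \<sigma>" and ltV: "\<forall>v\<in>set V. lt_of (wle n) \<rho> v"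
    using so' by (simp_all add: sorted_wrt_append)
  have le: "wle n \<sigma> \<rho>" "\<sigma> \<noteq> \<rho>" using lt by (simp_all add: lt_of_def)
  obtain A a B b u where AB: "(A, a) \<in> \<sigma>" "(B, b) \<in> \<sigma>" "A \<noteq> B" "u \<le> 1" "wle n (merge u A B \<sigma>) \<rho>"
    by (rule interpolate_merge[OF w le])
  define \<tau> where "\<tau> = merge u A B \<sigma>"
  have \<tau>w: "\<tau> \<in> wpartitions n" unfolding \<tau>_def by (rule merge_in_wpartitions[OF w(1) AB(1-4)])
  have \<tau>c: "Suc (card \<tau>) = card \<sigma>" unfolding \<tau>_def by (rule card_merge[OF w(1) AB(1-3)])
  have lt1: "lt_of (wle n) \<sigma> \<tau>"
    using wle_merge[OF w(1) AB(1-4)] \<tau>c by (simp add: lt_wle_card[OF w(1) \<tau>w] flip: \<tau>_def)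
  have lt2: "lt_of (wle n) \<tau> \<rho>"
    using AB(5) \<tau>c gap by (simp add: lt_wle_card[OF \<tau>w w(2)] flip: \<tau>_def)
  let ?cs = "U @ \<sigma> # \<tau> # \<rho> # V"
  have "\<forall>u\<in>set U. lt_of (wle n) u \<tau>" using lt_wle_trans[OF _ w(1) \<tau>w _ lt1] ltU wU by blast
  moreover have "\<forall>v\<in>set V. lt_of (wle n) \<tau> v" using lt_wle_trans[OF \<tau>w w(2) _ lt2] ltV wV by blast
  ultimately have so'': "sorted_wrt (lt_of (wle n)) ?cs"
    using so' lt1 lt2 by (simp add: sorted_wrt_append)
  have "hd ?cs = hd (U @ \<sigma> # \<rho> # V)" by (cases U) simp_all
  then have hd: "hd ?cs = wbot n" unfolding full[symmetric] by simp
  have "last ?cs = last (U @ \<sigma> # \<rho> # V)" by simp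
  then have last: "last ?cs = wtop n i" unfolding full[symmetric] by simp
  have lcs: "length ?cs = n" using arg_cong[OF full, of length] len by simp
  have "?cs \<in> max_chains n i"
    unfolding max_chains_def using so'' sub' \<tau>w hd last lcs by simp
  moreover have "n \<ge> 1" using n by simp
  ultimately obtain m L where m: "perm_bracket n m" "red_brackets m = i" "linear_ext m L" "?cs = chain_from n {} L"
    using max_chain_decode by metis
  have lL: "length L = Suc (length U + Suc (length V))"
    using linear_ext_length[OF m(1,3)] lcs by simp
  define P where "P = take (length U) L"
  obtain x y Q where Q: "drop (length U) L = x # y # Q"
    using lL by (cases "drop (length U) L"; cases "tl (drop (length U) L)")
      (auto dest: arg_cong[of _ _ length])
  have L: "L = P @ x # y # Q" unfolding P_def Q[symmetric] by simp
  have lP: "length P = length U" unfolding P_def using lL by simp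
  have "U @ \<sigma> # \<tau> # \<rho> # V = chain_init n {} P @ forest_wpart n (set P) # forest_wpart n (insert x (set P))
      # chain_from n (insert y (insert x (set P))) Q"
    unfolding m(4) L by (simp add: chain_from_append)
  then have "U = chain_init n {} P" "\<sigma> = forest_wpart n (set P)" "\<rho> # V = chain_from n (insert y (insert x (set P))) Q"
    using lP by (simp_all add: append_eq_append_conv)
  then have "?full = gap_chain n P x y Q" unfolding full gap_chain_def by simp
  then have "bar (gap_chain n P x y Q) = bar ?full" by simp
  then have "xs = bar (gap_chain n P x y Q)" by (simp add: bar_def butlast_append)
  then show thesis using that m L by blast
qed

lemma chain_to_lie_cobdries:
  assumes n: "n \<ge> 1" "i \<le> n - 1" and p: "p \<in> (wcobdries n i :: (('k::field) chain_vecs) set)"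
  shows "chain_to_lie n i p \<in> lie2_ideal {1..n}"
proof (cases "n = 1")
  \<comment> \<open>The interval is degenerate and its only coboundary is 0.\<close>
  case True
  then have "wbot n = wtop n i" using n(2) by (simp add: wbot_def wtop_def)
  then have "p = 0" using p by (simp add: int_cobdries_def)
  then show ?thesis by (simp add: chain_to_lie_def lie2_ideal.zero)
next
  case False
  then have n2: "n \<ge> 2" using n(1) by simp
  obtain q where q: "q \<in> cochains (wint n i) (wle n) (int n - 4)" "p = cobdry (wint n i) (wle n) q"
    using p unfolding wcobdries_eq[OF n2] by blast
  show ?thesis unfolding q(2)
  proof (rule linear_image_in_subspace[OF subspace_lie2_ideal _ _ q(1)[unfolded cochains_def]])
    fix xs assume "xs \<in> chains (wint n i) (wle n) (int n - 4)"
    then obtain m P x y Q where "perm_bracket n m" "red_brackets m = i" "linear_ext m (P @ x # y # Q)"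
      "xs = bar (gap_chain n P x y Q)" by (rule gap_decode[OF n2 n(2)])
    then show "chain_to_lie n i (cobdry (wint n i) (wle n) (basis_vec xs)) \<in> (lie2_ideal {1..n} :: ('k bracket_vec) set)"
      using chain_to_lie_gap by blast
  qed simp_all
qed

section \<open>Isomorphism of subquotients\<close>

lemma subspace_set_plus:
  assumes "fvs.subspace W"
  shows "W + W = W"
proof
  show "W + W \<subseteq> W" using fvs.subspace_add[OF assms] by (auto elim!: set_plus_elim)
  show "W \<subseteq> W + W"
  proof
    fix w assume "w \<in> W"
    then have "w + 0 \<in> W + W" using fvs.subspace_0[OF assms] by (rule set_plus_intro)
    then show "w \<in> W + W" by simp
  qed
qed

text \<open>Adding \<open>B\<close> completes the image to a full coset, as \<open>F\<close> need
  not map \<open>W\<close> onto \<open>B\<close>. The lemma covers scalar multiples and the group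
  action as well as the isomorphism itself.\<close>

lemma coset_image:
  assumes B: "fvs.subspace B" and W: "fvs.subspace W"
    and add: "\<And>p q. F (p + q) = F p + F q" and FW: "\<And>w. w \<in> W \<Longrightarrow> F w \<in> B"
  shows "F ` (v +o W) + B = F v +o B"
proof
  show "F ` (v +o W) + B \<subseteq> F v +o B"
  proof
    fix z assume "z \<in> F ` (v +o W) + B"
    then obtain w b where "w \<in> W" "b \<in> B" "z = F (v + w) + b"
      by (auto simp: elt_set_plus_def elim!: set_plus_elim)
    then have "z = F v + (F w + b)" "F w + b \<in> B"
      using FW fvs.subspace_add[OF B] by (simp_all add: add)
    then show "z \<in> F v +o B" by (simp add: set_plus_intro2)
  qed
  show "F v +o B \<subseteq> F ` (v +o W) + B"
  proof
    fix z assume "z \<in> F v +o B"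
    then obtain b where b: "b \<in> B" "z = F v + b" by (auto simp: elt_set_plus_def)
    have "v + 0 \<in> v +o W" using fvs.subspace_0[OF W] by (rule set_plus_intro2)
    then have "F v \<in> F ` (v +o W)" by simp
    then show "z \<in> F ` (v +o W) + B" unfolding b(2) using b(1) by (rule set_plus_intro)
  qed
qed

lemma coset_eq_iff:
  assumes "fvs.subspace W"
  shows "v +o W = v' +o W \<longleftrightarrow> v - v' \<in> W"
proof
  assume eq: "v +o W = v' +o W"
  have "v + 0 \<in> v +o W" using fvs.subspace_0[OF assms] by (rule set_plus_intro2)
  then have "v \<in> v' +o W" unfolding eq by simp
  then show "v - v' \<in> W" by (rule set_plus_imp_minus)
next
  assume d: "v - v' \<in> W"
  have sub: "u +o W \<subseteq> u' +o W" if "u - u' \<in> W" for u u'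
  proof
    fix z assume "z \<in> u +o W"
    then obtain w where w: "w \<in> W" "z = u + w" by (auto simp: elt_set_plus_def)
    have "z = u' + ((u - u') + w)" using w(2) by simp
    moreover have "(u - u') + w \<in> W" using fvs.subspace_add[OF assms that w(1)] .
    ultimately show "z \<in> u' +o W" by (metis set_plus_intro2)
  qed
  have "v' - v \<in> W" using fvs.subspace_neg[OF assms d] by simp
  then show "v +o W = v' +o W" using sub d by (metis subset_antisym)
qed

lemma coset_add:
  "fvs.subspace W \<Longrightarrow> (v +o W) + (v' +o W) = (v + v') +o W"
  by (simp add: set_plus_rearrange subspace_set_plus)

lemma subquotient_simps [simp]:
  "rep_space (subquotient h V W) = (\<lambda>v. v +o W) ` V"
  "rep_add (subquotient h V W) = (\<lambda>X Y. X + Y)"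
  "rep_scale (subquotient h V W) = (\<lambda>c X. fscale c ` X + W)"
  "rep_act (subquotient h V W) = (\<lambda>\<sigma> X. lin_ext (\<lambda>x. basis_vec (h \<sigma> x)) ` X)"
  by (simp_all add: subquotient_def)

lemma tensor_sgn_simps [simp]:
  "rep_space (tensor_sgn M) = rep_space M"
  "rep_add (tensor_sgn M) = rep_add M"
  "rep_scale (tensor_sgn M) = rep_scale M"
  "rep_act (tensor_sgn M) = (\<lambda>\<sigma> x. rep_scale M (of_int (sign \<sigma>)) (rep_act M \<sigma> x))"
  by (simp_all add: tensor_sgn_def)

lemma coset_scale:
  assumes "fvs.subspace W"
  shows "fscale c ` (v +o W) + W = fscale c v +o W"
  using assms by (intro coset_image) (simp_all add: fvs.scale_right_distrib fvs.subspace_scale)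

text \<open>\<open>F\<close> and \<open>G\<close> are inverse to each other only modulo
  \<open>W\<close> and \<open>B\<close>. In the application \<open>W\<close> is not contained in
  \<open>V\<close>, since the ideal has elements of all degrees; the carrier is the image of
  \<open>V\<close> modulo \<open>W\<close>.\<close>

lemma subquotient_iso:
  fixes F :: "('x \<Rightarrow>\<^sub>0 'k::field) \<Rightarrow> ('y \<Rightarrow>\<^sub>0 'k)" and G :: "('y \<Rightarrow>\<^sub>0 'k) \<Rightarrow> ('x \<Rightarrow>\<^sub>0 'k)"
  assumes W: "fvs.subspace W" and B: "fvs.subspace B"
    and F_add: "\<And>p q. F (p + q) = F p + F q" and F_scale: "\<And>c p. F (fscale c p) = fscale c (F p)"
    and G_diff: "\<And>p q. G (p - q) = G p - G q"
    and FV: "\<And>v. v \<in> V \<Longrightarrow> F v \<in> C" and GC: "\<And>c. c \<in> C \<Longrightarrow> G c \<in> V"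
    and FW: "\<And>w. w \<in> W \<Longrightarrow> F w \<in> B" and GB: "\<And>b. b \<in> B \<Longrightarrow> G b \<in> W"
    and GF: "\<And>v. v \<in> V \<Longrightarrow> G (F v) - v \<in> W" and FG: "\<And>c. c \<in> C \<Longrightarrow> F (G c) - c \<in> B"
    and hW: "\<And>\<sigma> w. \<sigma> permutes {1..n} \<Longrightarrow> w \<in> W \<Longrightarrow> lin_ext (\<lambda>x. basis_vec (h \<sigma> x)) w \<in> W"
    and gB: "\<And>\<sigma> b. \<sigma> permutes {1..n} \<Longrightarrow> b \<in> B \<Longrightarrow> lin_ext (\<lambda>x. basis_vec (g \<sigma> x)) b \<in> B"
    and equiv: "\<And>\<sigma> v. \<sigma> permutes {1..n} \<Longrightarrow> v \<in> V \<Longrightarrow> F (lin_ext (\<lambda>x. basis_vec (h \<sigma> x)) v)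
      = fscale (of_int (sign \<sigma>)) (lin_ext (\<lambda>x. basis_vec (g \<sigma> x)) (F v))"
  shows "sn_module_iso n (subquotient h V W) (tensor_sgn (subquotient g C B)) (\<lambda>X. F ` X + B)"
    and "F ` (v +o W) + B = F v +o B"
proof -
  have cos: "F ` (v +o W) + B = F v +o B" for v by (rule coset_image[OF B W F_add FW])
  then show "F ` (v +o W) + B = F v +o B" .
  have F_diff: "F p - F q = F (p - q)" for p q
    using F_add[of "p - q" q] by (simp add: algebra_simps)
  have lin: "rep_linear (subquotient h V W) (tensor_sgn (subquotient g C B)) (\<lambda>X. F ` X + B)"
    unfolding rep_linear_def
  proof (intro conjI ballI allI)
    fix x assume "x \<in> rep_space (subquotient h V W)"
    then obtain v where v: "v \<in> V" "x = v +o W" by auto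
    show "F ` x + B \<in> rep_space (tensor_sgn (subquotient g C B))"
      unfolding v(2) cos using FV[OF v(1)] by simp
    {
      fix y assume "y \<in> rep_space (subquotient h V W)"
      then obtain u where u: "u \<in> V" "y = u +o W" by auto
      show "F ` rep_add (subquotient h V W) x y + B
          = rep_add (tensor_sgn (subquotient g C B)) (F ` x + B) (F ` y + B)"
        by (simp add: v u cos coset_add[OF W] coset_add[OF B] F_add)
    }
    fix c
    show "F ` rep_scale (subquotient h V W) c x + B
        = rep_scale (tensor_sgn (subquotient g C B)) c (F ` x + B)"
      by (simp add: v cos coset_scale[OF W] coset_scale[OF B] F_scale)
  qed
  have bij: "bij_betw (\<lambda>X. F ` X + B) (rep_space (subquotient h V W)) (rep_space (tensor_sgn (subquotient g C B)))"
    unfolding bij_betw_def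
  proof
    show "inj_on (\<lambda>X. F ` X + B) (rep_space (subquotient h V W))"
    proof (rule inj_onI)
      fix x y assume "x \<in> rep_space (subquotient h V W)" "y \<in> rep_space (subquotient h V W)"
      then obtain v u where v: "v \<in> V" "x = v +o W" and u: "u \<in> V" "y = u +o W" by auto
      assume "F ` x + B = F ` y + B"
      then have "F v - F u \<in> B" unfolding v(2) u(2) cos coset_eq_iff[OF B] .
      then have "G (F v) - G (F u) \<in> W" using GB[of "F v - F u"] by (simp add: G_diff)
      moreover have "v - u = (G (F v) - G (F u)) - ((G (F v) - v) - (G (F u) - u))" by simp
      ultimately have "v - u \<in> W"
        using GF[OF v(1)] GF[OF u(1)] fvs.subspace_diff[OF W] by metis
      then show "x = y" unfolding v(2) u(2) coset_eq_iff[OF W] .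
    qed
    show "(\<lambda>X. F ` X + B) ` rep_space (subquotient h V W) = rep_space (tensor_sgn (subquotient g C B))"
    proof
      show "(\<lambda>X. F ` X + B) ` rep_space (subquotient h V W) \<subseteq> rep_space (tensor_sgn (subquotient g C B))"
        using lin unfolding rep_linear_def by blast
      show "rep_space (tensor_sgn (subquotient g C B)) \<subseteq> (\<lambda>X. F ` X + B) ` rep_space (subquotient h V W)"
      proof
        fix y assume "y \<in> rep_space (tensor_sgn (subquotient g C B))"
        then obtain c where c: "c \<in> C" "y = c +o B" by auto
        have "F ` (G c +o W) + B = y" unfolding cos c(2) coset_eq_iff[OF B] by (rule FG[OF c(1)])
        then show "y \<in> (\<lambda>X. F ` X + B) ` rep_space (subquotient h V W)"
          using GC[OF c(1)] by (intro image_eqI[of _ _ "G c +o W"]) simp_all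
      qed
    qed
  qed
  have act: "F ` rep_act (subquotient h V W) \<sigma> x + B = rep_act (tensor_sgn (subquotient g C B)) \<sigma> (F ` x + B)"
    if \<sigma>: "\<sigma> permutes {1..n}" and x: "x \<in> rep_space (subquotient h V W)" for \<sigma> x
  proof -
    obtain v where v: "v \<in> V" "x = v +o W" using x by auto
    have "(\<lambda>p. F (lin_ext (\<lambda>x. basis_vec (h \<sigma> x)) p)) ` (v +o W) + B
        = F (lin_ext (\<lambda>x. basis_vec (h \<sigma> x)) v) +o B"
      by (rule coset_image[OF B W]) (simp_all add: F_add FW hW[OF \<sigma>])
    moreover have "(\<lambda>p. fscale (of_int (sign \<sigma>)) (lin_ext (\<lambda>x. basis_vec (g \<sigma> x)) p)) ` (F v +o B) + B
        = fscale (of_int (sign \<sigma>)) (lin_ext (\<lambda>x. basis_vec (g \<sigma> x)) (F v)) +o B"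
      by (rule coset_image[OF B B]) (simp_all add: fvs.scale_right_distrib fvs.subspace_scale[OF B] gB[OF \<sigma>])
    ultimately show ?thesis
      by (simp add: v cos equiv[OF \<sigma>] image_image)
  qed
  show "sn_module_iso n (subquotient h V W) (tensor_sgn (subquotient g C B)) (\<lambda>X. F ` X + B)"
    unfolding sn_module_iso_def using lin bij act by blast
qed

section \<open>Top cochains, and the two maps as mutual inverses\<close>

lemma bracketed_perms_eq: "bracketed_perms n i = {m. perm_bracket n m \<and> red_brackets m = i}"
  by (auto simp: bracketed_perms_def perm_bracket_def)

text \<open>Described through bracketings instead of chains of the interval, so that the degenerate
  case \<open>n = 1\<close> with its empty list is included.\<close>

definition top_chains :: "nat \<Rightarrow> nat \<Rightarrow> wpart list set" where
  "top_chains n i = {xs. \<exists>m L. represents n i xs m L}"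

lemma top_chains_eq:
  assumes "n \<ge> 2" "i \<le> n - 1"
  shows "top_chains n i = chains (wint n i) (wle n) (int n - 3)"
proof (intro set_eqI iffI)
  have n: "n \<ge> 1" using assms by simp
  fix xs
  {
    assume "xs \<in> top_chains n i"
    then obtain m L where "represents n i xs m L" by (auto simp: top_chains_def)
    then have mc: "chain_from n {} L \<in> max_chains n i" and xs: "xs = bar (chain_from n {} L)"
      using chain_from_max[OF n] by (auto simp: represents_def)
    show "xs \<in> chains (wint n i) (wle n) (int n - 3)"
      unfolding top_chains_wint_iff[OF assms] xs max_chain_bar[OF assms(1) mc, symmetric] by (rule mc)
  }
  assume "xs \<in> chains (wint n i) (wle n) (int n - 3)"
  then have mc: "wbot n # xs @ [wtop n i] \<in> max_chains n i" unfolding top_chains_wint_iff[OF assms] .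
  from max_chain_decode[OF n mc] obtain m L where "perm_bracket n m" "red_brackets m = i" "linear_ext m L"
    "wbot n # xs @ [wtop n i] = chain_from n {} L" .
  moreover from this(4) have "bar (chain_from n {} L) = bar (wbot n # xs @ [wtop n i])" by simp
  then have "bar (chain_from n {} L) = xs" by (simp add: bar_def butlast_append)
  ultimately show "xs \<in> top_chains n i" by (auto simp: top_chains_def represents_def)
qed

text \<open>A maximal chain has no gap, so nothing can be inserted.\<close>

lemma cobdry_top_chain:
  assumes n: "n \<ge> 2" "i \<le> n - 1" and xs: "xs \<in> chains (wint n i) (wle n) (int n - 3)"
  shows "cobdry (wint n i) (wle n) (basis_vec xs) = 0"
proof -
  let ?full = "wbot n # xs @ [wtop n i]"
  have mc: "?full \<in> max_chains n i" using xs unfolding top_chains_wint_iff[OF n] .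
  have "n \<ge> 1" using n by simp
  from max_chain_decode[OF this mc] obtain m L where m: "perm_bracket n m" "red_brackets m = i" "linear_ext m L"
    "?full = chain_from n {} L" .
  have lL: "Suc (length L) = n" by (rule linear_ext_length[OF m(1,3)])
  have lx: "length xs + 2 = n" using arg_cong[OF m(4), of length] lL by simp
  have sub: "set ?full \<subseteq> wpartitions n" using mc by (simp add: max_chains_def)
  have "insertable (wint n i) (wle n) xs j = {}" if j: "j \<le> length xs" for j
  proof -
    have "card (?full ! j) = Suc (card (?full ! Suc j))"
      using card_chain_nth[OF m(1,3), of j] card_chain_nth[OF m(1,3), of "Suc j"] j lL lx unfolding m(4) by simp
    moreover have w: "?full ! j \<in> wpartitions n" "?full ! Suc j \<in> wpartitions n"
      using sub nth_mem[of j ?full] nth_mem[of "Suc j" ?full] lx j by auto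
    ultimately show ?thesis
      unfolding insertable_wint[OF n xs j] using lt_wle_card[OF w(1)] lt_wle_card[OF _ w(2)] by fastforce
  qed
  then show ?thesis unfolding cobdry_basis by (intro sum.neutral ballI) simp
qed

abbreviation wcocycles :: "nat \<Rightarrow> nat \<Rightarrow> (('k::field) chain_vecs) set" where
  "wcocycles n i \<equiv> int_cocycles (wpartitions n) (wle n) (wbot n) (wtop n i) (int n - 3)"

lemma wcocycles_eq:
  assumes "n \<ge> 1" "i \<le> n - 1"
  shows "(wcocycles n i :: (('k::field) chain_vecs) set) = fspan (basis_vec ` top_chains n i)"
proof (cases "n = 1")
  case True
  then have i: "i = 0" using assms by simp
  have eq: "wbot n = wtop n i" using True i by (simp add: wbot_def wtop_def)
  \<comment> \<open>The empty list is \<open>bar\<close> of the chain with one element, and it is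
    also the generator in degree -2.\<close>
  have "top_chains 1 0 = {[]}"
  proof
    show "top_chains 1 0 \<subseteq> {[]}"
    proof
      fix xs assume "xs \<in> top_chains 1 0"
      then obtain m L where r: "represents 1 0 xs m L" by (auto simp: top_chains_def)
      then have "L = []" using linear_ext_length[of 1 m L] by (simp add: represents_def)
      with r show "xs \<in> {[]}" by (simp add: represents_def bar_def)
    qed
    have "represents 1 0 [] (Letter 1) []"
      by (simp add: represents_def perm_bracket_def linear_ext_def bar_def)
    then show "{[]} \<subseteq> top_chains 1 0" by (auto simp: top_chains_def)
  qed
  then show ?thesis using True i eq by (simp add: int_cocycles_def)
next
  case False
  then have n: "n \<ge> 2" using assms(1) by simp
  have "cobdry (wint n i) (wle n) f = 0" if "f \<in> cochains (wint n i) (wle n) (int n - 3)"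
    for f :: "'k chain_vecs"
  proof -
    have "cobdry (wint n i) (wle n) f \<in> {0}"
      by (rule linear_image_in_subspace[OF subspace_zero_set _ _ that[unfolded cochains_def]])
        (simp_all add: cobdry_top_chain[OF n assms(2)])
    then show ?thesis by simp
  qed
  then show ?thesis
    using wbot_neq_wtop[OF n] by (auto simp: int_cocycles_def cochains_def top_chains_eq[OF n assms(2)])
qed

text \<open>The bracketing found for a chain is sent back to its postorder chain, in general another
  linear extension; the two are congruent up to sign, and \<open>nsgn L\<close> and
  \<open>osgn m\<close> both occur squared.\<close>

lemma chain_to_lie_to_chain:
  assumes n: "n \<ge> 1" "i \<le> n - 1" and c: "c \<in> (wcocycles n i :: (('k::field) chain_vecs) set)"
  shows "lie_to_chain n i (chain_to_lie n i c) - c \<in> (wcobdries n i :: ('k chain_vecs) set)"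
proof (rule linear_image_in_subspace[OF subspace_cobdries _ _ c[unfolded wcocycles_eq[OF n]]])
  fix xs assume "xs \<in> top_chains n i"
  then obtain m0 L0 where "represents n i xs m0 L0" by (auto simp: top_chains_def)
  from chain_to_lie_choice[OF this] obtain m L where r: "represents n i xs m L"
    and eq: "chain_to_lie n i (basis_vec xs) = (fscale (of_int (nsgn L)) (signed_vec m) :: 'k bracket_vec)" .
  have m: "perm_bracket n m" "red_brackets m = i" "linear_ext m L" "basis_vec xs = (chain_vec n L :: 'k chain_vecs)"
    using r by (auto simp: represents_def chain_vec_def)
  have "lie_to_chain n i (basis_vec m) - fscale (of_int (osgn m)) (signed_chain n L) \<in> (wcobdries n i :: ('k chain_vecs) set)"
    using lie_to_chain_cong[OF m(1,3)] unfolding m(2) .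
  from fvs.subspace_scale[OF subspace_cobdries this]
  have "fscale (of_int (nsgn L * osgn m)) (lie_to_chain n i (basis_vec m) - fscale (of_int (osgn m)) (signed_chain n L))
    \<in> (wcobdries n i :: ('k chain_vecs) set)" .
  moreover have "fscale (of_int (nsgn L * osgn m)) (lie_to_chain n i (basis_vec m) - fscale (of_int (osgn m)) (signed_chain n L))
    = lie_to_chain n i (chain_to_lie n i (basis_vec xs)) - (basis_vec xs :: 'k chain_vecs)"
  proof -
    have "nsgn L * osgn m * (osgn m * nsgn L) = (nsgn L * nsgn L) * (osgn m * osgn m)" by (simp only: mult_ac)
    then have "nsgn L * osgn m * (osgn m * nsgn L) = 1" by simp
    then have "of_int (nsgn L * osgn m) * (of_int (osgn m) * of_int (nsgn L)) = (1 :: 'k)"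
      by (metis of_int_1 of_int_mult)
    then show ?thesis
      unfolding eq unfolding m(4) signed_vec_def signed_chain_def
      by (simp only: lie_to_chain_linear fvs.scale_right_diff_distrib fvs.scale_scale of_int_mult fvs.scale_one)
  qed
  ultimately show "lie_to_chain n i (chain_to_lie n i (basis_vec xs)) - basis_vec xs \<in> (wcobdries n i :: ('k chain_vecs) set)"
    by simp
qed (simp_all add: fvs.scale_right_diff_distrib)

text \<open>The postorder chain of \<open>m\<close> may be decoded to a bracketing with swapped
  children, which is congruent to \<open>m\<close> as a signed monomial.\<close>

lemma lie_to_chain_to_lie:
  assumes n: "n \<ge> 1" and v: "v \<in> (fspan (basis_vec ` bracketed_perms n i) :: (('k::field) bracket_vec) set)"
  shows "chain_to_lie n i (lie_to_chain n i v) - v \<in> (lie2_ideal {1..n} :: ('k bracket_vec) set)"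
proof (rule linear_image_in_subspace[OF subspace_lie2_ideal _ _ v])
  fix m assume "m \<in> bracketed_perms n i"
  then have m: "perm_bracket n m" "red_brackets m = i" by (simp_all add: bracketed_perms_eq)
  then have le: "linear_ext m (post m)" by (simp add: perm_bracket_def linear_ext_post)
  let ?L = "post m"
  have "chain_to_lie n i (chain_vec n ?L) - fscale (of_int (nsgn ?L)) (signed_vec m) \<in> (lie2_ideal {1..n} :: ('k bracket_vec) set)"
    using chain_to_lie_cong[OF n m(1) le] unfolding m(2) .
  from lie2_ideal.scale[OF this]
  have "fscale (of_int (nsgn ?L * osgn m)) (chain_to_lie n i (chain_vec n ?L) - fscale (of_int (nsgn ?L)) (signed_vec m))
    \<in> (lie2_ideal {1..n} :: ('k bracket_vec) set)" .
  moreover have "fscale (of_int (nsgn ?L * osgn m)) (chain_to_lie n i (chain_vec n ?L) - fscale (of_int (nsgn ?L)) (signed_vec m))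
    = chain_to_lie n i (lie_to_chain n i (basis_vec m)) - (basis_vec m :: 'k bracket_vec)"
  proof -
    have "nsgn ?L * osgn m * (nsgn ?L * osgn m) = (nsgn ?L * nsgn ?L) * (osgn m * osgn m)" by (simp only: mult_ac)
    then have "nsgn ?L * osgn m * (nsgn ?L * osgn m) = 1" by simp
    then have "of_int (nsgn ?L * osgn m) * (of_int (nsgn ?L) * of_int (osgn m)) = (1 :: 'k)"
      by (metis of_int_1 of_int_mult)
    moreover have "lie_to_chain n i (basis_vec m) = (fscale (of_int (nsgn ?L * osgn m)) (chain_vec n ?L) :: 'k chain_vecs)"
      using lie_to_chain_signed[OF m(1)] unfolding m(2) signed_chain_def by (simp add: mult.commute)
    ultimately show ?thesis
      unfolding signed_vec_def
      by (simp only: chain_to_lie_linear fvs.scale_right_diff_distrib fvs.scale_scale fvs.scale_one)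
  qed
  ultimately show "chain_to_lie n i (lie_to_chain n i (basis_vec m)) - basis_vec m \<in> (lie2_ideal {1..n} :: ('k bracket_vec) set)"
    by simp
qed (simp_all add: fvs.scale_right_diff_distrib)

lemma lie_to_chain_in_cocycles:
  assumes n: "n \<ge> 1" "i \<le> n - 1" and v: "v \<in> (fspan (basis_vec ` bracketed_perms n i) :: (('k::field) bracket_vec) set)"
  shows "lie_to_chain n i v \<in> (wcocycles n i :: ('k chain_vecs) set)"
  unfolding wcocycles_eq[OF n]
proof (rule linear_image_in_subspace[OF fvs.subspace_span _ _ v])
  fix m assume "m \<in> bracketed_perms n i"
  then have m: "perm_bracket n m" "red_brackets m = i" by (simp_all add: bracketed_perms_eq)
  then have "represents n i (bar (chain_from n {} (post m))) m (post m)"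
    by (simp add: represents_def perm_bracket_def linear_ext_post)
  then have "bar (chain_from n {} (post m)) \<in> top_chains n i" by (auto simp: top_chains_def)
  then have "(chain_vec n (post m) :: 'k chain_vecs) \<in> fspan (basis_vec ` top_chains n i)"
    unfolding chain_vec_def by (intro fvs.span_base) simp
  then show "lie_to_chain n i (basis_vec m) \<in> (fspan (basis_vec ` top_chains n i) :: ('k chain_vecs) set)"
    unfolding lie_to_chain_basis[OF m(1), unfolded m(2)] by (rule fvs.span_scale)
qed simp_all

lemma chain_to_lie_in_span:
  assumes n: "n \<ge> 1" "i \<le> n - 1" and c: "c \<in> (wcocycles n i :: (('k::field) chain_vecs) set)"
  shows "chain_to_lie n i c \<in> (fspan (basis_vec ` bracketed_perms n i) :: ('k bracket_vec) set)"
proof (rule linear_image_in_subspace[OF fvs.subspace_span _ _ c[unfolded wcocycles_eq[OF n]]])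
  fix xs assume "xs \<in> top_chains n i"
  then obtain m0 L0 where "represents n i xs m0 L0" by (auto simp: top_chains_def)
  from chain_to_lie_choice[OF this] obtain m L where r: "represents n i xs m L"
    and eq: "chain_to_lie n i (basis_vec xs) = (fscale (of_int (nsgn L)) (signed_vec m) :: 'k bracket_vec)" .
  have "m \<in> bracketed_perms n i" using r by (simp add: represents_def bracketed_perms_eq)
  then have "(basis_vec m :: 'k bracket_vec) \<in> fspan (basis_vec ` bracketed_perms n i)"
    by (intro fvs.span_base) simp
  then show "chain_to_lie n i (basis_vec xs) \<in> (fspan (basis_vec ` bracketed_perms n i) :: ('k bracket_vec) set)"
    unfolding eq signed_vec_def by (intro fvs.span_scale)
qed simp_all

section \<open>Equivariance and the postorder chain\<close>

lemma permutes_image_inj: "\<sigma> permutes S \<Longrightarrow> \<sigma> ` A = \<sigma> ` B \<longleftrightarrow> A = B"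
  by (simp add: inj_image_eq_iff permutes_inj)

lemma permutes_image_subset: "\<sigma> permutes S \<Longrightarrow> \<sigma> ` A \<subseteq> \<sigma> ` B \<longleftrightarrow> A \<subseteq> B"
  by (simp add: inj_image_subset_iff permutes_inj)

lemma in_perm_wpart: "p \<in> perm_wpart \<sigma> \<pi> \<longleftrightarrow> (\<exists>B v. (B, v) \<in> \<pi> \<and> p = (\<sigma> ` B, v))"
  unfolding perm_wpart_def image_iff Bex_pair by simp

lemma perm_wpart_mem:
  "\<sigma> permutes S \<Longrightarrow> (\<sigma> ` B, v) \<in> perm_wpart \<sigma> \<pi> \<longleftrightarrow> (B, v) \<in> \<pi>"
  by (auto simp: in_perm_wpart permutes_image_inj)

lemma perm_wpart_in:
  assumes \<sigma>: "\<sigma> permutes {1..n}" and wp: "\<pi> \<in> wpartitions n"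
  shows "perm_wpart \<sigma> \<pi> \<in> wpartitions n"
proof (rule wpartitionsI)
  have inj: "inj \<sigma>" using \<sigma> by (rule permutes_inj)
  fix A a assume "(A, a) \<in> perm_wpart \<sigma> \<pi>"
  then obtain B where B: "(B, a) \<in> \<pi>" "A = \<sigma> ` B" by (auto simp: in_perm_wpart)
  have "card A = card B" unfolding B(2) using inj by (metis card_image inj_on_subset subset_UNIV)
  moreover have "A \<subseteq> {1..n}" unfolding B(2) using image_mono[OF wp_subset[OF wp B(1)], of \<sigma>] permutes_image[OF \<sigma>] by simp
  ultimately show "A \<noteq> {} \<and> A \<subseteq> {1..n} \<and> a \<le> card A - 1"
    using wp_nonempty[OF wp B(1)] wp_weight[OF wp B(1)] B(2) by simp
  fix C c x assume "(C, c) \<in> perm_wpart \<sigma> \<pi>" and x: "x \<in> A" "x \<in> C"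
  then obtain D where D: "(D, c) \<in> \<pi>" "C = \<sigma> ` D" by (auto simp: in_perm_wpart)
  obtain y where y: "y \<in> B" "x = \<sigma> y" using x(1) B(2) by blast
  then have "y \<in> D" using x(2) D(2) inj by (metis inj_image_mem_iff)
  from wp_disj[OF wp B(1) D(1) y(1) this] show "A = C \<and> a = c" using B(2) D(2) by simp
next
  fix x assume "x \<in> {1..n}"
  then have "x \<in> \<sigma> ` {1..n}" using permutes_image[OF \<sigma>] by simp
  then obtain y where y: "y \<in> {1..n}" "x = \<sigma> y" by blast
  from wp_cover[OF wp y(1)] obtain A a where "(A, a) \<in> \<pi>" "y \<in> A" by blast
  then have "(\<sigma> ` A, a) \<in> perm_wpart \<sigma> \<pi>" "x \<in> \<sigma> ` A" using y(2) by (auto simp: in_perm_wpart)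
  then show "\<exists>(A, a)\<in>perm_wpart \<sigma> \<pi>. x \<in> A" by blast
qed

lemma inj_perm_wpart: "\<sigma> permutes S \<Longrightarrow> inj (perm_wpart \<sigma>)"
proof (rule injI)
  fix \<pi> \<rho> assume \<sigma>: "\<sigma> permutes S" and eq: "perm_wpart \<sigma> \<pi> = perm_wpart \<sigma> \<rho>"
  have "(B, v) \<in> \<pi> \<longleftrightarrow> (B, v) \<in> \<rho>" for B v
    using perm_wpart_mem[OF \<sigma>, of B v \<pi>] perm_wpart_mem[OF \<sigma>, of B v \<rho>] eq by simp
  then show "\<pi> = \<rho>" by auto
qed

lemma perm_wpart_inv:
  assumes "\<sigma> permutes S"
  shows "perm_wpart \<sigma> (perm_wpart (inv \<sigma>) \<pi>) = \<pi>"
proof -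
  have "\<sigma> ` inv \<sigma> ` B = B" for B by (simp add: image_comp permutes_inv_o(1)[OF assms])
  then show ?thesis by (simp add: perm_wpart_def image_image split_beta)
qed

lemma perm_wpart_inv':
  assumes "\<sigma> permutes S"
  shows "perm_wpart (inv \<sigma>) (perm_wpart \<sigma> \<pi>) = \<pi>"
  using perm_wpart_inv[OF permutes_inv[OF assms]] permutes_inv_inv[OF assms] by metis

lemma parts_in_perm:
  assumes "\<sigma> permutes S"
  shows "parts_in (perm_wpart \<sigma> \<pi>) (\<sigma> ` B) = perm_wpart \<sigma> (parts_in \<pi> B)"
  using permutes_image_subset[OF assms] unfolding parts_in_def perm_wpart_def by auto

lemma wle_perm:
  assumes \<sigma>: "\<sigma> permutes {1..n}" and wp: "\<pi> \<in> wpartitions n" "\<rho> \<in> wpartitions n" and le: "wle n \<pi> \<rho>"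
  shows "wle n (perm_wpart \<sigma> \<pi>) (perm_wpart \<sigma> \<rho>)"
  unfolding wle_iff[OF perm_wpart_in[OF \<sigma> wp(1)] perm_wpart_in[OF \<sigma> wp(2)]]
proof (intro conjI allI impI)
  fix A a assume "(A, a) \<in> perm_wpart \<sigma> \<pi>"
  then obtain B where B: "(B, a) \<in> \<pi>" "A = \<sigma> ` B" by (auto simp: in_perm_wpart)
  from wle_sub[OF wp le B(1)] obtain C v where "(C, v) \<in> \<rho>" "B \<subseteq> C" .
  then have "(\<sigma> ` C, v) \<in> perm_wpart \<sigma> \<rho>" "A \<subseteq> \<sigma> ` C" using B(2) by (auto simp: in_perm_wpart)
  then show "\<exists>C v. (C, v) \<in> perm_wpart \<sigma> \<rho> \<and> A \<subseteq> C" by blast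
next
  fix C v assume "(C, v) \<in> perm_wpart \<sigma> \<rho>"
  then obtain B where B: "(B, v) \<in> \<rho>" "C = \<sigma> ` B" by (auto simp: in_perm_wpart)
  have inj: "inj_on (\<lambda>(B, v). (\<sigma> ` B, v)) (parts_in \<pi> B)"
    by (auto intro!: inj_onI simp: permutes_image_inj[OF \<sigma>])
  have "wsum (perm_wpart \<sigma> \<pi>) C = wsum \<pi> B"
    unfolding wsum_def B(2) parts_in_perm[OF \<sigma>] unfolding perm_wpart_def
    by (subst sum.reindex[OF inj]) (simp add: split_beta)
  moreover have "card (parts_in (perm_wpart \<sigma> \<pi>) C) = card (parts_in \<pi> B)"
    unfolding B(2) parts_in_perm[OF \<sigma>] unfolding perm_wpart_def by (rule card_image[OF inj])
  ultimately show "wsum (perm_wpart \<sigma> \<pi>) C \<le> int v"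
    "int v < wsum (perm_wpart \<sigma> \<pi>) C + int (card (parts_in (perm_wpart \<sigma> \<pi>) C))"
    using le B(1) unfolding wle_iff[OF wp] by auto
qed

lemma lt_perm:
  assumes \<sigma>: "\<sigma> permutes {1..n}" and wp: "\<pi> \<in> wpartitions n" "\<rho> \<in> wpartitions n"
  shows "lt_of (wle n) (perm_wpart \<sigma> \<pi>) (perm_wpart \<sigma> \<rho>) \<longleftrightarrow> lt_of (wle n) \<pi> \<rho>"
proof -
  have "wle n \<pi> \<rho>" if "wle n (perm_wpart \<sigma> \<pi>) (perm_wpart \<sigma> \<rho>)"
    using wle_perm[OF permutes_inv[OF \<sigma>] perm_wpart_in[OF \<sigma> wp(1)] perm_wpart_in[OF \<sigma> wp(2)] that]
    by (simp add: perm_wpart_inv'[OF \<sigma>])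
  then show ?thesis
    unfolding lt_of_def using wle_perm[OF \<sigma> wp] inj_eq[OF inj_perm_wpart[OF \<sigma>]] by blast
qed

lemma perm_wbot: "\<sigma> permutes {1..n} \<Longrightarrow> perm_wpart \<sigma> (wbot n) = wbot n"
proof -
  assume \<sigma>: "\<sigma> permutes {1..n}"
  have "perm_wpart \<sigma> (wbot n) = (\<lambda>x. ({x}, 0)) ` \<sigma> ` {1..n}"
    by (simp add: perm_wpart_def wbot_def image_image)
  then show ?thesis unfolding permutes_image[OF \<sigma>] by (simp only: wbot_def)
qed

lemma perm_wtop: "\<sigma> permutes {1..n} \<Longrightarrow> perm_wpart \<sigma> (wtop n i) = wtop n i"
  by (simp add: perm_wpart_def wtop_def permutes_image)

lemma perm_wint:
  assumes \<sigma>: "\<sigma> permutes {1..n}" and "n \<ge> 1" "i \<le> n - 1"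
  shows "a \<in> wint n i \<Longrightarrow> perm_wpart \<sigma> a \<in> wint n i"
  unfolding open_interval_def
  using perm_wpart_in[OF \<sigma>] lt_perm[OF \<sigma> wbot_in, of a] lt_perm[OF \<sigma> _ wtop_in[OF assms(2,3)], of a]
  by (simp add: perm_wbot[OF \<sigma>] perm_wtop[OF \<sigma>])

lemma insertable_perm:
  assumes \<sigma>: "\<sigma> permutes {1..n}" and n: "n \<ge> 1" "i \<le> n - 1" and xs: "set xs \<subseteq> wpartitions n" and j: "j \<le> length xs"
  shows "insertable (wint n i) (wle n) (map (perm_wpart \<sigma>) xs) j = perm_wpart \<sigma> ` insertable (wint n i) (wle n) xs j"
proof -
  let ?f = "perm_wpart \<sigma>"
  have wi: "a \<in> wpartitions n" if "a \<in> wint n i" for a using that by (simp add: open_interval_def)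
  have nth: "xs ! k \<in> wpartitions n" if "k < length xs" for k using xs nth_mem[OF that] by blast
  have *: "?f a \<in> insertable (wint n i) (wle n) (map ?f xs) j \<longleftrightarrow> a \<in> insertable (wint n i) (wle n) xs j"
    if a: "a \<in> wint n i" for a
  proof -
    have "0 < j \<Longrightarrow> lt_of (wle n) (map ?f xs ! (j - 1)) (?f a) \<longleftrightarrow> lt_of (wle n) (xs ! (j - 1)) a"
      using lt_perm[OF \<sigma> nth wi[OF a], of "j - 1"] j by simp
    moreover have "j < length xs \<Longrightarrow> lt_of (wle n) (?f a) (map ?f xs ! j) \<longleftrightarrow> lt_of (wle n) a (xs ! j)"
      using lt_perm[OF \<sigma> wi[OF a] nth, of j] by simp
    ultimately show ?thesis
      unfolding insertable_def using a perm_wint[OF \<sigma> n a] by auto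
  qed
  show ?thesis
  proof (intro set_eqI iffI)
    fix b assume b: "b \<in> insertable (wint n i) (wle n) (map ?f xs) j"
    then have "b \<in> wint n i" by (simp add: insertable_def)
    then have "perm_wpart (inv \<sigma>) b \<in> wint n i" by (rule perm_wint[OF permutes_inv[OF \<sigma>] n])
    from *[OF this] b show "b \<in> ?f ` insertable (wint n i) (wle n) xs j"
      unfolding perm_wpart_inv[OF \<sigma>] by (metis image_eqI perm_wpart_inv[OF \<sigma>])
  next
    fix b assume "b \<in> ?f ` insertable (wint n i) (wle n) xs j"
    then obtain a where a: "a \<in> insertable (wint n i) (wle n) xs j" "b = ?f a" by blast
    then have "a \<in> wint n i" by (simp add: insertable_def)
    from *[OF this] a show "b \<in> insertable (wint n i) (wle n) (map ?f xs) j" by simp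
  qed
qed

abbreviation perm_chains :: "(nat \<Rightarrow> nat) \<Rightarrow> (('k::field) chain_vecs) \<Rightarrow> ('k chain_vecs)" where
  "perm_chains \<sigma> \<equiv> lin_ext (\<lambda>xs. basis_vec (map (perm_wpart \<sigma>) xs))"

text \<open>The action maps the elements insertable at a position bijectively to those insertable
  into the image chain at the same position.\<close>

lemma cobdry_perm_basis:
  assumes \<sigma>: "\<sigma> permutes {1..n}" and n: "n \<ge> 1" "i \<le> n - 1" and xs: "set xs \<subseteq> wpartitions n"
  shows "perm_chains \<sigma> (cobdry (wint n i) (wle n) (basis_vec xs))
    = cobdry (wint n i) (wle n) (basis_vec (map (perm_wpart \<sigma>) xs))"
proof -
  let ?f = "perm_wpart \<sigma>"
  have inj: "inj_on ?f S" for S using inj_perm_wpart[OF \<sigma>] by (rule inj_on_subset) simp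
  show ?thesis
    unfolding cobdry_basis lin_ext_sum lin_ext_scale lin_ext_basis length_map
  proof (rule sum.cong[OF refl])
    fix j assume "j \<in> {0..length xs}"
    then have j: "j \<le> length xs" by simp
    show "(\<Sum>a\<in>insertable (wint n i) (wle n) xs j. fscale ((- 1) ^ j) (basis_vec (map ?f (take j xs @ a # drop j xs))))
      = (\<Sum>a\<in>insertable (wint n i) (wle n) (map ?f xs) j.
          fscale ((- 1) ^ j) (basis_vec (take j (map ?f xs) @ a # drop j (map ?f xs))))"
      unfolding insertable_perm[OF \<sigma> n xs j] sum.reindex[OF inj] by (simp add: take_map drop_map)
  qed
qed

lemma perm_chain_in:
  assumes \<sigma>: "\<sigma> permutes {1..n}" and n: "n \<ge> 1" "i \<le> n - 1" and xs: "xs \<in> chains (wint n i) (wle n) r"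
  shows "map (perm_wpart \<sigma>) xs \<in> chains (wint n i) (wle n) r"
proof -
  have sub: "set xs \<subseteq> wint n i" and so: "sorted_wrt (lt_of (wle n)) xs" and len: "int (length xs) = r + 1"
    using xs by (simp_all add: chains_def)
  have sub': "set xs \<subseteq> wpartitions n" using sub by (auto simp: open_interval_def)
  have "sorted_wrt (\<lambda>x y. lt_of (wle n) (perm_wpart \<sigma> x) (perm_wpart \<sigma> y)) xs"
    by (rule sorted_wrt_mono_rel[OF _ so]) (use sub' lt_perm[OF \<sigma>] in blast)
  then show ?thesis using sub perm_wint[OF \<sigma> n] len by (auto simp: chains_def sorted_wrt_map)
qed

lemma perm_chains_cobdries:
  assumes \<sigma>: "\<sigma> permutes {1..n}" and n: "n \<ge> 1" "i \<le> n - 1" and p: "p \<in> (wcobdries n i :: (('k::field) chain_vecs) set)"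
  shows "perm_chains \<sigma> p \<in> wcobdries n i"
proof (cases "n = 1")
  case True
  then have "wbot n = wtop n i" using n by (simp add: wbot_def wtop_def)
  then show ?thesis using p by (simp add: int_cobdries_def)
next
  case False
  then have n2: "n \<ge> 2" using n by simp
  let ?C = "cochains (wint n i) (wle n) (int n - 4) :: ('k chain_vecs) set"
  obtain q where q: "q \<in> ?C" "p = cobdry (wint n i) (wle n) q"
    using p unfolding wcobdries_eq[OF n2] by blast
  show ?thesis unfolding q(2)
  proof (rule linear_image_in_subspace[OF subspace_cobdries _ _ q(1)[unfolded cochains_def]])
    fix xs assume xs: "xs \<in> chains (wint n i) (wle n) (int n - 4)"
    then have "set xs \<subseteq> wpartitions n" by (auto simp: chains_def open_interval_def)
    from cobdry_perm_basis[OF \<sigma> n this]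
    have eq: "perm_chains \<sigma> (cobdry (wint n i) (wle n) (basis_vec xs))
      = (cobdry (wint n i) (wle n) (basis_vec (map (perm_wpart \<sigma>) xs)) :: 'k chain_vecs)" .
    have "basis_vec (map (perm_wpart \<sigma>) xs) \<in> ?C"
      unfolding cochains_def using perm_chain_in[OF \<sigma> n xs] by (intro fvs.span_base) simp
    then show "perm_chains \<sigma> (cobdry (wint n i) (wle n) (basis_vec xs)) \<in> (wcobdries n i :: ('k chain_vecs) set)"
      unfolding eq wcobdries_eq[OF n2] by (rule imageI)
  qed simp_all
qed

section \<open>The symmetric group acting on brackets\<close>

abbreviation relabel :: "(nat \<Rightarrow> nat) \<Rightarrow> (('k::field) bracket_vec) \<Rightarrow> ('k bracket_vec)" where
  "relabel \<sigma> \<equiv> lin_ext (\<lambda>m. basis_vec (map_bracketing \<sigma> m))"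

lemma letters_map: "letters (map_bracketing f m) = map f (letters m)"
  by (induction m) simp_all

lemma relabel_br: "relabel \<sigma> (br c x y) = br c (relabel \<sigma> x) (relabel \<sigma> y)"
proof (rule lin_eq_if_basis_eq[where p = x])
  fix s
  show "relabel \<sigma> (br c (basis_vec s) y) = br c (relabel \<sigma> (basis_vec s)) (relabel \<sigma> y)"
    by (rule lin_eq_if_basis_eq[where p = y]) simp_all
qed simp_all

lemma subspace_free_alg: "fvs.subspace (free_alg A :: ('a bracketing \<Rightarrow>\<^sub>0 'b::field) set)"
proof (rule fvs.subspaceI)
  show "0 \<in> free_alg A" by (simp add: free_alg_def)
  fix x y :: "'a bracketing \<Rightarrow>\<^sub>0 'b" assume "x \<in> free_alg A" "y \<in> free_alg A"
  then show "x + y \<in> free_alg A" using keys_add[of x y] by (auto simp: free_alg_def)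
qed (rule scale_in_free_alg)

lemma relabel_free_alg:
  assumes "\<sigma> permutes A" "x \<in> free_alg A"
  shows "relabel \<sigma> x \<in> free_alg A"
proof (rule linear_image_in_subspace[where F = "relabel \<sigma>" and p = x
      and X = "{m. lset m \<subseteq> A}", OF subspace_free_alg])
  show "x \<in> fspan (basis_vec ` {m. lset m \<subseteq> A})"
    using assms(2) by (intro in_span_basis) (auto simp: free_alg_def)
  fix m assume "m \<in> {m. lset m \<subseteq> A}"
  then show "relabel \<sigma> (basis_vec m) \<in> free_alg A"
    using permutes_in_image[OF assms(1)] by (auto simp: letters_map)
qed simp_all

text \<open>Relabeling is a homomorphism for both brackets and preserves the free algebra, so it
  sends each defining relation to one of the same kind.\<close>

lemma relabel_ideal:
  assumes "\<sigma> permutes A" "p \<in> (lie2_ideal A :: (('k::field) bracket_vec) set)"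
  shows "relabel \<sigma> p \<in> lie2_ideal A"
  using assms(2)
proof induction
  case (antisym x y c)
  then show ?case using lie2_ideal.antisym[OF relabel_free_alg[OF assms(1)] relabel_free_alg[OF assms(1)]]
    by (simp add: relabel_br)
next
  case (jacobi x y z c)
  then show ?case using lie2_ideal.jacobi[OF relabel_free_alg[OF assms(1)] relabel_free_alg[OF assms(1)] relabel_free_alg[OF assms(1)]]
    by (simp add: relabel_br)
next
  case (mixed_jacobi x y z)
  then show ?case using lie2_ideal.mixed_jacobi[OF relabel_free_alg[OF assms(1)] relabel_free_alg[OF assms(1)] relabel_free_alg[OF assms(1)]]
    by (simp add: relabel_br)
next
  case zero
  then show ?case by (simp add: lie2_ideal.zero)
next
  case (add p q)
  then show ?case by (simp add: lie2_ideal.add)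
next
  case (scale p a)
  then show ?case by (simp add: lie2_ideal.scale)
next
  case (br_left p x c)
  then show ?case by (simp add: relabel_br lie2_ideal.br_left relabel_free_alg[OF assms(1)])
next
  case (br_right p x c)
  then show ?case by (simp add: relabel_br lie2_ideal.br_right relabel_free_alg[OF assms(1)])
qed

definition map_node :: "(nat \<Rightarrow> nat) \<Rightarrow> node \<Rightarrow> node" where
  "map_node \<sigma> x = (\<sigma> ` fst x, snd x)"

lemma post_map: "post (map_bracketing \<sigma> m) = map (map_node \<sigma>) (post m)"
  by (induction m) (simp_all add: map_node_def letters_map image_Un)

lemma bsgn_map: "bsgn (map_bracketing \<sigma> m) = bsgn m"
  by (induction m) (simp_all add: post_map)

lemma red_map: "red_brackets (map_bracketing \<sigma> m) = red_brackets m"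
  by (induction m) simp_all

text \<open>Blocks and red counts are defined by inclusions and colors, which an injective
  relabeling preserves; the singletons are permuted.\<close>

lemma forest_wpart_map:
  assumes \<sigma>: "\<sigma> permutes {1..n}"
  shows "forest_wpart n (map_node \<sigma> ` F) = perm_wpart \<sigma> (forest_wpart n F)"
proof -
  have fstF: "fst ` map_node \<sigma> ` F = (`) \<sigma> ` fst ` F" by (simp add: map_node_def image_image)
  have sing: "(\<lambda>x. {x}) ` {1..n} = (`) \<sigma> ` (\<lambda>x. {x}) ` {1..n}"
  proof -
    have "(`) \<sigma> ` (\<lambda>x. {x}) ` {1..n} = (\<lambda>x. {x}) ` \<sigma> ` {1..n}" by (simp add: image_image)
    then show ?thesis unfolding permutes_image[OF \<sigma>] by (rule sym)
  qed
  have b: "blocks n (map_node \<sigma> ` F) = (`) \<sigma> ` blocks n F"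
  proof -
    have un: "fst ` map_node \<sigma> ` F \<union> (\<lambda>x. {x}) ` {1..n} = (`) \<sigma> ` (fst ` F \<union> (\<lambda>x. {x}) ` {1..n})"
      unfolding image_Un fstF sing[symmetric] ..
    have max: "(\<forall>Y\<in>fst ` map_node \<sigma> ` F. \<sigma> ` X \<subseteq> Y \<longrightarrow> \<sigma> ` X = Y) \<longleftrightarrow> (\<forall>Y\<in>fst ` F. X \<subseteq> Y \<longrightarrow> X = Y)" for X
      unfolding fstF by (simp add: permutes_image_subset[OF \<sigma>] permutes_image_inj[OF \<sigma>])
    have col: "{X \<in> f ` U. P X} = f ` {X \<in> U. P (f X)}" for f :: "nat set \<Rightarrow> nat set" and U P by auto
    show ?thesis unfolding blocks_def un col max ..
  qed
  have inj: "inj_on (map_node \<sigma>) S" for S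
    by (auto intro!: inj_onI simp: map_node_def permutes_image_inj[OF \<sigma>] prod_eq_iff)
  have r: "red_wt (map_node \<sigma> ` F) (\<sigma> ` X) = red_wt F X" for X
  proof -
    have "{y \<in> map_node \<sigma> ` F. snd y = Red \<and> fst y \<subseteq> \<sigma> ` X} = map_node \<sigma> ` {y \<in> F. snd y = Red \<and> fst y \<subseteq> X}"
    proof -
      have "{y \<in> f ` U. P y} = f ` {y \<in> U. P (f y)}" for f :: "node \<Rightarrow> node" and U P by auto
      moreover have "snd (map_node \<sigma> y) = snd y" "fst (map_node \<sigma> y) \<subseteq> \<sigma> ` X \<longleftrightarrow> fst y \<subseteq> X" for y
        by (simp_all add: map_node_def permutes_image_subset[OF \<sigma>])
      ultimately show ?thesis by (simp only:)
    qed
    then show ?thesis unfolding red_wt_def by (simp add: card_image[OF inj])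
  qed
  show ?thesis unfolding forest_wpart_def b perm_wpart_def by (simp add: image_image r)
qed

lemma chain_from_map:
  assumes "\<sigma> permutes {1..n}"
  shows "chain_from n (map_node \<sigma> ` F) (map (map_node \<sigma>) L) = map (perm_wpart \<sigma>) (chain_from n F L)"
proof (induction L arbitrary: F)
  case (Cons x L)
  from Cons.IH[of "insert x F"] show ?case by (simp add: forest_wpart_map[OF assms])
qed (simp add: forest_wpart_map[OF assms])

lemma chain_vec_map:
  assumes "\<sigma> permutes {1..n}"
  shows "chain_vec n (map (map_node \<sigma>) L) = perm_chains \<sigma> (chain_vec n L)"
  using chain_from_map[OF assms, of "{}" L] by (simp add: chain_vec_def bar_def map_butlast map_tl)

lemma perm_bracket_map:
  assumes \<sigma>: "\<sigma> permutes {1..n}" and m: "perm_bracket n m"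
  shows "perm_bracket n (map_bracketing \<sigma> m)"
  using m permutes_image[OF \<sigma>] permutes_inj_on[OF \<sigma>] by (simp add: perm_bracket_def letters_map distinct_map)

text \<open>Postorder and the sign of the tree do not see the labels, and the sign of the letters
  changes by that of \<open>\<sigma>\<close>. The sign is taken in the form
  \<open>lsgn (letters m) * bsgn m\<close>, because relabeling does not preserve the order of the
  node keys.\<close>

lemma lie_to_chain_equivariant:
  assumes \<sigma>: "\<sigma> permutes {1..n}" and v: "v \<in> (fspan (basis_vec ` bracketed_perms n i) :: (('k::field) bracket_vec) set)"
  shows "lie_to_chain n i (relabel \<sigma> v) = fscale (of_int (sign \<sigma>)) (perm_chains \<sigma> (lie_to_chain n i v))"
proof -
  have "lie_to_chain n i (relabel \<sigma> v) - fscale (of_int (sign \<sigma>)) (perm_chains \<sigma> (lie_to_chain n i v)) \<in> {0}"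
  proof (rule linear_image_in_subspace[OF subspace_zero_set _ _ v])
    fix m assume "m \<in> bracketed_perms n i"
    then have m: "perm_bracket n m" "red_brackets m = i" by (simp_all add: bracketed_perms_eq)
    note m' = perm_bracket_map[OF \<sigma> m(1)]
    have s: "lsgn (letters (map_bracketing \<sigma> m)) = sign \<sigma> * lsgn (letters m)"
      unfolding letters_map using m(1) by (intro lsgn_map_permutes[OF \<sigma>]) (simp_all add: perm_bracket_def)
    have "lie_to_chain n i (basis_vec (map_bracketing \<sigma> m)) = fscale (of_int (sign \<sigma>))
        (perm_chains \<sigma> (lie_to_chain n i (basis_vec m)) :: 'k chain_vecs)"
      by (simp add: lie_to_chain_basis[OF m(1), unfolded m(2)] lie_to_chain_basis[OF m', unfolded red_map m(2)] s bsgn_map post_map chain_vec_map[OF \<sigma>] mult.assoc)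
    then show "lie_to_chain n i (relabel \<sigma> (basis_vec m)) - fscale (of_int (sign \<sigma>))
        (perm_chains \<sigma> (lie_to_chain n i (basis_vec m))) \<in> {0 :: 'k chain_vecs}" by simp
  qed (simp_all add: fvs.scale_right_distrib fvs.scale_right_diff_distrib mult.commute)
  then show ?thesis by simp
qed

section \<open>Postorder merges of a tree\<close>

lemma iterates_append:
  "iterates x (fs @ gs) = butlast (iterates x fs) @ iterates (last (iterates x fs)) gs"
proof (induction fs arbitrary: x)
  case (Cons f fs)
  have "iterates (f x) fs \<noteq> []" by (cases fs) simp_all
  with Cons show ?case by simp
qed simp

lemma chain_from_append':
  "chain_from n F (P @ Q) = butlast (chain_from n F P) @ chain_from n (F \<union> set P) Q"
proof (induction P arbitrary: F)
  case (Cons x P)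
  have "chain_from n (insert x F) P \<noteq> []" by (cases P) simp_all
  with Cons show ?case by simp
qed simp

text \<open>Generalized to a subbracketing \<open>g\<close> after a prefix \<open>P\<close> of
  merges, because the merges of a right child start from the partition left by those of its
  sibling.\<close>

lemma iterates_postorder:
  assumes m: "perm_bracket n (fill K g)" and le: "linear_ext (fill K g) (P @ post g @ Q)"
  shows "iterates (forest_wpart n (set P)) (postorder_merges g) = chain_from n (set P) (post g)"
  using assms
proof (induction g arbitrary: K P Q)
  case (Bracket c s t)
  let ?x = "(lset s \<union> lset t, c)"
  have IH1: "iterates (forest_wpart n (set P)) (postorder_merges s) = chain_from n (set P) (post s)"
    using Bracket.IH(1)[of "comp_ctx K (CtxL c Hole t)" P "post t @ ?x # Q"] Bracket.prems by (simp add: fill_comp_ctx)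
  have IH2: "iterates (forest_wpart n (set (P @ post s))) (postorder_merges t) = chain_from n (set (P @ post s)) (post t)"
    using Bracket.IH(2)[of "comp_ctx K (CtxR c s Hole)" "P @ post s" "?x # Q"] Bracket.prems by (simp add: fill_comp_ctx)
  have le: "linear_ext (fill K (Bracket c s t)) ((P @ post s @ post t) @ ?x # Q)" using Bracket.prems(2) by simp
  have blk: "lset s \<in> blocks n (set (P @ post s @ post t))" "lset t \<in> blocks n (set (P @ post s @ post t))"
    by (rule child_block[OF Bracket.prems(1) le])+
  have D: "lset s \<inter> lset t = {}"
    using Bracket.prems(1) by (auto simp: perm_bracket_def letters_fill)
  have ne: "lset s \<noteq> lset t" using letters_not_subset(1)[OF D] by auto
  have "merge (u_color c) (lset s) (lset t) (forest_wpart n (set (P @ post s @ post t)))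
      = forest_wpart n (insert ?x (set (P @ post s @ post t)))"
    using forest_wpart_insert(1)[OF good_prefix[OF Bracket.prems(1) le] blk ne, of c] by simp
  then show ?case using IH1 IH2
    by (simp add: iterates_append chain_from_append' last_chain_from Un_assoc)
qed simp

lemma iterates_postorder_full:
  assumes m: "perm_bracket n m"
  shows "iterates (wbot n) (postorder_merges m) = chain_from n {} (post m)"
proof -
  have d: "distinct (letters m)" using m by (simp add: perm_bracket_def)
  have 1: "perm_bracket n (fill Hole m)" using m by simp
  have 2: "linear_ext (fill Hole m) ([] @ post m @ [])" using linear_ext_post[OF d] by simp
  show ?thesis using iterates_postorder[OF 1 2] by (simp only: forest_wpart_empty list.set)
qed

lemma max_chain_eq:
  assumes "perm_bracket n (bracket_of T \<sigma>)"
  shows "max_chain n T \<sigma> = chain_from n {} (post (bracket_of T \<sigma>))"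
  unfolding max_chain_def by (rule iterates_postorder_full[OF assms])

lemma letters_label_from: "letters (label_from j T \<sigma>) = map \<sigma> [j..<j + leaf_count T]"
proof (induction T arbitrary: j)
  case (Node c l r)
  have "[j..<j + leaf_count (Node c l r)] = [j..<j + leaf_count l] @ [j + leaf_count l..<j + leaf_count l + leaf_count r]"
    using upt_add_eq_append[of j "j + leaf_count l" "leaf_count r"] by (simp add: add.assoc)
  with Node show ?case by simp
qed simp

lemma length_post_label_from: "length (post (label_from j T \<sigma>)) = internal_count T"
  by (induction T arbitrary: j) simp_all

lemma bsgn_label_from: "bsgn (label_from j T \<sigma>) = tree_sgn T"
  by (induction T arbitrary: j) (simp_all add: length_post_label_from)

lemma red_label_from: "red_brackets (label_from j T \<sigma>) = red_count T"
  by (induction T arbitrary: j) simp_all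

lemma bracket_of_BT:
  assumes "(T, \<sigma>) \<in> BT n i"
  shows "perm_bracket n (bracket_of T \<sigma>)" "red_brackets (bracket_of T \<sigma>) = i"
    and "lsgn (letters (bracket_of T \<sigma>)) * bsgn (bracket_of T \<sigma>) = sign \<sigma> * tree_sgn T"
proof -
  have T: "leaf_count T = n" "red_count T = i" and \<sigma>: "\<sigma> permutes {1..n}" using assms by (auto simp: BT_def)
  have l: "letters (bracket_of T \<sigma>) = map \<sigma> [1..<Suc n]" by (simp add: bracket_of_def letters_label_from T)
  have s: "set [1..<Suc n] = {1..n}" by auto
  show "perm_bracket n (bracket_of T \<sigma>)"
    unfolding perm_bracket_def l using permutes_inj_on[OF \<sigma>] permutes_image[OF \<sigma>] s
    by (simp add: distinct_map del: upt_Suc)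
  show "red_brackets (bracket_of T \<sigma>) = i" by (simp add: bracket_of_def red_label_from T)
  have "lsgn (map \<sigma> [1..<Suc n]) = sign \<sigma> * lsgn [1..<Suc n]"
    by (rule lsgn_map_permutes[OF \<sigma> _ _ s]) (simp_all del: upt_Suc)
  moreover have "lsgn [1..<Suc n] = 1" by (rule lsgn_sorted) (simp del: upt_Suc)
  ultimately show "lsgn (letters (bracket_of T \<sigma>)) * bsgn (bracket_of T \<sigma>) = sign \<sigma> * tree_sgn T"
    unfolding l by (simp add: bracket_of_def bsgn_label_from del: upt_Suc)
qed

text \<open>Filtering out the ends agrees with removing the first and the last position, as the
  inner elements lie strictly between them; for \<open>n = 1\<close> both give the empty
  list.\<close>

lemma bar_chain_eq:
  assumes n: "n \<ge> 1" and T: "(T, \<sigma>) \<in> BT n i"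
  shows "bar_chain n i T \<sigma> = bar (chain_from n {} (post (bracket_of T \<sigma>)))"
proof -
  note b = bracket_of_BT[OF T]
  have le: "linear_ext (bracket_of T \<sigma>) (post (bracket_of T \<sigma>))"
    using b(1) by (simp add: perm_bracket_def linear_ext_post)
  have mc: "chain_from n {} (post (bracket_of T \<sigma>)) \<in> max_chains n i"
    using chain_from_max[OF n b(1) le] unfolding b(2) .
  show ?thesis
  proof (cases "n = 1")
    case True
    then have "post (bracket_of T \<sigma>) = []" using linear_ext_length[OF b(1) le] by simp
    then show ?thesis unfolding bar_chain_def max_chain_eq[OF b(1)] by (simp add: forest_wpart_empty bar_def)
  next
    case False
    then have n2: "n \<ge> 2" using n by simp
    let ?cs = "chain_from n {} (post (bracket_of T \<sigma>))"
    have cs: "?cs = wbot n # bar ?cs @ [wtop n i]" by (rule max_chain_bar[OF n2 mc])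
    have "sorted_wrt (lt_of (wle n)) (wbot n # bar ?cs @ [wtop n i])"
      using mc unfolding max_chains_def by (subst cs[symmetric]) simp
    then have "\<forall>x\<in>set (bar ?cs). x \<notin> {wbot n, wtop n i}"
      by (auto simp: sorted_wrt_append lt_of_def)
    then have "filter (\<lambda>\<pi>. \<pi> \<notin> {wbot n, wtop n i}) (wbot n # bar ?cs @ [wtop n i]) = bar ?cs" by simp
    then show ?thesis unfolding bar_chain_def max_chain_eq[OF b(1)] using cs by simp
  qed
qed

section \<open>Bracketed permutations as labeled trees\<close>

fun shape :: "'a bracketing \<Rightarrow> bctree" where
  "shape (Letter a) = Tip"
| "shape (Bracket c s t) = Node c (shape s) (shape t)"

lemma leaf_count_shape: "leaf_count (shape m) = length (letters m)"
  by (induction m) simp_all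

lemma red_count_shape: "red_count (shape m) = red_brackets m"
  by (induction m) simp_all

lemma label_from_shape:
  "(\<And>k. k < length (letters m) \<Longrightarrow> \<sigma> (j + k) = letters m ! k) \<Longrightarrow> label_from j (shape m) \<sigma> = m"
proof (induction m arbitrary: j)
  case (Letter a)
  from Letter[of 0] show ?case by simp
next
  case (Bracket c s t)
  have "label_from j (shape s) \<sigma> = s"
  proof (rule Bracket.IH(1))
    fix k assume "k < length (letters s)"
    then show "\<sigma> (j + k) = letters s ! k" using Bracket.prems[of k] by (simp add: nth_append)
  qed
  moreover have "label_from (j + length (letters s)) (shape t) \<sigma> = t"
  proof (rule Bracket.IH(2))
    fix k assume "k < length (letters t)"
    then show "\<sigma> (j + length (letters s) + k) = letters t ! k"
      using Bracket.prems[of "length (letters s) + k"] by (simp add: nth_append add.assoc)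
  qed
  ultimately show ?case by (simp add: leaf_count_shape)
qed

text \<open>The labeled trees reach every bracketed permutation, so the formula of the theorem fixes
  the map on a spanning set. This is what uniqueness rests on.\<close>

lemma bracketed_perm_BT:
  assumes "m \<in> bracketed_perms n i"
  obtains T \<sigma> where "(T, \<sigma>) \<in> BT n i" "bracket_of T \<sigma> = m"
proof -
  have d: "distinct (letters m)" and s: "lset m = {1..n}" and r: "red_brackets m = i"
    using assms by (simp_all add: bracketed_perms_def)
  have len: "length (letters m) = n" using distinct_card[OF d] s by simp
  \<comment> \<open>Leaves are counted from 1 and list positions from 0. Outside
    \<open>{1..n}\<close> the identity is taken, as \<open>permutes\<close> demands.\<close>
  define \<sigma> where "\<sigma> = (\<lambda>j. if j \<in> {1..n} then letters m ! (j - 1) else j)"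
  have bij: "bij_betw \<sigma> {1..n} {1..n}"
    unfolding bij_betw_def
  proof
    show inj: "inj_on \<sigma> {1..n}"
    proof (rule inj_onI)
      fix a b assume ab: "a \<in> {1..n}" "b \<in> {1..n}" "\<sigma> a = \<sigma> b"
      then have "letters m ! (a - 1) = letters m ! (b - 1)" "a - 1 < length (letters m)" "b - 1 < length (letters m)"
        using len by (auto simp: \<sigma>_def)
      then have "a - 1 = b - 1" using nth_eq_iff_index_eq[OF d] by blast
      then show "a = b" using ab by auto
    qed
    have "\<sigma> ` {1..n} \<subseteq> {1..n}"
    proof
      fix y assume "y \<in> \<sigma> ` {1..n}"
      then obtain j where j: "j \<in> {1..n}" "y = letters m ! (j - 1)" by (auto simp: \<sigma>_def)
      then have "j - 1 < length (letters m)" using len by auto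
      then show "y \<in> {1..n}" unfolding j(2) s[symmetric] by (rule nth_mem)
    qed
    then show "\<sigma> ` {1..n} = {1..n}" using inj by (simp add: endo_inj_surj)
  qed
  have "\<sigma> permutes {1..n}" by (rule bij_imp_permutes[OF bij]) (auto simp: \<sigma>_def)
  moreover have "bracket_of (shape m) \<sigma> = m"
    unfolding bracket_of_def by (rule label_from_shape) (simp add: \<sigma>_def len)
  ultimately show thesis
    using that[of "shape m" \<sigma>] by (simp add: BT_def leaf_count_shape red_count_shape len r)
qed

theorem theorem4p5:
  fixes n i :: nat
  assumes "n \<ge> 1" and "i \<in> {0..n - 1}"
  defines "L \<equiv> (Lie2 n i :: ('k::field, (nat bracketing \<Rightarrow>\<^sub>0 'k) set) sn_rep)"
    and "H \<equiv> (HPi n i (int n - 3) :: ('k, (wpart list \<Rightarrow>\<^sub>0 'k) set) sn_rep)"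
  defines "formula \<equiv> (\<lambda>\<psi>. \<forall>(T, \<sigma>)\<in>BT n i.
      \<psi> (lie_class n (bracket_of T \<sigma>)) =
        rep_scale H (of_int (sign \<sigma> * tree_sgn T)) (coh_class n i (int n - 3) (bar_chain n i T \<sigma>)))"
  shows "\<exists>\<phi>. sn_module_iso n L (tensor_sgn H) \<phi> \<and> formula \<phi> \<and>
    (\<forall>\<psi>. rep_linear L (tensor_sgn H) \<psi> \<and> formula \<psi> \<longrightarrow> (\<forall>x\<in>rep_space L. \<psi> x = \<phi> x))"
proof -
  have n: "n \<ge> 1" "i \<le> n - 1" using assms(1,2) by simp_all
  define V :: "('k bracket_vec) set" where "V = fspan (basis_vec ` bracketed_perms n i)"
  define W :: "('k bracket_vec) set" where "W = lie2_ideal {1..n}"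
  define C :: "('k chain_vecs) set" where "C = wcocycles n i"
  define B :: "('k chain_vecs) set" where "B = wcobdries n i"
  define \<phi> where "\<phi> = (\<lambda>X. lie_to_chain n i ` X + B)"
  have L: "L = subquotient map_bracketing V W" by (simp add: L_def Lie2_def V_def W_def)
  have H: "H = subquotient (\<lambda>\<sigma>. map (perm_wpart \<sigma>)) C B" by (simp add: H_def HPi_def C_def B_def)
  have W: "fvs.subspace W" unfolding W_def by (rule subspace_lie2_ideal)
  have B: "fvs.subspace B" unfolding B_def by (rule subspace_cobdries)
  have iso: "sn_module_iso n L (tensor_sgn H) \<phi>"
    unfolding L H \<phi>_def
  proof (rule subquotient_iso(1)[OF W B, where G = "chain_to_lie n i"])
    show "lie_to_chain n i v \<in> C" if "v \<in> V" for v
      using that unfolding V_def C_def by (rule lie_to_chain_in_cocycles[OF n])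
    show "chain_to_lie n i c \<in> V" if "c \<in> C" for c
      using that unfolding V_def C_def by (rule chain_to_lie_in_span[OF n])
    show "lie_to_chain n i w \<in> B" if "w \<in> W" for w
      using that unfolding W_def B_def by (rule lie_to_chain_ideal)
    show "chain_to_lie n i b \<in> W" if "b \<in> B" for b
      using that unfolding W_def B_def by (rule chain_to_lie_cobdries[OF n])
    show "chain_to_lie n i (lie_to_chain n i v) - v \<in> W" if "v \<in> V" for v
      using that unfolding V_def W_def by (rule lie_to_chain_to_lie[OF n(1)])
    show "lie_to_chain n i (chain_to_lie n i c) - c \<in> B" if "c \<in> C" for c
      using that unfolding C_def B_def by (rule chain_to_lie_to_chain[OF n])
    fix \<sigma> assume \<sigma>: "\<sigma> permutes {1..n}"
    show "relabel \<sigma> w \<in> W" if "w \<in> W" for w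
      using that unfolding W_def by (rule relabel_ideal[OF \<sigma>])
    show "perm_chains \<sigma> b \<in> B" if "b \<in> B" for b
      using that unfolding B_def by (rule perm_chains_cobdries[OF \<sigma> n])
    show "lie_to_chain n i (relabel \<sigma> v) = fscale (of_int (sign \<sigma>)) (perm_chains \<sigma> (lie_to_chain n i v))"
      if "v \<in> V" for v
      using that unfolding V_def by (rule lie_to_chain_equivariant[OF \<sigma>])
  qed simp_all
  have cos: "\<phi> (v +o W) = lie_to_chain n i v +o B" for v
    unfolding \<phi>_def by (rule coset_image[OF B W]) (simp_all add: W_def B_def lie_to_chain_ideal)
  have form: "formula \<phi>"
    unfolding formula_def
  proof (intro ballI, clarify)
    fix T \<sigma> assume T: "(T, \<sigma>) \<in> BT n i"
    note b = bracket_of_BT[OF T]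
    have "lie_to_chain n i (basis_vec (bracket_of T \<sigma>))
        = (fscale (of_int (sign \<sigma> * tree_sgn T)) (basis_vec (bar_chain n i T \<sigma>)) :: 'k chain_vecs)"
      using lie_to_chain_basis[OF b(1)] unfolding b bar_chain_eq[OF n(1) T] chain_vec_def .
    then show "\<phi> (lie_class n (bracket_of T \<sigma>)) =
        rep_scale H (of_int (sign \<sigma> * tree_sgn T)) (coh_class n i (int n - 3) (bar_chain n i T \<sigma>))"
      unfolding lie_class_def coh_class_def W_def[symmetric] B_def[symmetric] cos H subquotient_simps
        coset_scale[OF B] by simp
  qed
  \<comment> \<open>Nothing is known about a competitor \<open>\<psi>\<close> outside the carrier,
    so the argument runs on representatives: the vectors of \<open>V\<close> whose cosets have the
    same image under both maps form a subspace, and it contains all bracketed permutations.\<close>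
  have uniq: "\<psi> x = \<phi> x" if lin: "rep_linear L (tensor_sgn H) \<psi>" and f: "formula \<psi>" and x: "x \<in> rep_space L" for \<psi> x
  proof -
    have lin': "rep_linear L (tensor_sgn H) \<phi>" using iso by (simp add: sn_module_iso_def)
    have add: "\<theta> ((u +o W) + (v +o W)) = \<theta> (u +o W) + \<theta> (v +o W)"
      if "rep_linear L (tensor_sgn H) \<theta>" "u \<in> V" "v \<in> V" for \<theta> u v
      using that unfolding rep_linear_def L H by simp
    have scale: "\<theta> (fscale c ` (v +o W) + W) = fscale c ` \<theta> (v +o W) + B"
      if "rep_linear L (tensor_sgn H) \<theta>" "v \<in> V" for \<theta> c v
      using that unfolding rep_linear_def L H by simp
    have coset: "\<exists>c. \<theta> (v +o W) = c +o B" if "rep_linear L (tensor_sgn H) \<theta>" "v \<in> V" for \<theta> v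
    proof -
      have "\<theta> (v +o W) \<in> (\<lambda>v. v +o B) ` C" using that unfolding rep_linear_def L H by simp
      then show ?thesis by blast
    qed
    let ?S = "{v \<in> V. \<psi> (v +o W) = \<phi> (v +o W)}"
    have V: "fvs.subspace V" unfolding V_def by (rule fvs.subspace_span)
    \<comment> \<open>The zero coset is reached as 0 times a coset. The added \<open>B\<close> in
      the scalar multiple makes the result the coset \<open>B\<close> instead of the set
      \<open>{0}\<close>.\<close>
    have zero: "\<theta> (0 +o W) = 0 +o B" if l: "rep_linear L (tensor_sgn H) \<theta>" for \<theta>
    proof -
      have "0 \<in> V" using V by (rule fvs.subspace_0)
      obtain c where c: "\<theta> (0 +o W) = c +o B" using coset[OF l \<open>0 \<in> V\<close>] by blast
      have "\<theta> (fscale 0 (0 :: 'k bracket_vec) +o W) = fscale 0 c +o B"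
        using scale[OF l \<open>0 \<in> V\<close>, of 0] unfolding c coset_scale[OF W] coset_scale[OF B] .
      then show ?thesis by (simp only: fvs.scale_zero_left)
    qed
    have S: "fvs.subspace ?S"
    proof (rule fvs.subspaceI)
      show "0 \<in> ?S" using fvs.subspace_0[OF V] zero[OF lin] zero[OF lin'] by simp
      fix u v assume "u \<in> ?S" "v \<in> ?S"
      then show "u + v \<in> ?S"
        using add[OF lin, of u v] add[OF lin', of u v] fvs.subspace_add[OF V] by (simp add: coset_add[OF W])
    next
      fix c v assume "v \<in> ?S"
      then show "fscale c v \<in> ?S"
        using scale[OF lin, of v c] scale[OF lin', of v c] fvs.subspace_scale[OF V] by (simp add: coset_scale[OF W])
    qed
    have "basis_vec m \<in> ?S" if m: "m \<in> bracketed_perms n i" for m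
    proof -
      obtain T \<sigma> where T: "(T, \<sigma>) \<in> BT n i" "bracket_of T \<sigma> = m" by (rule bracketed_perm_BT[OF m])
      have "\<psi> (lie_class n m) = \<phi> (lie_class n m)"
        using f form T unfolding formula_def by fastforce
      moreover have "basis_vec m \<in> V" unfolding V_def using m by (intro fvs.span_base) simp
      ultimately show ?thesis by (simp add: lie_class_def W_def)
    qed
    then have "V \<subseteq> ?S" unfolding V_def by (intro fvs.span_minimal S[unfolded V_def]) auto
    moreover obtain v where "v \<in> V" "x = v +o W" using x unfolding L by auto
    ultimately show ?thesis by blast
  qed
  show ?thesis using iso form uniq by blast
qed

end
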